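(* Let $W=\bigoplus_{k=1}^r V_{d_k}$ ($r\ge1$) be a finite-dimensional $\mathrm{SL}_2$-representation with $W^{\mathrm{SL}_2}=\{0\}$ (so all $d_k\ge1$), let $L\ge0$ be an integer, and set $\nu_{W,L}=L+1-\sum_{(k,i)\in\Lambda}a_{k,i}$. For $t_1,\dots,t_r\in\mathbb C$ with $0<|t_k|<1$ such that no denominator below vanishes, put $$F(t_1,\dots,t_r)=\sum_{(K,I)\in\Lambda}\ \sum_{\zeta^{a_{K,I}}=1}\frac{\zeta^{-L}t_K^{-L/a_{K,I}}-\zeta^{L+2}t_K^{(L+2)/a_{K,I}}}{a_{K,I}(1-t_K^2)\prod\limits_{d_k\in2\mathbb Z}(1-t_k)\prod\limits_{(k,i)\in\Lambda\smallsetminus\{(K,I)\}}\big(1-\zeta^{-a_{k,i}}t_kt_K^{-a_{k,i}/a_{K,I}}\big)\big(1-\zeta^{a_{k,i}}t_kt_K^{a_{k,i}/a_{K,I}}\big)}.$$ If $\nu_{W,L}\le0$, then the $(\mathbb Z_{\ge0})^r$-graded Hilbert series of the module of covariants $W\to V_L$ is $$\mathrm{Hilb}_{(\mathbb{C}[W]\otimes V_L)^{\mathrm{SL}_2}}(t_1,\dots,t_r)=F(t_1,\dots,t_r).$$ If $\nu_{W,L}>0$, then $$\mathrm{Hilb}_{(\mathbb{C}[W]\otimes V_L)^{\mathrm{SL}_2}}(t_1,\dots,t_r)=F(t_1,\dots,t_r)+\frac{(-1)^C}{\prod\limits_{d_k\in2\mathbb Z}(1-t_k)}\sum_S\ \prod_{(k,i)\in\Lambda}t_k^{I_{k,i}-J_{k,i}-1},$$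 where the sum runs over all $(I_{k,i},J_{k,i})_{(k,i)\in\Lambda}$ in $$S=\Big\{(I_{k,i},J_{k,i})_{(k,i)\in\Lambda}\in\mathbb{Z}_{\ge0}^{2C}\ :\ \sum_{(k,i)\in\Lambda}(I_{k,i}+J_{k,i})a_{k,i}=\nu_{W,L}-1\Big\}.$$
   Context: $V_d$ denotes the irreducible $\mathrm{SL}_2=\mathrm{SL}_2(\mathbb C)$-module of dimension $d+1$ (binary forms of degree $d$). Set $a_{k,i}=2i-d_k$ and $\Lambda=\{(k,i)\in\mathbb Z^2:1\le k\le r,\ \lfloor d_k/2\rfloor+1\le i\le d_k\}$, so that $(a_{k,i})_{(k,i)\in\Lambda}$ lists the positive weights of $W$ with multiplicity; $C=|\Lambda|$. Products over $d_k\in2\mathbb Z$ run over the indices $k\in\{1,\dots,r\}$ with $d_k$ even. $\mathbb C[W]\cong\bigotimes_{k=1}^r\mathbb C[V_{d_k}]$ is $(\mathbb Z_{\ge0})^r$-graded by the polynomial degrees in the individual summands, and $$\mathrm{Hilb}_{(\mathbb{C}[W]\otimes V_L)^{\mathrm{SL}_2}}(t_1,\dots,t_r)=\sum_{n_1,\dots,n_r\ge0}\dim_{\mathbb C}\big((\mathbb{C}[W]_{(n_1,\dots,n_r)}\otimes V_L)^{\mathrm{SL}_2}\big)\,t_1^{n_1}\cdots t_r^{n_r},$$ which converges for $|t_k|<1$. Fractional powers are $t_K^x=\exp(x\log t_K)$ for a fixed choice of $\log t_K$ for each $K$. The inner sum is over all complex $a_{K,I}$-th roots of unity $\zeta$.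 *)

theory Defs
  imports "HOL-Analysis.Analysis" "HOL-Library.Function_Algebras"
begin

definition fscale :: "complex \<Rightarrow> ('a \<Rightarrow> complex) \<Rightarrow> 'a \<Rightarrow> complex" where
  "fscale c f = (\<lambda>x. c * f x)"

interpretation fun_space: vector_space "fscale :: complex \<Rightarrow> ('a \<Rightarrow> complex) \<Rightarrow> 'a \<Rightarrow> complex"
  by unfold_locales (auto simp: fscale_def fun_eq_iff algebra_simps)

definition SL2 :: "(complex^2^2) set" where
  "SL2 = {g. det g = 1}"

type_synonym form = "complex^2 \<Rightarrow> complex"

definition binary_forms :: "nat \<Rightarrow> form set" where
  "binary_forms m = fun_space.span {(\<lambda>v. v $ 1 ^ i * v $ 2 ^ (m - i)) | i. i \<le> m}"

definition form_act :: "complex^2^2 \<Rightarrow> form \<Rightarrow> form" where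
  "form_act g f = (\<lambda>v. f (matrix_inv g *v v))"

(* The direct sum of the binary_forms (d k) for 1 <= k <= r, as tuples that are padded by 0
   outside {1..r}; the componentwise action respects the padding. *)
definition rep_space :: "nat \<Rightarrow> (nat \<Rightarrow> nat) \<Rightarrow> (nat \<Rightarrow> form) set" where
  "rep_space r d =
     {w. (\<forall>k\<in>{1..r}. w k \<in> binary_forms (d k)) \<and> (\<forall>k. k \<notin> {1..r} \<longrightarrow> w k = 0)}"

definition rep_act :: "complex^2^2 \<Rightarrow> (nat \<Rightarrow> form) \<Rightarrow> nat \<Rightarrow> form" where
  "rep_act g w = (\<lambda>k. form_act g (w k))"

definition rep_invariants :: "nat \<Rightarrow> (nat \<Rightarrow> nat) \<Rightarrow> (nat \<Rightarrow> form) set" where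
  "rep_invariants r d = {w \<in> rep_space r d. \<forall>g\<in>SL2. rep_act g w = w}"

(* The multidegree n part of C[W]: polynomial functions on W = rep_space r d (extended by 0
   outside W), spanned by the products having n k linear forms on the k-th summand for each k.
   Every linear form on a summand is the restriction of one on the space of all functions. *)
definition poly_functions ::
  "nat \<Rightarrow> (nat \<Rightarrow> nat) \<Rightarrow> (nat \<Rightarrow> nat) \<Rightarrow> ((nat \<Rightarrow> form) \<Rightarrow> complex) set" where
  "poly_functions r d n = fun_space.span
     {(\<lambda>w. if w \<in> rep_space r d then \<Prod>k=1..r. \<Prod>j<n k. l k j (w k) else 0) |
        l. \<forall>k j. Vector_Spaces.linear fscale (*) (l k j)}"

(* For spaces of functions A on X and B on Y, the canonical map from the tensor product of A and B
   to the functions on X \<times> Y is injective; this is its image. *)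
definition fun_tensor ::
  "('a \<Rightarrow> complex) set \<Rightarrow> ('b \<Rightarrow> complex) set \<Rightarrow> ('a \<times> 'b \<Rightarrow> complex) set" where
  "fun_tensor A B = fun_space.span {(\<lambda>(x, y). f x * h y) | f h. f \<in> A \<and> h \<in> B}"

(* The tensor product of the contragredient action on functions of w and form_act on functions
   of v. *)
definition tensor_act ::
  "complex^2^2 \<Rightarrow> ((nat \<Rightarrow> form) \<times> (complex^2) \<Rightarrow> complex) \<Rightarrow> (nat \<Rightarrow> form) \<times> (complex^2) \<Rightarrow> complex"
  where
  "tensor_act g \<Phi> = (\<lambda>(w, v). \<Phi> (rep_act (matrix_inv g) w, matrix_inv g *v v))"

definition covariants ::
  "nat \<Rightarrow> (nat \<Rightarrow> nat) \<Rightarrow> nat \<Rightarrow> (nat \<Rightarrow> nat) \<Rightarrow> ((nat \<Rightarrow> form) \<times> (complex^2) \<Rightarrow> complex) set" where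
  "covariants r d L n =
     {\<Phi> \<in> fun_tensor (poly_functions r d n) (binary_forms L). \<forall>g\<in>SL2. tensor_act g \<Phi> = \<Phi>}"

definition multidegrees :: "nat \<Rightarrow> (nat \<Rightarrow> nat) set" where
  "multidegrees r = {1..r} \<rightarrow>\<^sub>E UNIV"

definition hilb_term :: "nat \<Rightarrow> (nat \<Rightarrow> nat) \<Rightarrow> nat \<Rightarrow> (nat \<Rightarrow> complex) \<Rightarrow> (nat \<Rightarrow> nat) \<Rightarrow> complex"
  where
  "hilb_term r d L t n = of_nat (fun_space.dim (covariants r d L n)) * (\<Prod>k=1..r. t k ^ n k)"

definition Hilb :: "nat \<Rightarrow> (nat \<Rightarrow> nat) \<Rightarrow> nat \<Rightarrow> (nat \<Rightarrow> complex) \<Rightarrow> complex" where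
  "Hilb r d L t = (\<Sum>\<^sub>\<infinity>n\<in>multidegrees r. hilb_term r d L t n)"

definition wt :: "(nat \<Rightarrow> nat) \<Rightarrow> nat \<times> nat \<Rightarrow> int" where
  "wt d = (\<lambda>(k, i). 2 * int i - int (d k))"

definition Lam :: "nat \<Rightarrow> (nat \<Rightarrow> nat) \<Rightarrow> (nat \<times> nat) set" where
  "Lam r d = {(k, i). 1 \<le> k \<and> k \<le> r \<and> d k div 2 + 1 \<le> i \<and> i \<le> d k}"

definition nu :: "nat \<Rightarrow> (nat \<Rightarrow> nat) \<Rightarrow> nat \<Rightarrow> int" where
  "nu r d L = int L + 1 - (\<Sum>p\<in>Lam r d. wt d p)"

(* z to the power x, where u is the chosen logarithm of z *)
definition lpow :: "complex \<Rightarrow> complex \<Rightarrow> complex" where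
  "lpow u x = exp (x * u)"

definition even_prod :: "nat \<Rightarrow> (nat \<Rightarrow> nat) \<Rightarrow> (nat \<Rightarrow> complex) \<Rightarrow> complex" where
  "even_prod r d t = (\<Prod>k\<in>{k\<in>{1..r}. even (d k)}. 1 - t k)"

(* In summand_num, summand_den and residue_sum, the argument u consists of the chosen logarithms of the t k,
   and q is the pair (K, I). *)
definition summand_num :: "(nat \<Rightarrow> nat) \<Rightarrow> nat \<Rightarrow> (nat \<Rightarrow> complex) \<Rightarrow> nat \<times> nat \<Rightarrow> complex \<Rightarrow> complex" where
  "summand_num d L u q \<zeta> =
     \<zeta> powi (- int L) * lpow (u (fst q)) (- of_nat L / of_int (wt d q))
     - \<zeta> ^ (L + 2) * lpow (u (fst q)) (of_nat (L + 2) / of_int (wt d q))"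

definition summand_den ::
  "nat \<Rightarrow> (nat \<Rightarrow> nat) \<Rightarrow> (nat \<Rightarrow> complex) \<Rightarrow> (nat \<Rightarrow> complex) \<Rightarrow> nat \<times> nat \<Rightarrow> complex \<Rightarrow> complex"
  where
  "summand_den r d u t q \<zeta> =
     of_int (wt d q) * (1 - t (fst q) ^ 2) * even_prod r d t *
     (\<Prod>p\<in>Lam r d - {q}.
        (1 - \<zeta> powi (- wt d p) * t (fst p)
               * lpow (u (fst q)) (- of_int (wt d p) / of_int (wt d q))) *
        (1 - \<zeta> powi (wt d p) * t (fst p)
               * lpow (u (fst q)) (of_int (wt d p) / of_int (wt d q))))"

definition residue_sum ::
  "nat \<Rightarrow> (nat \<Rightarrow> nat) \<Rightarrow> nat \<Rightarrow> (nat \<Rightarrow> complex) \<Rightarrow> (nat \<Rightarrow> complex) \<Rightarrow> complex" where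
  "residue_sum r d L u t =
     (\<Sum>q\<in>Lam r d. \<Sum>\<zeta>\<in>{\<zeta>. \<zeta> powi (wt d q) = 1}. summand_num d L u q \<zeta> / summand_den r d u t q \<zeta>)"

(* finite, because all weights in Lam r d are positive *)
definition S_set :: "nat \<Rightarrow> (nat \<Rightarrow> nat) \<Rightarrow> nat \<Rightarrow> ((nat \<times> nat \<Rightarrow> nat) \<times> (nat \<times> nat \<Rightarrow> nat)) set" where
  "S_set r d L =
     {(I, J). I \<in> Lam r d \<rightarrow>\<^sub>E UNIV \<and> J \<in> Lam r d \<rightarrow>\<^sub>E UNIV \<and>
        (\<Sum>p\<in>Lam r d. int (I p + J p) * wt d p) = nu r d L - 1}"

end

theory Submission
  imports Defs "HOL-Complex_Analysis.Complex_Analysis"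
begin

unbundle no Formal_Power_Series.fps_syntax

text \<open>
  A covariant of order \<open>L\<close> is an invariant polynomial on \<open>V_1 \<oplus> W\<close> of degree \<open>L\<close> in the first summand.
  An invariant is the same as a polynomial of weight \<open>0\<close> killed by the lowering derivation, and in the
  finite-dimensional graded pieces the lowering derivation maps weight \<open>0\<close> onto weight \<open>-2\<close>. Counting
  monomials, the dimension of the covariants of multidegree \<open>n\<close> is therefore the number of monomials
  on \<open>W\<close> of weight \<open>L\<close> minus the number of those of weight \<open>- L - 2\<close>. By Cauchy's formula the
  generating function of these differences is the integral of
  \<open>(z ^ (-L-1) - z ^ (L+1)) / \<Prod> (1 - t_k z ^ w)\<close> over the unit circle, the product being over all weights
  \<open>w\<close> of \<open>W\<close>. The residues at the points \<open>z\<close> with \<open>z ^ a = t_K\<close> give the double sum; the residue at \<open>0\<close> is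
  again evaluated by expanding into geometric series, now on a small circle, and gives the sum over \<open>S\<close>.
\<close>

subsection \<open>Weight modules of the Lie algebra\<close>

text \<open>The factor \<open>V_L\<close> can be moved into the polynomial ring because a form of
  degree L in v is a polynomial of degree L on C^2, and the determinant identifies C^2 with
  \<open>V_1\<close>. Covariants thus become invariants, for which only the weights 0 and -2 have to
  be compared; the sums over the monomials of the extra block telescope, and this is where L and
  -L-2 come from. Complete reducibility never enters: bounded weights make the two operators
  nilpotent on weight vectors, and a commutator formula does the rest. On the analytic side each
  pair of weights a, -a gives a factor 1 - t z^a without zeros in the closed unit disc and a factor
  1 - t z^(-a) whose zeros all lie inside it. Non-vanishing denominators keep the zeros of different
  factors apart, so all nonzero poles are simple. Near 0 the second factor is written as - t z^(-a)
  (1 - t^(-1) z^a); pulling its first part out of all pairs produces the sign (-1)^C, the inverse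
  variables and a shift of the exponent by the sum of the a. This shift is the origin of
  \<open>nu\<close>.\<close>

lemma (in vector_space) rank_nullity_on:
  assumes S: "subspace S" and B: "finite B" "S \<subseteq> span B"
    and add: "\<And>x y. x \<in> S \<Longrightarrow> y \<in> S \<Longrightarrow> f (x + y) = f x + f y"
    and scale: "\<And>c x. x \<in> S \<Longrightarrow> f (scale c x) = scale c (f x)"
  shows "dim {x \<in> S. f x = 0} + dim (f ` S) = dim S"
proof -
  interpret vp: vector_space_pair scale scale ..
  have f0: "f 0 = 0"
    using scale[of 0 0] subspace_0[OF S] by simp
  define K where "K = {x \<in> S. f x = 0}"
  have K: "subspace K"
    unfolding K_def using S by (auto simp: subspace_def f0 add scale)
  obtain B0 where B0: "B0 \<subseteq> K" "independent B0" "K \<subseteq> span B0" "card B0 = dim K"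
    using basis_exists by blast
  have "B0 \<subseteq> S" using B0(1) by (auto simp: K_def)
  then obtain B1 where B1: "B0 \<subseteq> B1" "B1 \<subseteq> S" "independent B1" "S \<subseteq> span B1"
    using maximal_independent_subset_extend[OF _ B0(2)] by metis
  have finB1: "finite B1"
    using independent_span_bound[OF B(1) B1(3)] B1(2) B(2) by auto
  \<comment> \<open>\<open>f\<close> is linear on \<open>S\<close> only. It is replaced by a linear
    map on the whole space that agrees with it on \<open>S\<close>.\<close>
  obtain g where g: "Vector_Spaces.linear scale scale g" "\<And>x. x \<in> B1 \<Longrightarrow> g x = f x"
    using vp.linear_independent_extend[OF B1(3), of f] by blast
  have spanB1: "span B1 = S"
    using B1 S by (simp add: span_subspace)
  have gf: "g x = f x" if "x \<in> S" for x
  proof -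
    have "x \<in> span B1" using that spanB1 by simp
    then have "x \<in> S \<and> g x = f x"
    proof (induction rule: span_induct_alt)
      case base
      then show ?case using subspace_0[OF S] f0 vp.linear_0[OF g(1)] by simp
    next
      case (step c x y)
      have xS: "x \<in> S" using step B1(2) by auto
      then have "scale c x + y \<in> S"
        using step S by (simp add: subspace_add subspace_scale)
      moreover have "g (scale c x + y) = f (scale c x + y)"
        using xS step S by (simp add: vp.linear_add[OF g(1)] vp.linear_scale[OF g(1)] g(2) add scale
            subspace_scale)
      ultimately show ?case by simp
    qed
    then show ?thesis by simp
  qed
  define C where "C = B1 - B0"
  have indC: "independent C"
    using B1(3) unfolding C_def by (rule independent_mono) auto
  have spanC: "span C \<subseteq> S"
    using span_mono[of C B1] spanB1 by (auto simp: C_def)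
  \<comment> \<open>A kernel vector in \<open>span C\<close> also lies in \<open>span B0\<close>, so
    its coordinates with respect to \<open>B1\<close> are supported on two disjoint sets.\<close>
  have inj: "inj_on g (span C)"
  proof (subst vp.linear_inj_on_iff_eq_0[OF g(1)])
    show "subspace (span C)" by simp
    show "\<forall>x\<in>span C. g x = 0 \<longrightarrow> x = 0"
    proof (intro ballI impI)
      fix x assume x: "x \<in> span C" "g x = 0"
      then have "x \<in> K" using spanC gf by (auto simp: K_def)
      then have "x \<in> span B0" using B0 by auto
      then have 1: "representation B1 x = representation B0 x"
        using representation_extend[OF B1(3)] B1(1) by simp
      have 2: "representation B1 x = representation C x"
        using representation_extend[OF B1(3) x(1)] by (auto simp: C_def)
      have z: "representation C x b = 0" for b
        using representation_ne_zero[of C x b] representation_ne_zero[of B0 x b] 1 2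
        by (auto simp: C_def)
      show "x = 0"
        using sum_nonzero_representation_eq[OF indC x(1)] z by simp
    qed
  qed
  have indg: "independent (g ` C)"
    by (rule vp.linear_independent_injective_image[OF g(1) indC inj])
  have "f ` S = g ` span B1"
    using spanB1 gf by auto
  also have "\<dots> = span (g ` B1)"
    by (rule vp.linear_span_image[OF g(1), symmetric])
  also have "\<dots> = span (g ` C)"
  proof (rule span_eq[THEN iffD2], intro conjI subsetI)
    fix y assume "y \<in> g ` B1"
    then obtain b where b: "b \<in> B1" "y = g b" by auto
    show "y \<in> span (g ` C)"
    proof (cases "b \<in> C")
      case True
      then show ?thesis using b by (auto intro: span_base)
    next
      case False
      then have "b \<in> K" using b B0(1) by (auto simp: C_def)
      then have "y = 0" using b gf by (auto simp: K_def)
      then show ?thesis by (simp add: span_zero)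
    qed
  qed (auto simp: C_def intro: span_base)
  finally have "dim (f ` S) = card (g ` C)"
    using dim_span_eq_card_independent[OF indg] by simp
  also have "\<dots> = card C"
    by (rule card_image) (rule inj_on_subset[OF inj span_superset])
  also have "\<dots> = card B1 - card B0"
    unfolding C_def using B1(1) finB1 by (simp add: card_Diff_subset finite_subset)
  finally have "dim (f ` S) = card B1 - card B0" .
  moreover have "dim S = card B1"
    using dim_eq_card[of B1 S] B1 spanB1 S by (simp add: span_eq_iff[THEN iffD2])
  moreover have "card B0 \<le> card B1"
    using B1(1) finB1 by (rule card_mono[rotated])
  ultimately show ?thesis
    using B0(4) by (simp add: K_def)
qed

text \<open>Linearity is required on each weight space separately, because the operators used later
  are analytic derivatives, which are additive on polynomial functions but not on arbitrary ones.
  \<open>bounded\<close> stands in for finite dimension.\<close>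

locale sl2_weight_module = vector_space scale
  for scale :: "'a::field_char_0 \<Rightarrow> 'b::ab_group_add \<Rightarrow> 'b" +
  fixes X Y :: "'b \<Rightarrow> 'b" and M :: "int \<Rightarrow> 'b set" and bound :: int
  assumes subspace_M: "subspace (M m)"
    and X_in: "x \<in> M m \<Longrightarrow> X x \<in> M (m + 2)"
    and Y_in: "x \<in> M m \<Longrightarrow> Y x \<in> M (m - 2)"
    and X_add: "x \<in> M m \<Longrightarrow> y \<in> M m \<Longrightarrow> X (x + y) = X x + X y"
    and Y_add: "x \<in> M m \<Longrightarrow> y \<in> M m \<Longrightarrow> Y (x + y) = Y x + Y y"
    and X_scale: "x \<in> M m \<Longrightarrow> X (scale c x) = scale c (X x)"
    and Y_scale: "x \<in> M m \<Longrightarrow> Y (scale c x) = scale c (Y x)"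
    and commutator: "x \<in> M m \<Longrightarrow> X (Y x) - Y (X x) = scale (of_int m) x"
    and bounded: "\<bar>m\<bar> > bound \<Longrightarrow> M m \<subseteq> {0}"
begin

lemma swap: "sl2_weight_module scale Y X (\<lambda>m. M (- m)) bound"
proof unfold_locales
  fix m x
  assume x: "x \<in> M (- m)"
  show "Y x \<in> M (- (m + 2))" using Y_in[OF x] by simp
  show "X x \<in> M (- (m - 2))" using X_in[OF x] by simp
  show "Y (X x) - X (Y x) = scale (of_int m) x"
    using commutator[OF x] by (simp add: algebra_simps)
qed (use subspace_M X_add Y_add X_scale Y_scale bounded in auto)

lemma X_0 [simp]: "X 0 = 0" and Y_0 [simp]: "Y 0 = 0"
  using X_scale[of 0 0 0] Y_scale[of 0 0 0] subspace_0[OF subspace_M] by simp_all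

lemma X_pow_in: "x \<in> M m \<Longrightarrow> (X ^^ k) x \<in> M (m + 2 * int k)"
proof (induction k)
  case (Suc k)
  then show ?case using X_in[of "(X ^^ k) x" "m + 2 * int k"] by (simp add: algebra_simps)
qed simp

lemma X_pow_add:
  "x \<in> M m \<Longrightarrow> y \<in> M m \<Longrightarrow> (X ^^ k) (x + y) = (X ^^ k) x + (X ^^ k) y"
  by (induction k) (auto intro: X_add X_pow_in)

lemma X_pow_scale: "x \<in> M m \<Longrightarrow> (X ^^ k) (scale c x) = scale c ((X ^^ k) x)"
  by (induction k) (auto intro: X_scale X_pow_in)

lemma X_pow_0 [simp]: "(X ^^ k) 0 = 0"
  by (induction k) auto

lemma X_nilpotent:
  assumes "x \<in> M m" shows "\<exists>k. (X ^^ k) x = 0"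
proof -
  have "\<bar>m + 2 * int (nat (\<bar>bound\<bar> + \<bar>m\<bar> + 1))\<bar> > bound" by linarith
  then show ?thesis using X_pow_in[OF assms] bounded by blast
qed

text \<open>Moving \<open>Y\<close> to the left past k + 1 copies of \<open>X\<close> collects the
  weights m, m + 2, ..., m + 2 k, whose sum is (k + 1) (m + k). For m > 0 this scalar is nonzero, so
  powers of \<open>X\<close> can be peeled off one at a time.\<close>

lemma X_pow_Y:
  assumes x: "x \<in> M m"
  shows "(X ^^ Suc k) (Y x)
    = Y ((X ^^ Suc k) x) + scale (of_int ((int k + 1) * (m + int k))) ((X ^^ k) x)"
proof (induction k)
  case 0
  then show ?case using commutator[OF x] by (simp add: algebra_simps)
next
  case (Suc k)
  let ?y = "(X ^^ Suc k) x"
  have y: "?y \<in> M (m + 2 * int (Suc k))" by (rule X_pow_in[OF x])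
  have z: "(X ^^ k) x \<in> M (m + 2 * int k)" by (rule X_pow_in[OF x])
  have "(X ^^ Suc (Suc k)) (Y x)
      = X (Y ?y + scale (of_int ((int k + 1) * (m + int k))) ((X ^^ k) x))"
    using Suc by simp
  also have "\<dots> = X (Y ?y) + scale (of_int ((int k + 1) * (m + int k))) ?y"
    using X_add[of "Y ?y" "m + 2 * int k"] Y_in[OF y] z subspace_M
    by (simp add: subspace_scale X_scale[OF z])
  also have "X (Y ?y) = Y (X ?y) + scale (of_int (m + 2 * int (Suc k))) ?y"
    using commutator[OF y] by (simp add: algebra_simps)
  also have "Y (X ?y) + scale (of_int (m + 2 * int (Suc k))) ?y
        + scale (of_int ((int k + 1) * (m + int k))) ?y
      = Y (X ?y) + scale (of_int (m + 2 * int (Suc k)) + of_int ((int k + 1) * (m + int k))) ?y"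
    by (simp only: scale_left_distrib add.assoc)
  also have "(of_int (m + 2 * int (Suc k)) + of_int ((int k + 1) * (m + int k)) :: 'a)
      = of_int ((int (Suc k) + 1) * (m + int (Suc k)))"
    unfolding of_int_add[symmetric] by (rule arg_cong[where f=of_int]) (simp add: algebra_simps)
  finally show ?case by simp
qed

text \<open>Induction on \<open>k\<close>: subtracting a suitable multiple of \<open>X (Y y)\<close> from \<open>y\<close> makes it vanish
  already under \<open>X ^^ k\<close>.\<close>

lemma X_surj_aux:
  assumes "m > 0" "y \<in> M m" "(X ^^ k) y = 0"
  shows "\<exists>x \<in> M (m - 2). X x = y"
  using assms(2,3)
proof (induction k arbitrary: y)
  case 0
  then show ?case using subspace_0[OF subspace_M] by (intro bexI[of _ 0]) auto
next
  case (Suc k)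
  define c :: 'a where "c = of_int ((int k + 1) * (m + int k))"
  have c: "c \<noteq> 0"
    unfolding c_def of_int_eq_0_iff using assms(1) by auto
  have Yy: "Y y \<in> M (m - 2)" using Y_in Suc by blast
  have XYy: "X (Y y) \<in> M m" using X_in[OF Yy] by simp
  define w where "w = scale (- inverse c) (X (Y y))"
  have w: "w \<in> M m" unfolding w_def using XYy subspace_M by (rule subspace_scale[rotated])
  have "(X ^^ k) (y + w) = (X ^^ k) y + scale (- inverse c) ((X ^^ Suc k) (Y y))"
    using X_pow_add[OF Suc(2) w] X_pow_scale[OF XYy, of k "- inverse c"]
    by (simp add: w_def funpow_swap1)
  also have "\<dots> = 0"
    unfolding X_pow_Y[OF Suc(2)] Suc(3) c_def[symmetric] using c by simp
  finally obtain x where x: "x \<in> M (m - 2)" "X x = y + w"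
    using Suc(1)[of "y + w"] Suc(2) w subspace_M by (auto simp: subspace_add)
  have "X (x + scale (inverse c) (Y y)) = y + w + scale (inverse c) (X (Y y))"
    using X_add[OF x(1), of "scale (inverse c) (Y y)"] Yy subspace_M x(2)
    by (simp add: subspace_scale X_scale[OF Yy])
  also have "\<dots> = y" by (simp add: w_def)
  finally show ?case
    using x(1) Yy subspace_M by (intro bexI[of _ "x + scale (inverse c) (Y y)"])
      (auto simp: subspace_add subspace_scale)
qed

lemma X_image:
  assumes "m > 0" shows "X ` M (m - 2) = M m"
proof
  show "X ` M (m - 2) \<subseteq> M m" using X_in[of _ "m - 2"] by auto
  show "M m \<subseteq> X ` M (m - 2)"
  proof
    fix y assume y: "y \<in> M m"
    from X_nilpotent[OF this] obtain k where "(X ^^ k) y = 0" ..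
    from X_surj_aux[OF assms y this] show "y \<in> X ` M (m - 2)" by auto
  qed
qed

text \<open>\<open>X_pow_Y\<close> with exchanged roles: as \<open>X\<close> kills x and the next
  power of \<open>Y\<close> vanishes, a nonzero multiple of \<open>(Y ^^ k) x\<close> is 0.
  Descending in k reaches x itself.\<close>

lemma negative_highest_weight:
  assumes "x \<in> M m" "m < 0" "X x = 0"
  shows "x = 0"
proof -
  interpret sw: sl2_weight_module scale Y X "\<lambda>m. M (- m)" bound by (rule swap)
  obtain k where "(Y ^^ k) x = 0"
    using sw.X_nilpotent[of x "- m"] assms by auto
  then show ?thesis
  proof (induction k)
    case (Suc k)
    have "scale (of_int ((int k + 1) * (- m + int k))) ((Y ^^ k) x) = 0"
      using sw.X_pow_Y[of x "- m" k] assms(1) by (simp only: assms(3) Suc.prems) simp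
    moreover have "(int k + 1) * (- m + int k) \<noteq> 0" using assms(2) by auto
    then have "(of_int ((int k + 1) * (- m + int k)) :: 'a) \<noteq> 0" unfolding of_int_eq_0_iff .
    ultimately have "(Y ^^ k) x = 0" using scale_eq_0_iff by blast
    then show ?case by (rule Suc.IH)
  qed simp
qed

text \<open>\<open>Y x\<close> has weight -2, and on weight 0 the operators commute, so
  \<open>X\<close> kills \<open>Y x\<close>. Hence being killed by one of the two operators already
  makes a vector of weight 0 invariant.\<close>

lemma Y_eq_0:
  assumes "x \<in> M 0" "X x = 0" shows "Y x = 0"
  using negative_highest_weight[OF Y_in[OF assms(1)]] commutator[OF assms(1)] assms(2) by simp

lemma dim_kernel:
  assumes "finite B" "M 0 \<subseteq> span B"
  shows "dim {x \<in> M 0. X x = 0} + dim (M 2) = dim (M 0)"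
  using rank_nullity_on[OF subspace_M assms, of X] X_image[of 2] by (simp add: X_add X_scale)

end

subsection \<open>Polynomials graded by multidegree and weight\<close>

type_synonym coords = "nat \<times> nat \<Rightarrow> complex"

abbreviation idx :: "nat set \<Rightarrow> (nat \<Rightarrow> nat) \<Rightarrow> (nat \<times> nat) set" where
  "idx K D \<equiv> (SIGMA k:K. {..D k})"

text \<open>Polynomial functions of multidegree \<open>N\<close> and weight \<open>m\<close>, the
  variable c (k, i) having weight 2 i - D k. Building products one variable at a time leaves the
  product rule for a coordinate as the only substantial case of the inductions. Degrees are
  constrained on \<open>K\<close> only, and the zero function has every degree and weight.\<close>

inductive weighted :: "nat set \<Rightarrow> (nat \<Rightarrow> nat) \<Rightarrow> (nat \<Rightarrow> nat) \<Rightarrow> int \<Rightarrow> (coords \<Rightarrow> complex) \<Rightarrow> bool"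
  for K D where
  zero: "weighted K D N m (\<lambda>_. 0)" |
  one: "(\<And>k. k \<in> K \<Longrightarrow> N k = 0) \<Longrightarrow> weighted K D N 0 (\<lambda>_. 1)" |
  add: "weighted K D N m f \<Longrightarrow> weighted K D N m g \<Longrightarrow> weighted K D N m (\<lambda>c. f c + g c)" |
  scale: "weighted K D N m f \<Longrightarrow> weighted K D N m (\<lambda>c. a * f c)" |
  var: "weighted K D N m f \<Longrightarrow> k \<in> K \<Longrightarrow> i \<le> D k \<Longrightarrow>
     weighted K D (N(k := Suc (N k))) (m + (2 * int i - int (D k))) (\<lambda>c. c (k, i) * f c)"

lemma weighted_varI:
  assumes "weighted K D N m f" "k \<in> K" "i \<le> D k" "N' = N(k := Suc (N k))"
    "m' = m + (2 * int i - int (D k))"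
  shows "weighted K D N' m' (\<lambda>c. c (k, i) * f c)"
  using weighted.var[OF assms(1-3)] assms(4,5) by simp

lemma weighted_cong_degree:
  assumes "weighted K D N m f" "\<And>k. k \<in> K \<Longrightarrow> N' k = N k"
  shows "weighted K D N' m f"
  using assms
proof (induction arbitrary: N')
  case (var N m f k i)
  have "weighted K D (N'(k := N k)) m f" using var by (intro var.IH) auto
  then show ?case
    by (rule weighted_varI) (use var in \<open>auto simp: fun_eq_iff\<close>)
qed (auto intro: weighted.intros)

lemma weighted_cong_coords:
  assumes "weighted K D N m f" "\<And>p. p \<in> idx K D \<Longrightarrow> c p = c' p"
  shows "f c = f c'"
  using assms by (induction) auto

text \<open>A variable of block k has weight between - D k and D k. The resulting bound supplies the
  nilpotency in the weight module.\<close>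

lemma weighted_bounded:
  assumes "weighted K D N m f" "finite K"
  shows "f = (\<lambda>_. 0) \<or> \<bar>m\<bar> \<le> (\<Sum>k\<in>K. int (N k * D k))"
  using assms(1)
proof induction
  case (var N m f k i)
  show ?case
  proof (cases "f = (\<lambda>_. 0)")
    case False
    then have "\<bar>m\<bar> \<le> (\<Sum>k\<in>K. int (N k * D k))" using var by simp
    moreover have "(\<Sum>j\<in>K. int ((N(k := Suc (N k))) j * D j))
        = (\<Sum>j\<in>K. int (N j * D j)) + (\<Sum>j\<in>K. if j = k then int (D k) else 0)"
      unfolding sum.distrib[symmetric] by (rule sum.cong) (auto simp: algebra_simps)
    moreover have "(\<Sum>j\<in>K. if j = k then int (D k) else 0) = int (D k)"
      using var assms(2) by simp
    ultimately show ?thesis using var by linarith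
  qed simp
qed (auto simp: sum_nonneg)

section \<open>Derivatives of polynomial functions along vector fields\<close>

definition ddir :: "(coords \<Rightarrow> complex) \<Rightarrow> coords \<Rightarrow> coords \<Rightarrow> complex" where
  "ddir f c v = deriv (\<lambda>s. f (\<lambda>p. c p + s * v p)) 0"

lemma weighted_curve_differentiable:
  assumes "weighted K D N m f"
    and "\<And>p. p \<in> idx K D \<Longrightarrow> (\<lambda>s. \<gamma> s p) field_differentiable (at s)"
  shows "(\<lambda>s. f (\<gamma> s)) field_differentiable (at s)"
  using assms by induction (auto intro!: derivative_intros)

lemma weighted_line_differentiable:
  assumes "weighted K D N m f"
  shows "(\<lambda>s. f (\<lambda>p. c p + s * v p)) field_differentiable (at s)"
  by (rule weighted_curve_differentiable[OF assms]) (auto intro!: derivative_intros)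

lemma ddir_add:
  assumes "weighted K D N m f" "weighted K D N' m' g"
  shows "ddir (\<lambda>c. f c + g c) c v = ddir f c v + ddir g c v"
  unfolding ddir_def
  by (rule deriv_add) (rule weighted_line_differentiable assms)+

lemma ddir_scale:
  assumes "weighted K D N m f"
  shows "ddir (\<lambda>c. a * f c) c v = a * ddir f c v"
  unfolding ddir_def by (rule deriv_cmult) (rule weighted_line_differentiable assms)+

lemma ddir_const [simp]: "ddir (\<lambda>_. a) c v = 0"
  by (simp add: ddir_def)

lemma ddir_var:
  assumes "weighted K D N m f"
  shows "ddir (\<lambda>c. c p * f c) c v = v p * f c + c p * ddir f c v"
proof -
  have 1: "((\<lambda>s. f (\<lambda>p. c p + s * v p)) has_field_derivative ddir f c v) (at 0)"
    unfolding ddir_def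
    by (rule field_differentiable_derivI) (rule weighted_line_differentiable[OF assms])
  have "((\<lambda>s. (c p + s * v p) * f (\<lambda>p. c p + s * v p)) has_field_derivative
      v p * f c + c p * ddir f c v) (at 0)"
    by (rule derivative_eq_intros 1 refl)+ simp
  then show ?thesis unfolding ddir_def by (rule DERIV_imp_deriv)
qed

text \<open>Only the velocities at coordinates in \<open>idx K D\<close> are constrained, since
  \<open>f\<close> reads no others. This links one-parameter substitutions with derivations.\<close>

lemma weighted_chain_rule:
  assumes "weighted K D N m f"
    and "\<And>p. p \<in> idx K D \<Longrightarrow> ((\<lambda>s. \<gamma> s p) has_field_derivative v p) (at s)"
  shows "((\<lambda>s. f (\<gamma> s)) has_field_derivative ddir f (\<gamma> s) v) (at s)"
  using assms
proof induction
  case (add N m f g)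
  then show ?case by (auto simp: ddir_add intro!: derivative_eq_intros)
next
  case (scale N m f a)
  then show ?case by (auto simp: ddir_scale intro!: derivative_eq_intros)
next
  case (var N m f k i)
  show ?case unfolding ddir_var[OF var(1)]
    by (rule derivative_eq_intros var refl | use var in auto)+
qed auto

text \<open>Polynomials are kept as functions, so the derivation attached to a vector field is a
  directional derivative. The rules of a derivation are available on \<open>weighted\<close>
  functions.\<close>

definition lie :: "(coords \<Rightarrow> coords) \<Rightarrow> (coords \<Rightarrow> complex) \<Rightarrow> coords \<Rightarrow> complex" where
  "lie a f = (\<lambda>c. ddir f c (a c))"

lemma lie_zero [simp]: "lie a (\<lambda>_. b) = (\<lambda>_. 0)"
  by (simp add: lie_def)

lemma lie_add: "weighted K D N m f \<Longrightarrow> weighted K D N' m' g \<Longrightarrow>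
    lie a (\<lambda>c. f c + g c) = (\<lambda>c. lie a f c + lie a g c)"
  by (simp add: lie_def ddir_add)

lemma lie_scale: "weighted K D N m f \<Longrightarrow> lie a (\<lambda>c. b * f c) = (\<lambda>c. b * lie a f c)"
  by (simp add: lie_def ddir_scale)

lemma lie_var: "weighted K D N m f \<Longrightarrow>
    lie a (\<lambda>c. c p * f c) = (\<lambda>c. a c p * f c + c p * lie a f c)"
  by (simp add: lie_def ddir_var)

text \<open>The vector fields on the coefficients \<open>c (k, i)\<close> of \<open>x ^ i * y ^ (D k - i)\<close> generated by the
  substitutions \<open>x \<mapsto> x + s y\<close> and \<open>y \<mapsto> y + s x\<close>.\<close>

definition raise :: "(nat \<Rightarrow> nat) \<Rightarrow> coords \<Rightarrow> coords" where
  "raise D c = (\<lambda>(k, i). if i < D k then of_nat (i + 1) * c (k, i + 1) else 0)"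

definition lower :: "(nat \<Rightarrow> nat) \<Rightarrow> coords \<Rightarrow> coords" where
  "lower D c = (\<lambda>(k, i). if 0 < i then of_nat (D k - i + 1) * c (k, i - 1) else 0)"

lemma weighted_raise_var:
  assumes "weighted K D N m f" "k \<in> K" "i \<le> D k"
  shows "weighted K D (N(k := Suc (N k))) (m + 2 + (2 * int i - int (D k)))
    (\<lambda>c. raise D c (k, i) * f c)"
proof (cases "i < D k")
  case True
  have "weighted K D (N(k := Suc (N k))) (m + 2 + (2 * int i - int (D k))) (\<lambda>c. c (k, i + 1) * f c)"
    by (rule weighted_varI[OF assms(1,2)]) (use True in auto)
  from weighted.scale[OF this, of "of_nat (i + 1)"] show ?thesis
    using True by (simp add: raise_def mult.assoc)
qed (auto simp: raise_def intro: weighted.intros)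

lemma weighted_lower_var:
  assumes "weighted K D N m f" "k \<in> K" "i \<le> D k"
  shows "weighted K D (N(k := Suc (N k))) (m - 2 + (2 * int i - int (D k)))
    (\<lambda>c. lower D c (k, i) * f c)"
proof (cases "0 < i")
  case True
  have "weighted K D (N(k := Suc (N k))) (m - 2 + (2 * int i - int (D k))) (\<lambda>c. c (k, i - 1) * f c)"
    by (rule weighted_varI[OF assms(1,2)]) (use True assms in \<open>auto simp: of_nat_diff\<close>)
  from weighted.scale[OF this, of "of_nat (D k - i + 1)"] show ?thesis
    using True by (simp add: lower_def mult.assoc)
qed (auto simp: lower_def intro: weighted.intros)

lemma weighted_raise: "weighted K D N m f \<Longrightarrow> weighted K D N (m + 2) (lie (raise D) f)"
proof (induction rule: weighted.induct)
  case (var N m f k i)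
  have weighted: "weighted K D (N(k := Suc (N k))) (m + 2 + (2 * int i - int (D k))) (\<lambda>c. c (k, i) * lie (raise D) f c)"
    by (rule weighted.var) (use var in auto)
  have eq: "m + (2 * int i - int (D k)) + 2 = m + 2 + (2 * int i - int (D k))" by simp
  show ?case
    unfolding lie_var[OF var(1)] eq by (rule weighted.add[OF weighted_raise_var[OF var(1-3)] weighted])
qed (auto simp: lie_add lie_scale intro: weighted.intros)

lemma weighted_lower: "weighted K D N m f \<Longrightarrow> weighted K D N (m - 2) (lie (lower D) f)"
proof (induction rule: weighted.induct)
  case (var N m f k i)
  have weighted: "weighted K D (N(k := Suc (N k))) (m - 2 + (2 * int i - int (D k))) (\<lambda>c. c (k, i) * lie (lower D) f c)"
    by (rule weighted.var) (use var in auto)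
  have eq: "m + (2 * int i - int (D k)) - 2 = m - 2 + (2 * int i - int (D k))" by simp
  show ?case
    unfolding lie_var[OF var(1)] eq by (rule weighted.add[OF weighted_lower_var[OF var(1-3)] weighted])
qed (auto simp: lie_add lie_scale intro: weighted.intros)

text \<open>A coordinate of \<open>lower D c\<close> is linear in c, so its derivative along the
  field \<open>raise D\<close> is the same coordinate of \<open>lower D\<close> evaluated at
  \<open>raise D c\<close>.\<close>

lemma lie_raise_lower_var:
  assumes "weighted K D N m f" "i \<le> D k"
  shows "lie (raise D) (\<lambda>c. lower D c (k, i) * f c)
    = (\<lambda>c. lower D (raise D c) (k, i) * f c + lower D c (k, i) * lie (raise D) f c)"
proof (cases "0 < i")
  case True
  have "lie (raise D) (\<lambda>c. of_nat (D k - i + 1) * (c (k, i - 1) * f c))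
      = (\<lambda>c. of_nat (D k - i + 1) * lie (raise D) (\<lambda>c. c (k, i - 1) * f c) c)"
    unfolding lie_def ddir_def
    apply (rule ext, rule deriv_cmult)
    by (intro derivative_intros weighted_line_differentiable[OF assms(1)])
  then show ?thesis
    using True lie_var[OF assms(1), of "raise D" "(k, i - 1)"]
    by (simp add: lower_def algebra_simps)
qed (simp add: lower_def)

lemma lie_lower_raise_var:
  assumes "weighted K D N m f" "i \<le> D k"
  shows "lie (lower D) (\<lambda>c. raise D c (k, i) * f c)
    = (\<lambda>c. raise D (lower D c) (k, i) * f c + raise D c (k, i) * lie (lower D) f c)"
proof (cases "i < D k")
  case True
  have "lie (lower D) (\<lambda>c. of_nat (i + 1) * (c (k, i + 1) * f c))
      = (\<lambda>c. of_nat (i + 1) * lie (lower D) (\<lambda>c. c (k, i + 1) * f c) c)"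
    unfolding lie_def ddir_def
    apply (rule ext, rule deriv_cmult)
    by (intro derivative_intros weighted_line_differentiable[OF assms(1)])
  then show ?thesis
    using True lie_var[OF assms(1), of "lower D" "(k, i + 1)"]
    by (simp add: raise_def algebra_simps)
qed (simp add: raise_def)

text \<open>The two composites multiply c (k, i) by i (D k - i + 1) and by (i + 1) (D k - i). At
  both ends of a block the cut-off cases of \<open>raise\<close> and \<open>lower\<close> agree with
  the vanishing of these factors.\<close>

lemma raise_lower_var:
  assumes "i \<le> D k"
  shows "lower D (raise D c) (k, i) - raise D (lower D c) (k, i) = of_int (2 * int i - int (D k)) * c (k, i)"
proof -
  have 1: "lower D (raise D c) (k, i) = of_nat i * of_nat (D k - i + 1) * c (k, i)"
    using assms by (cases i) (auto simp: raise_def lower_def)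
  have 2: "raise D (lower D c) (k, i) = of_nat (i + 1) * of_nat (D k - i) * c (k, i)"
    using assms by (auto simp: raise_def lower_def Suc_diff_Suc)
  show ?thesis
    unfolding 1 2 using assms by (simp add: of_nat_diff algebra_simps)
qed

text \<open>The commutator of two derivations is a derivation: the mixed terms of the product rule
  cancel, so it is determined by its value on a variable, given by \<open>raise_lower_var\<close>.
  The order of the fields is reversed there, because derivations compose opposite to the linear maps
  on coordinates.\<close>

lemma lie_commutator:
  "weighted K D N m f \<Longrightarrow> lie (raise D) (lie (lower D) f) c - lie (lower D) (lie (raise D) f) c = of_int m * f c"
proof (induction arbitrary: c rule: weighted.induct)
  case (add N m f g)
  then show ?case
    by (simp add: lie_add lie_add[OF weighted_lower weighted_lower] lie_add[OF weighted_raise weighted_raise] algebra_simps)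
next
  case (scale N m f a)
  have "lie (raise D) (lie (lower D) (\<lambda>c. a * f c)) c - lie (lower D) (lie (raise D) (\<lambda>c. a * f c)) c
      = a * (lie (raise D) (lie (lower D) f) c - lie (lower D) (lie (raise D) f) c)"
    by (simp add: lie_scale[OF scale(1)] lie_scale[OF weighted_lower[OF scale(1)]]
        lie_scale[OF weighted_raise[OF scale(1)]] algebra_simps)
  then show ?case by (simp add: scale.IH)
next
  case (var N m f k i)
  note f = var(1)
  have 1: "weighted K D (N(k := Suc (N k))) (m + 2 + (2 * int i - int (D k))) (\<lambda>c. c (k, i) * lie (raise D) f c)"
    by (rule weighted.var[OF weighted_raise[OF f]]) fact+
  have 2: "weighted K D (N(k := Suc (N k))) (m - 2 + (2 * int i - int (D k))) (\<lambda>c. c (k, i) * lie (lower D) f c)"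
    by (rule weighted.var[OF weighted_lower[OF f]]) fact+
  have "lie (raise D) (lie (lower D) (\<lambda>c. c (k, i) * f c)) c
      = lower D (raise D c) (k, i) * f c + lower D c (k, i) * lie (raise D) f c
      + (raise D c (k, i) * lie (lower D) f c + c (k, i) * lie (raise D) (lie (lower D) f) c)"
    by (simp add: lie_var[OF f] lie_add[OF weighted_lower_var[OF f var(2,3)] 2]
        lie_raise_lower_var[where N=N, OF f var(3)] lie_var[OF weighted_lower[OF f]])
  moreover have "lie (lower D) (lie (raise D) (\<lambda>c. c (k, i) * f c)) c
      = raise D (lower D c) (k, i) * f c + raise D c (k, i) * lie (lower D) f c
      + (lower D c (k, i) * lie (raise D) f c + c (k, i) * lie (lower D) (lie (raise D) f) c)"
    by (simp add: lie_var[OF f] lie_add[OF weighted_raise_var[OF f var(2,3)] 1]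
        lie_lower_raise_var[where N=N, OF f var(3)] lie_var[OF weighted_raise[OF f]])
  ultimately have "lie (raise D) (lie (lower D) (\<lambda>c. c (k, i) * f c)) c
        - lie (lower D) (lie (raise D) (\<lambda>c. c (k, i) * f c)) c
      = (lower D (raise D c) (k, i) - raise D (lower D c) (k, i)) * f c
      + c (k, i) * (lie (raise D) (lie (lower D) f) c - lie (lower D) (lie (raise D) f) c)"
    by (simp add: algebra_simps)
  then show ?case
    unfolding raise_lower_var[where D=D, OF var(3)] var.IH by (simp add: algebra_simps)
qed auto

section \<open>Monomials: spanning and linear independence\<close>

definition mon :: "nat set \<Rightarrow> (nat \<Rightarrow> nat) \<Rightarrow> (nat \<times> nat \<Rightarrow> nat) \<Rightarrow> coords \<Rightarrow> complex" where
  "mon K D e c = (\<Prod>p\<in>idx K D. c p ^ e p)"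

definition mdeg :: "(nat \<Rightarrow> nat) \<Rightarrow> (nat \<times> nat \<Rightarrow> nat) \<Rightarrow> nat \<Rightarrow> nat" where
  "mdeg D e k = (\<Sum>i\<le>D k. e (k, i))"

definition mwt :: "nat set \<Rightarrow> (nat \<Rightarrow> nat) \<Rightarrow> (nat \<times> nat \<Rightarrow> nat) \<Rightarrow> int" where
  "mwt K D e = (\<Sum>p\<in>idx K D. int (e p) * wt D p)"

text \<open>Exponents are extensional, so that the set is finite and distinct exponents give
  distinct monomials.\<close>

definition degree_weight_exps :: "nat set \<Rightarrow> (nat \<Rightarrow> nat) \<Rightarrow> (nat \<Rightarrow> nat) \<Rightarrow> (nat \<times> nat \<Rightarrow> nat) set" where
  "degree_weight_exps K D N = {e \<in> idx K D \<rightarrow>\<^sub>E UNIV. \<forall>k\<in>K. mdeg D e k = N k}"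

definition weight_weight_exps :: "nat set \<Rightarrow> (nat \<Rightarrow> nat) \<Rightarrow> (nat \<Rightarrow> nat) \<Rightarrow> int \<Rightarrow> (nat \<times> nat \<Rightarrow> nat) set" where
  "weight_weight_exps K D N m = {e \<in> degree_weight_exps K D N. mwt K D e = m}"

lemma degree_weight_exps_subset: "degree_weight_exps K D N \<subseteq> idx K D \<rightarrow>\<^sub>E UNIV"
  by (auto simp: degree_weight_exps_def)

lemma finite_degree_weight_exps:
  assumes "finite K" shows "finite (degree_weight_exps K D N)"
proof (rule finite_subset)
  show "degree_weight_exps K D N \<subseteq> (\<Pi>\<^sub>E p\<in>idx K D. {..N (fst p)})"
  proof
    fix e assume e: "e \<in> degree_weight_exps K D N"
    show "e \<in> (\<Pi>\<^sub>E p\<in>idx K D. {..N (fst p)})"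
    proof (rule PiE_I)
      fix p assume "p \<in> idx K D"
      then obtain k i where p: "p = (k, i)" "k \<in> K" "i \<le> D k" by auto
      have "e (k, i) \<le> mdeg D e k"
        unfolding mdeg_def using p by (intro member_le_sum) auto
      then show "e p \<in> {..N (fst p)}" using e p by (auto simp: degree_weight_exps_def)
    qed (use e in \<open>auto simp: degree_weight_exps_def\<close>)
  qed
  show "finite (\<Pi>\<^sub>E p\<in>idx K D. {..N (fst p)})"
    using assms by (intro finite_PiE finite_SigmaI) auto
qed

lemma finite_weight_exps: "finite K \<Longrightarrow> finite (weight_weight_exps K D N m)"
  unfolding weight_weight_exps_def by (rule finite_subset[OF _ finite_degree_weight_exps]) auto

lemma mon_Suc:
  assumes "finite K" "p \<in> idx K D"
  shows "mon K D (e(p := Suc (e p))) c = c p * mon K D e c"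
proof -
  have "mon K D (e(p := Suc (e p))) c
      = c p ^ Suc (e p) * (\<Prod>q\<in>idx K D - {p}. c q ^ e q)"
    unfolding mon_def using assms by (subst prod.remove[of _ p]) auto
  also have "\<dots> = c p * mon K D e c"
    unfolding mon_def using assms by (subst (2) prod.remove[of _ p]) auto
  finally show ?thesis .
qed

lemma mdeg_Suc:
  assumes "i \<le> D k"
  shows "mdeg D (e((k, i) := Suc (e (k, i)))) = (mdeg D e)(k := Suc (mdeg D e k))"
proof
  fix j
  have "(\<Sum>l\<le>D k. (e((k, i) := Suc (e (k, i)))) (k, l)) = (\<Sum>l\<le>D k. e (k, l) + (if l = i then 1 else 0))"
    by (rule sum.cong) auto
  also have "\<dots> = Suc (\<Sum>l\<le>D k. e (k, l))"
    using assms by (simp add: sum.distrib)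
  finally show "mdeg D (e((k, i) := Suc (e (k, i)))) j = ((mdeg D e)(k := Suc (mdeg D e k))) j"
    by (cases "j = k") (simp only: mdeg_def fun_upd_same, simp add: mdeg_def)
qed

lemma mwt_Suc:
  assumes "finite K" "p \<in> idx K D"
  shows "mwt K D (e(p := Suc (e p))) = mwt K D e + wt D p"
proof -
  have "mwt K D (e(p := Suc (e p)))
      = (\<Sum>q\<in>idx K D. int (e q) * wt D q + (if q = p then wt D p else 0))"
    unfolding mwt_def by (rule sum.cong) (auto simp: algebra_simps)
  also have "\<dots> = mwt K D e + wt D p"
    unfolding mwt_def sum.distrib using assms by simp
  finally show ?thesis .
qed

text \<open>Induction on the total degree, splitting off one variable that occurs.\<close>

lemma mon_weighted:
  assumes "finite K" "e \<in> idx K D \<rightarrow>\<^sub>E UNIV"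
  shows "weighted K D (mdeg D e) (mwt K D e) (mon K D e)"
  using assms(2)
proof (induction "\<Sum>p\<in>idx K D. e p" arbitrary: e)
  case 0
  then have e: "\<And>p. p \<in> idx K D \<Longrightarrow> e p = 0" using assms(1) by auto
  then have "mon K D e = (\<lambda>_. 1)" "mwt K D e = 0"
    by (auto simp: mon_def mwt_def fun_eq_iff)
  moreover have "mdeg D e k = 0" if "k \<in> K" for k
    unfolding mdeg_def using e that by auto
  ultimately show ?case by (simp add: weighted.one)
next
  case (Suc n)
  then obtain p where p: "p \<in> idx K D" "e p \<noteq> 0"
    by (metis sum.neutral nat.distinct(1))
  obtain k i where ki: "p = (k, i)" "k \<in> K" "i \<le> D k" using p by auto
  define e' where "e' = e(p := e p - 1)"
  have e: "e = e'(p := Suc (e' p))" using p by (auto simp: e'_def)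
  have "(\<Sum>q\<in>idx K D. e q) = (\<Sum>q\<in>idx K D. e' q + (if q = p then 1 else 0))"
    by (rule sum.cong) (use p in \<open>auto simp: e'_def\<close>)
  also have "\<dots> = Suc (\<Sum>q\<in>idx K D. e' q)"
    using p assms(1) by (simp add: sum.distrib)
  finally have "n = (\<Sum>q\<in>idx K D. e' q)" using Suc.hyps(2) by simp
  moreover have "e' \<in> idx K D \<rightarrow>\<^sub>E UNIV"
    using Suc.prems p unfolding e'_def by (auto simp: PiE_iff extensional_def)
  ultimately have IH: "weighted K D (mdeg D e') (mwt K D e') (mon K D e')" by (rule Suc.hyps(1))
  have "mon K D e = (\<lambda>c. c (k, i) * mon K D e' c)"
    using mon_Suc[OF assms(1) p(1), of e'] ki unfolding e[symmetric] by (simp add: fun_eq_iff)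
  moreover have "mdeg D e = (mdeg D e')(k := Suc (mdeg D e' k))"
    using mdeg_Suc[of i D k e'] ki e by simp
  moreover have "mwt K D e = mwt K D e' + (2 * int i - int (D k))"
    using mwt_Suc[OF assms(1) p(1), of e'] unfolding e[symmetric] by (simp add: ki wt_def)
  ultimately show ?case
    using weighted.var[OF IH ki(2,3)] by simp
qed

lemma subspace_weighted: "fun_space.subspace (Collect (weighted K D N m))"
  unfolding fun_space.subspace_def
  using weighted.zero weighted.add weighted.scale
  by (auto simp: zero_fun_def plus_fun_def fscale_def)

lemma linear_mult_left: "Vector_Spaces.linear fscale fscale (\<lambda>f x. g x * f x)"
  by unfold_locales (auto simp: fscale_def fun_eq_iff algebra_simps)

interpretation fun_pair: vector_space_pair
  "fscale :: complex \<Rightarrow> ('a \<Rightarrow> complex) \<Rightarrow> 'a \<Rightarrow> complex"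
  "fscale :: complex \<Rightarrow> ('b \<Rightarrow> complex) \<Rightarrow> 'b \<Rightarrow> complex" ..

lemma weighted_eq_span:
  assumes "finite K"
  shows "Collect (weighted K D N m) = fun_space.span (mon K D ` weight_weight_exps K D N m)"
proof (rule antisym)
  show "fun_space.span (mon K D ` weight_weight_exps K D N m) \<subseteq> Collect (weighted K D N m)"
  proof (rule fun_space.span_minimal[OF _ subspace_weighted])
    show "mon K D ` weight_weight_exps K D N m \<subseteq> Collect (weighted K D N m)"
    proof clarify
      fix e assume e: "e \<in> weight_weight_exps K D N m"
      then have "weighted K D (mdeg D e) m (mon K D e)"
        using mon_weighted[OF assms, of e D] by (auto simp: weight_weight_exps_def degree_weight_exps_def)
      then show "weighted K D N m (mon K D e)"
        by (rule weighted_cong_degree) (use e in \<open>auto simp: weight_weight_exps_def degree_weight_exps_def\<close>)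
    qed
  qed
  show "Collect (weighted K D N m) \<subseteq> fun_space.span (mon K D ` weight_weight_exps K D N m)"
  proof clarify
    fix f assume "weighted K D N m f"
    then show "f \<in> fun_space.span (mon K D ` weight_weight_exps K D N m)"
    proof induction
      case (zero N m)
      then show ?case using fun_space.span_zero by (simp add: zero_fun_def)
    next
      case (one N)
      let ?e = "\<lambda>p\<in>idx K D. 0 :: nat"
      have "?e \<in> weight_weight_exps K D N 0"
        using one by (auto simp: weight_weight_exps_def degree_weight_exps_def mdeg_def mwt_def)
      moreover have "mon K D ?e = (\<lambda>_. 1)" by (auto simp: mon_def fun_eq_iff)
      ultimately show ?case by (metis fun_space.span_base image_eqI)
    next
      case (add N m f g)
      then show ?case using fun_space.span_add[of f _ g] by (simp add: plus_fun_def)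
    next
      case (scale N m f a)
      have "(\<lambda>c. a * f c) = fscale a f" by (simp add: fscale_def)
      then show ?case using fun_space.span_scale[OF scale.IH, of a] by metis
    next
      case (var N m f k i)
      let ?p = "(k, i)"
      let ?T = "weight_weight_exps K D (N(k := Suc (N k))) (m + (2 * int i - int (D k)))"
      have p: "?p \<in> idx K D" using var by auto
      \<comment> \<open>Multiplication by a variable is linear and sends monomials to monomials, so
        the induction step only has to be checked on generators of the span.\<close>
      have "(\<lambda>f c. c ?p * f c) ` mon K D ` weight_weight_exps K D N m \<subseteq> mon K D ` ?T"
      proof clarify
        fix e assume e: "e \<in> weight_weight_exps K D N m"
        have "e(?p := Suc (e ?p)) \<in> ?T"
          using e p var(2,3) unfolding weight_weight_exps_def degree_weight_exps_def
          by (auto simp: mwt_Suc[OF assms p] mdeg_Suc wt_def PiE_iff extensional_def)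
        moreover have "(\<lambda>c. c ?p * mon K D e c) = mon K D (e(?p := Suc (e ?p)))"
          by (simp add: fun_eq_iff mon_Suc[OF assms p])
        ultimately show "(\<lambda>c. c ?p * mon K D e c) \<in> mon K D ` ?T" by blast
      qed
      from fun_space.span_mono[OF this] show ?case
        using var.IH unfolding fun_pair.linear_span_image[OF linear_mult_left] by blast
    qed
  qed
qed

text \<open>Induction on the variables. With the others fixed, the relation is a polynomial in the
  variable q that vanishes at every complex number; each of its coefficients is a relation in fewer
  variables.\<close>

lemma monomials_independent:
  fixes a :: "('i \<Rightarrow> nat) \<Rightarrow> complex"
  assumes "finite I" "finite A" "A \<subseteq> I \<rightarrow>\<^sub>E UNIV"
    and "\<And>c. (\<Sum>e\<in>A. a e * (\<Prod>p\<in>I. c p ^ e p)) = 0" and "e \<in> A"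
  shows "a e = 0"
  using assms
proof (induction I arbitrary: A a e rule: finite_induct)
  case empty
  then have "A = {\<lambda>_. undefined}" by auto
  then show ?case using empty by auto
next
  case (insert q I)
  define A' where "A' = {x \<in> A. x q = e q}"
  have zero: "(\<Sum>x\<in>A'. a x * (\<Prod>p\<in>I. c p ^ x p)) = 0" for c
  proof -
    obtain n where n: "\<And>x. x \<in> A \<Longrightarrow> x q \<le> n"
      using finite_nat_set_iff_bounded_le[of "(\<lambda>x. x q) ` A"] insert.prems(1) by auto
    define b where "b j = (\<Sum>x\<in>{x \<in> A. x q = j}. a x * (\<Prod>p\<in>I. c p ^ x p))" for j
    have "(\<Sum>j\<le>n. b j * z ^ j) = 0" for z
    proof -
      have "(\<Sum>j\<le>n. b j * z ^ j)
          = (\<Sum>j\<le>n. \<Sum>x\<in>{x \<in> A. x q = j}. a x * (z ^ x q * (\<Prod>p\<in>I. c p ^ x p)))"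
        unfolding b_def sum_distrib_right by (intro sum.cong refl) (auto simp: algebra_simps)
      also have "\<dots> = (\<Sum>x\<in>A. a x * (z ^ x q * (\<Prod>p\<in>I. c p ^ x p)))"
        by (rule sum.group) (use insert.prems n in auto)
      also have "\<dots> = (\<Sum>x\<in>A. a x * (\<Prod>p\<in>insert q I. (c(q := z)) p ^ x p))"
      proof (intro sum.cong refl arg_cong2[of _ _ _ _ "(*)"])
        fix x
        have "(\<Prod>p\<in>I. c p ^ x p) = (\<Prod>p\<in>I. (c(q := z)) p ^ x p)"
          by (rule prod.cong) (use insert.hyps in auto)
        then show "z ^ x q * (\<Prod>p\<in>I. c p ^ x p) = (\<Prod>p\<in>insert q I. (c(q := z)) p ^ x p)"
          using insert.hyps by simp
      qed
      also have "\<dots> = 0" by (rule insert.prems)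
      finally show ?thesis .
    qed
    then have "\<forall>j\<le>n. b j = 0" using polyfun_eq_0[of b n] by simp
    then have "b (e q) = 0" using n insert.prems by auto
    then show ?thesis by (simp add: b_def A'_def)
  qed
  \<comment> \<open>On \<open>A'\<close> the exponent of q is constant, so forgetting it is
    injective and the coefficients can be transported to the restricted exponents.\<close>
  define R where "R x = restrict x I" for x :: "'i \<Rightarrow> nat"
  have inj: "inj_on R A'"
  proof (rule inj_onI)
    fix x y assume xy: "x \<in> A'" "y \<in> A'" "R x = R y"
    show "x = y"
    proof (rule PiE_ext[of x "insert q I" "\<lambda>_. UNIV" y])
      show "x i = y i" if "i \<in> insert q I" for i
      proof (cases "i = q")
        case False
        then show ?thesis using that fun_cong[OF xy(3), of i] by (simp add: R_def)
      qed (use xy in \<open>auto simp: A'_def\<close>)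
    qed (use xy insert.prems in \<open>auto simp: A'_def\<close>)
  qed
  define b where "b = a \<circ> the_inv_into A' R"
  have bR: "b (R x) = a x" if "x \<in> A'" for x
    using that by (simp add: b_def the_inv_into_f_f[OF inj])
  have "b (R e) = 0"
  proof (rule insert.IH[of "R ` A'" b "R e"])
    show "R e \<in> R ` A'" using insert.prems by (simp add: A'_def)
    show "(\<Sum>x\<in>R ` A'. b x * (\<Prod>p\<in>I. c p ^ x p)) = 0" for c
      using zero[of c] by (simp add: sum.reindex[OF inj] bR) (simp add: R_def)
  qed (use insert.prems in \<open>auto simp: A'_def R_def\<close>)
  then show ?case using bR[of e] insert.prems by (simp add: A'_def)
qed

lemma sum_fun_apply: "(\<Sum>x\<in>A. f x) c = (\<Sum>x\<in>A. f x c :: 'b::comm_monoid_add)"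
  by (induction A rule: infinite_finite_induct) auto

lemma mon_sum_eq_0:
  assumes "finite K" "finite A" "A \<subseteq> idx K D \<rightarrow>\<^sub>E UNIV"
    and "\<And>c. (\<Sum>e\<in>A. a e * mon K D e c) = 0" "e \<in> A"
  shows "a e = 0"
  by (rule monomials_independent[of "idx K D" A a e]) (use assms in \<open>auto simp: mon_def\<close>)

text \<open>Two distinct exponents with equal monomials would satisfy the relation with coefficients
  1 and -1. This has to be known before \<open>independent_mon\<close>, since the set of monomials
  does not see repetitions.\<close>

lemma inj_mon:
  assumes "finite K" shows "inj_on (mon K D) (idx K D \<rightarrow>\<^sub>E UNIV)"
proof (rule inj_onI, rule ccontr)
  fix x y assume xy: "x \<in> idx K D \<rightarrow>\<^sub>E UNIV" "y \<in> idx K D \<rightarrow>\<^sub>E UNIV" "mon K D x = mon K D y" "x \<noteq> y"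
  have "(if x = x then 1 else -1 :: complex) = 0"
    by (rule mon_sum_eq_0[OF assms, of "{x, y}" D "\<lambda>e. if e = x then 1 else -1" x]) (use xy in auto)
  then show False by simp
qed

lemma independent_mon:
  assumes "finite K" "A \<subseteq> idx K D \<rightarrow>\<^sub>E UNIV"
  shows "fun_space.independent (mon K D ` A)"
proof
  assume "fun_space.dependent (mon K D ` A)"
  then obtain T u v where T: "finite T" "T \<subseteq> mon K D ` A" "(\<Sum>f\<in>T. fscale (u f) f) = 0" "v \<in> T" "u v \<noteq> 0"
    unfolding fun_space.dependent_explicit by blast
  obtain A' where A': "A' \<subseteq> A" "finite A'" "T = mon K D ` A'"
    using finite_subset_image[OF T(1,2)] by blast
  have inj: "inj_on (mon K D) A'"
    using inj_mon[OF assms(1)] A'(1) assms(2) by (meson inj_on_subset order_trans)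
  obtain e where e: "e \<in> A'" "v = mon K D e" using T(4) A'(3) by auto
  have "u (mon K D e) = 0"
  proof (rule mon_sum_eq_0[OF assms(1) A'(2), of D "\<lambda>e. u (mon K D e)"])
    fix c
    have "(\<Sum>f\<in>T. fscale (u f) f) c = 0" using T(3) by simp
    then show "(\<Sum>e\<in>A'. u (mon K D e) * mon K D e c) = 0"
      unfolding A'(3) sum.reindex[OF inj] by (simp add: fscale_def sum_fun_apply)
  qed (use A' assms e in auto)
  then show False using T(5) e by simp
qed

lemma dim_weighted:
  assumes "finite K"
  shows "fun_space.dim (Collect (weighted K D N m)) = card (weight_weight_exps K D N m)"
proof -
  have "weight_weight_exps K D N m \<subseteq> idx K D \<rightarrow>\<^sub>E UNIV" by (auto simp: weight_weight_exps_def degree_weight_exps_def)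
  then show ?thesis
    unfolding weighted_eq_span[OF assms] fun_space.dim_span
    using fun_space.dim_eq_card_independent[OF independent_mon[OF assms, of "weight_weight_exps K D N m" D]]
      card_image[OF inj_on_subset[OF inj_mon[OF assms]]] by metis
qed

text \<open>The signs of the weights are reversed so that the lowering derivation takes the role of
  \<open>X\<close>: the surjection from weight 0 to weight 2 of the abstract module is then the
  lowering map from polynomials of weight 0 to those of weight -2.\<close>

lemma sl2_weight_module_weighted:
  assumes "finite K"
  shows "sl2_weight_module fscale (lie (lower D)) (lie (raise D)) (\<lambda>m. Collect (weighted K D N (- m)))
    (\<Sum>k\<in>K. int (N k * D k))"
proof unfold_locales
  fix m :: int and x y c
  assume x: "x \<in> Collect (weighted K D N (- m))"
  show "lie (lower D) x \<in> Collect (weighted K D N (- (m + 2)))"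
    using weighted_lower[of K D N "- m" x] x by simp
  show "lie (raise D) x \<in> Collect (weighted K D N (- (m - 2)))"
    using weighted_raise[of K D N "- m" x] x by (simp add: add.commute)
  show "lie (lower D) (fscale c x) = fscale c (lie (lower D) x)"
    "lie (raise D) (fscale c x) = fscale c (lie (raise D) x)"
    using x by (auto simp: fscale_def intro!: lie_scale)
  show "lie (lower D) (lie (raise D) x) - lie (raise D) (lie (lower D) x) = fscale (of_int m) x"
    using lie_commutator[of K D N "- m" x] x
    by (auto simp: fscale_def fun_eq_iff algebra_simps minus_equation_iff)
  assume y: "y \<in> Collect (weighted K D N (- m))"
  show "lie (lower D) (x + y) = lie (lower D) x + lie (lower D) y"
    "lie (raise D) (x + y) = lie (raise D) x + lie (raise D) y"
    using lie_add[of K D N "- m" x N "- m" y] x y by (auto simp: plus_fun_def)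
next
  fix m :: int
  assume "(\<Sum>k\<in>K. int (N k * D k)) < \<bar>m\<bar>"
  then show "Collect (weighted K D N (- m)) \<subseteq> {0}"
    using weighted_bounded[OF _ assms, of D N "- m"] by (auto simp: zero_fun_def)
qed (rule subspace_weighted)

lemma weighted_raise_eq_0:
  assumes "finite K" "weighted K D N 0 f" "lie (lower D) f = (\<lambda>_. 0)"
  shows "lie (raise D) f = (\<lambda>_. 0)"
  using sl2_weight_module.Y_eq_0[OF sl2_weight_module_weighted[OF assms(1)], of f D N] assms(2,3)
  by (simp add: zero_fun_def)

lemma dim_weighted_invariants:
  assumes "finite K"
  shows "fun_space.dim {f. weighted K D N 0 f \<and> lie (lower D) f = (\<lambda>_. 0)} + card (weight_weight_exps K D N (-2))
    = card (weight_weight_exps K D N 0)"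
proof -
  have "finite (mon K D ` weight_weight_exps K D N 0)" using finite_weight_exps[OF assms] by blast
  from sl2_weight_module.dim_kernel[OF sl2_weight_module_weighted[where D = D and N = N, OF assms] this]
  show ?thesis by (simp add: weighted_eq_span[OF assms, symmetric] dim_weighted[OF assms] zero_fun_def)
qed

subsection \<open>Binary forms and linear substitutions\<close>

definition bmon :: "nat \<Rightarrow> nat \<Rightarrow> form" where
  "bmon m i = (\<lambda>v. v $ 1 ^ i * v $ 2 ^ (m - i))"

lemma binary_forms_eq: "binary_forms m = fun_space.span (bmon m ` {..m})"
proof -
  have "{(\<lambda>v. v $ 1 ^ i * v $ 2 ^ (m - i)) | i. i \<le> m} = bmon m ` {..m}"
    by (auto simp: bmon_def)
  then show ?thesis by (simp add: binary_forms_def)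
qed

lemma bmon_sum_eq_0:
  assumes "(\<lambda>v. \<Sum>i\<le>m. a i * bmon m i v) = (\<lambda>_. 0)" "i \<le> m"
  shows "a i = 0"
proof -
  \<comment> \<open>Dehomogenising at v = (z, 1) turns the form into a polynomial in z.\<close>
  have "(\<Sum>i\<le>m. a i * z ^ i) = 0" for z
    using fun_cong[OF assms(1), of "vector [z, 1]"] by (simp add: bmon_def)
  then show ?thesis using polyfun_eq_0[of a m] assms(2) by blast
qed

lemma inj_on_bmon: "inj_on (bmon m) {..m}"
proof (rule inj_onI)
  fix i j assume ij: "i \<in> {..m}" "j \<in> {..m}" "bmon m i = bmon m j"
  have "(2 :: complex) ^ i = 2 ^ j"
    using fun_cong[OF ij(3), of "vector [2, 1]"] by (simp add: bmon_def)
  then have "(2 :: real) ^ i = 2 ^ j"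
    by (metis of_real_eq_iff of_real_numeral of_real_power)
  then show "i = j" by simp
qed

lemma independent_bmon: "fun_space.independent (bmon m ` {..m})"
proof -
  have "u (bmon m i) = 0" if "(\<Sum>f\<in>bmon m ` {..m}. fscale (u f) f) = 0" "i \<le> m" for u i
  proof (rule bmon_sum_eq_0[where a = "\<lambda>i. u (bmon m i)", OF _ that(2)])
    show "(\<lambda>v. \<Sum>i\<le>m. u (bmon m i) * bmon m i v) = (\<lambda>_. 0)"
      using that(1)
      by (simp add: sum.reindex[OF inj_on_bmon] fun_eq_iff sum_fun_apply fscale_def)
  qed
  then show ?thesis by (auto simp: fun_space.dependent_finite)
qed

interpretation fun_functional: vector_space_pair
  "fscale :: complex \<Rightarrow> ('a \<Rightarrow> complex) \<Rightarrow> 'a \<Rightarrow> complex" "(*) :: complex \<Rightarrow> complex \<Rightarrow> complex" ..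

text \<open>Coefficient functionals are extended from the binary forms to all functions, since
  \<open>poly_functions\<close> is built from linear forms on the space of all functions. The choice
  of extension does not affect values on binary forms.\<close>

definition coef :: "nat \<Rightarrow> nat \<Rightarrow> form \<Rightarrow> complex" where
  "coef m i = (SOME \<phi>. Vector_Spaces.linear fscale (*) \<phi> \<and>
     (\<forall>j\<le>m. \<phi> (bmon m j) = (if j = i then 1 else 0)))"

lemma coef: "Vector_Spaces.linear fscale (*) (coef m i)"
    and coef_bmon: "j \<le> m \<Longrightarrow> coef m i (bmon m j) = (if j = i then 1 else 0)"
proof -
  obtain \<phi> where \<phi>: "Vector_Spaces.linear fscale (*) \<phi>"
    "\<And>x. x \<in> bmon m ` {..m} \<Longrightarrow> \<phi> x = (if x = bmon m i \<and> i \<le> m then 1 else 0)"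
    using fun_functional.linear_independent_extend[OF independent_bmon[of m], of "\<lambda>x. if x = bmon m i \<and> i \<le> m then 1 else 0"]
    by blast
  have "\<phi> (bmon m j) = (if j = i then 1 else 0)" if "j \<le> m" for j
    using \<phi>(2)[of "bmon m j"] that inj_on_bmon[of m] by (auto simp: inj_on_def)
  with \<phi>(1) have "\<exists>\<phi>. Vector_Spaces.linear fscale (*) \<phi> \<and>
     (\<forall>j\<le>m. \<phi> (bmon m j) = (if j = i then 1 else 0))" by blast
  then have "Vector_Spaces.linear fscale (*) (coef m i) \<and>
     (\<forall>j\<le>m. coef m i (bmon m j) = (if j = i then 1 else 0))"
    unfolding coef_def by (rule someI_ex)
  then show "Vector_Spaces.linear fscale (*) (coef m i)"
    "j \<le> m \<Longrightarrow> coef m i (bmon m j) = (if j = i then 1 else 0)" by auto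
qed

lemma sum_bmon_in_binary_forms: "(\<lambda>v. \<Sum>i\<le>m. a i * bmon m i v) \<in> binary_forms m"
proof -
  have "(\<Sum>i\<le>m. fscale (a i) (bmon m i)) \<in> binary_forms m"
    unfolding binary_forms_eq
    by (intro fun_space.span_sum fun_space.span_scale fun_space.span_base) auto
  also have "(\<Sum>i\<le>m. fscale (a i) (bmon m i)) = (\<lambda>v. \<Sum>i\<le>m. a i * bmon m i v)"
    by (simp add: fun_eq_iff sum_fun_apply fscale_def)
  finally show ?thesis .
qed

lemma linear_sum_scale:
  assumes "Vector_Spaces.linear fscale (*) l"
  shows "l (\<lambda>v. \<Sum>i\<in>A. a i * f i v) = (\<Sum>i\<in>A. a i * l (f i))"
proof -
  have "(\<lambda>v. \<Sum>i\<in>A. a i * f i v) = (\<Sum>i\<in>A. fscale (a i) (f i))"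
    by (simp add: fun_eq_iff sum_fun_apply fscale_def)
  then show ?thesis
    by (simp add: fun_functional.linear_sum[OF assms] fun_functional.linear_scale[OF assms])
qed

lemma coef_sum_bmon:
  assumes "i \<le> m" shows "coef m i (\<lambda>v. \<Sum>j\<le>m. a j * bmon m j v) = a i"
proof -
  have "coef m i (\<lambda>v. \<Sum>j\<le>m. a j * bmon m j v) = (\<Sum>j\<le>m. if j = i then a j else 0)"
    unfolding linear_sum_scale[OF coef] by (rule sum.cong) (auto simp: coef_bmon)
  then show ?thesis using assms by simp
qed

lemma binary_forms_expand:
  assumes "f \<in> binary_forms m" shows "f = (\<lambda>v. \<Sum>i\<le>m. coef m i f * bmon m i v)"
proof -
  have "\<exists>a. f = (\<lambda>v. \<Sum>i\<le>m. a i * bmon m i v)"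
    using assms unfolding binary_forms_eq
  proof (induction rule: fun_space.span_induct_alt)
    case base
    then show ?case by (intro exI[of _ "\<lambda>_. 0"]) (simp add: zero_fun_def)
  next
    case (step c x y)
    then obtain j a where j: "j \<le> m" "x = bmon m j" "y = (\<lambda>v. \<Sum>i\<le>m. a i * bmon m i v)" by auto
    have "fscale c x + y = (\<lambda>v. \<Sum>i\<le>m. ((if i = j then c else 0) + a i) * bmon m i v)"
      using j(1) unfolding j(2,3) distrib_right sum.distrib
      by (simp add: fun_eq_iff fscale_def if_distrib[of "\<lambda>x. x * _"] cong: if_cong)
    then show ?case by (intro exI[of _ "\<lambda>i. (if i = j then c else 0) + a i"])
  qed
  then obtain a where a: "f = (\<lambda>v. \<Sum>i\<le>m. a i * bmon m i v)" ..
  show ?thesis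
    using coef_sum_bmon[of _ m a] unfolding a[symmetric] by (subst a) simp
qed

lemma binary_forms_mult_linear:
  assumes "f \<in> binary_forms m"
  shows "(\<lambda>v. (a * v $ 1 + b * v $ 2) * f v) \<in> binary_forms (Suc m)"
proof -
  let ?h = "\<lambda>f v. (a * v $ 1 + b * v $ 2) * f v"
  have "?h (bmon m i) \<in> binary_forms (Suc m)" if "i \<le> m" for i
  proof -
    have "?h (bmon m i) = fscale a (bmon (Suc m) (Suc i)) + fscale b (bmon (Suc m) i)"
      using that by (auto simp: fun_eq_iff bmon_def fscale_def Suc_diff_le algebra_simps)
    also have "\<dots> \<in> fun_space.span (bmon (Suc m) ` {..Suc m})"
      by (intro fun_space.span_add fun_space.span_scale fun_space.span_base) (use that in auto)
    finally show ?thesis by (simp add: binary_forms_eq)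
  qed
  then have "fun_space.span (?h ` bmon m ` {..m}) \<subseteq> binary_forms (Suc m)"
    unfolding binary_forms_eq by (intro fun_space.span_minimal) auto
  then have "?h ` binary_forms m \<subseteq> binary_forms (Suc m)"
    unfolding fun_pair.linear_span_image[OF linear_mult_left] binary_forms_eq[of m] .
  then show ?thesis using assms by blast
qed

lemma linear_pow_in_binary_forms:
  "(\<lambda>v. (a * v $ 1 + b * v $ 2) ^ i * (a' * v $ 1 + b' * v $ 2) ^ j) \<in> binary_forms (i + j)"
proof (induction i)
  case 0
  show ?case
  proof (induction j)
    case 0
    have "bmon 0 0 \<in> binary_forms 0" unfolding binary_forms_eq by (rule fun_space.span_base) simp
    then show ?case by (simp add: bmon_def)
  next
    case (Suc j)
    from binary_forms_mult_linear[OF this, of a' b'] show ?case by simp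
  qed
next
  case (Suc i)
  from binary_forms_mult_linear[OF this, of a b] show ?case by (simp add: mult.assoc)
qed

lemma matrix_vector_mult_2:
  fixes g :: "complex^2^2"
  shows "(g *v v) $ 1 = g $ 1 $ 1 * v $ 1 + g $ 1 $ 2 * v $ 2"
    and "(g *v v) $ 2 = g $ 2 $ 1 * v $ 1 + g $ 2 $ 2 * v $ 2"
  by (simp_all add: matrix_vector_mult_def sum_2)

lemma bmon_subst_in_binary_forms:
  fixes g :: "complex^2^2"
  assumes "i \<le> m" shows "(\<lambda>v. bmon m i (g *v v)) \<in> binary_forms m"
  using linear_pow_in_binary_forms[of "g $ 1 $ 1" "g $ 1 $ 2" i "g $ 2 $ 1" "g $ 2 $ 2" "m - i"] assms
  by (simp add: bmon_def matrix_vector_mult_2)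

lemma binary_forms_subst:
  fixes g :: "complex^2^2"
  assumes "f \<in> binary_forms m" shows "(\<lambda>v. f (g *v v)) \<in> binary_forms m"
proof -
  have "(\<lambda>v. f (g *v v)) = (\<Sum>i\<le>m. fscale (coef m i f) (\<lambda>v. bmon m i (g *v v)))"
    by (subst binary_forms_expand[OF assms]) (simp add: fun_eq_iff sum_fun_apply fscale_def)
  also have "\<dots> \<in> binary_forms m"
    unfolding binary_forms_def
    by (intro fun_space.span_sum fun_space.span_scale bmon_subst_in_binary_forms[unfolded binary_forms_def]) simp
  finally show ?thesis .
qed

text \<open>The matrix of the substitution v \<mapsto> g v in the monomial basis: \<open>i\<close>
  is the monomial substituted into, \<open>j\<close> the one whose coefficient is read off.\<close>

definition subst_coef :: "complex^2^2 \<Rightarrow> nat \<Rightarrow> nat \<Rightarrow> nat \<Rightarrow> complex" where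
  "subst_coef g m i j = coef m j (\<lambda>v. bmon m i (g *v v))"

lemma subst_coef_eqI:
  assumes "\<And>v. bmon m i (g *v v) = (\<Sum>j\<le>m. \<tau> j * bmon m j v)" "j \<le> m"
  shows "subst_coef g m i j = \<tau> j"
  unfolding subst_coef_def assms(1) by (rule coef_sum_bmon[OF assms(2)])

lemma coef_subst:
  assumes "f \<in> binary_forms m"
  shows "coef m j (\<lambda>v. f (g *v v)) = (\<Sum>i\<le>m. subst_coef g m i j * coef m i f)"
proof -
  have "(\<lambda>v. f (g *v v)) = (\<lambda>v. \<Sum>i\<le>m. coef m i f * bmon m i (g *v v))"
    by (subst binary_forms_expand[OF assms]) simp
  then show ?thesis
    by (simp add: linear_sum_scale[OF coef] subst_coef_def mult.commute)
qed

section \<open>Generators of SL2\<close>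

definition mat2 :: "complex \<Rightarrow> complex \<Rightarrow> complex \<Rightarrow> complex \<Rightarrow> complex^2^2" where
  "mat2 a b c d = vector [vector [a, b], vector [c, d]]"

lemma mat2_nth [simp]:
  "mat2 a b c d $ 1 $ 1 = a" "mat2 a b c d $ 1 $ 2 = b"
  "mat2 a b c d $ 2 $ 1 = c" "mat2 a b c d $ 2 $ 2 = d"
  by (simp_all add: mat2_def)

lemma mat2_mult: "mat2 a b c d ** mat2 a' b' c' d'
    = mat2 (a * a' + b * c') (a * b' + b * d') (c * a' + d * c') (c * b' + d * d')"
  by (simp add: vec_eq_iff forall_2 matrix_matrix_mult_def sum_2)

lemma SL2_iff: "g \<in> SL2 \<longleftrightarrow> g $ 1 $ 1 * g $ 2 $ 2 - g $ 1 $ 2 * g $ 2 $ 1 = 1"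
  by (simp add: SL2_def det_2)

lemma matrix_inv_SL2:
  assumes "g \<in> SL2"
  shows "matrix_inv g = mat2 (g $ 2 $ 2) (- g $ 1 $ 2) (- g $ 2 $ 1) (g $ 1 $ 1)"
proof -
  let ?h = "mat2 (g $ 2 $ 2) (- g $ 1 $ 2) (- g $ 2 $ 1) (g $ 1 $ 1)"
  have gh: "g ** ?h = mat 1" and hg: "?h ** g = mat 1"
    using assms unfolding SL2_iff
    by (auto simp: vec_eq_iff forall_2 matrix_matrix_mult_def sum_2 mat_def algebra_simps)
  \<comment> \<open>\<open>matrix_inv\<close> is defined by choice, so the existence of a two-sided
    inverse is what makes the chosen matrix an inverse.\<close>
  then have "matrix_inv g ** g = mat 1"
    unfolding matrix_inv_def by (metis (mono_tags, lifting) someI_ex)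
  then have "matrix_inv g ** (g ** ?h) = ?h"
    by (simp add: matrix_mul_assoc)
  then show ?thesis by (simp add: gh)
qed

lemma SL2_matrix_inv: "g \<in> SL2 \<Longrightarrow> matrix_inv g \<in> SL2"
  by (simp add: matrix_inv_SL2) (simp add: SL2_iff algebra_simps)

lemma matrix_inv_matrix_inv:
  assumes "g \<in> SL2" shows "matrix_inv (matrix_inv g) = g"
  using matrix_inv_SL2[OF SL2_matrix_inv[OF assms]]
  by (simp add: matrix_inv_SL2[OF assms] vec_eq_iff forall_2)

lemma form_act_matrix_inv: "g \<in> SL2 \<Longrightarrow> form_act (matrix_inv g) f = (\<lambda>v. f (g *v v))"
  by (simp add: form_act_def matrix_inv_matrix_inv)

lemma SL2_mult: "g \<in> SL2 \<Longrightarrow> h \<in> SL2 \<Longrightarrow> g ** h \<in> SL2"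
  by (simp add: SL2_def det_mul)

lemma matrix_inv_mult_SL2:
  assumes "g \<in> SL2" "h \<in> SL2"
  shows "matrix_inv (g ** h) = matrix_inv h ** matrix_inv g"
  unfolding matrix_inv_SL2[OF SL2_mult[OF assms]] matrix_inv_SL2[OF assms(1)] matrix_inv_SL2[OF assms(2)]
  by (simp add: vec_eq_iff forall_2 matrix_matrix_mult_def sum_2 algebra_simps)

lemma tensor_act_mult:
  assumes "g \<in> SL2" "h \<in> SL2"
  shows "tensor_act (g ** h) \<Phi> = tensor_act g (tensor_act h \<Phi>)"
proof (rule ext, clarify)
  fix w v
  have "rep_act (matrix_inv (g ** h)) w = rep_act (matrix_inv h) (rep_act (matrix_inv g) w)"
    unfolding rep_act_def form_act_matrix_inv[OF assms(1)] form_act_matrix_inv[OF assms(2)]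
      form_act_matrix_inv[OF SL2_mult[OF assms]]
    by (simp add: matrix_vector_mul_assoc)
  then show "tensor_act (g ** h) \<Phi> (w, v) = tensor_act g (tensor_act h \<Phi>) (w, v)"
    by (simp add: tensor_act_def matrix_inv_mult_SL2[OF assms] matrix_vector_mul_assoc)
qed

text \<open>Gauss decomposition with pivot \<open>g $ 1 $ 1\<close>; determinant 1 forces the second
  diagonal entry to be the inverse of the pivot.\<close>

lemma SL2_lower_diag_upper:
  fixes g :: "complex^2^2"
  assumes "g \<in> SL2" "g $ 1 $ 1 \<noteq> 0"
  obtains x y z where "z \<noteq> 0" "g = mat2 1 0 x 1 ** (mat2 z 0 0 (inverse z) ** mat2 1 y 0 1)"
proof
  let ?a = "g $ 1 $ 1"
  show "?a \<noteq> 0" by (rule assms)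
  have "g $ 2 $ 2 = inverse ?a + g $ 2 $ 1 * g $ 1 $ 2 / ?a"
    using assms by (simp add: SL2_iff field_simps)
  then show "g = mat2 1 0 (g $ 2 $ 1 / ?a) 1 ** (mat2 ?a 0 0 (inverse ?a) ** mat2 1 (g $ 1 $ 2 / ?a) 0 1)"
    using assms(2) by (simp add: mat2_mult vec_eq_iff forall_2 field_simps)
qed

lemma tensor_act_fixedI:
  assumes up: "\<And>s. tensor_act (mat2 1 s 0 1) \<Phi> = \<Phi>"
    and lo: "\<And>s. tensor_act (mat2 1 0 s 1) \<Phi> = \<Phi>"
    and to: "\<And>z. z \<noteq> 0 \<Longrightarrow> tensor_act (mat2 z 0 0 (inverse z)) \<Phi> = \<Phi>"
    and g: "g \<in> SL2"
  shows "tensor_act g \<Phi> = \<Phi>"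
proof -
  have SL: "mat2 1 s 0 1 \<in> SL2" "mat2 1 0 s 1 \<in> SL2" for s by (auto simp: SL2_iff)
  have SL3: "mat2 z 0 0 (inverse z) \<in> SL2" if "z \<noteq> 0" for z using that by (auto simp: SL2_iff)
  have *: "tensor_act g \<Phi> = \<Phi>" if g: "g \<in> SL2" "g $ 1 $ 1 \<noteq> 0" for g
  proof -
    obtain x y z where z: "z \<noteq> 0" and eq: "g = mat2 1 0 x 1 ** (mat2 z 0 0 (inverse z) ** mat2 1 y 0 1)"
      using SL2_lower_diag_upper[OF g] by blast
    show ?thesis
      unfolding eq tensor_act_mult[OF SL(2) SL2_mult[OF SL3[OF z] SL(1)]]
        tensor_act_mult[OF SL3[OF z] SL(1)] up lo to[OF z] ..
  qed
  show ?thesis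
  proof (cases "g $ 1 $ 1 = 0")
    case True
    then have "g $ 2 $ 1 \<noteq> 0" using g by (auto simp: SL2_iff)
    \<comment> \<open>Adding the second row to the first makes the pivot equal to
      \<open>g $ 2 $ 1\<close>, which is nonzero because the determinant is. The extra factor is an
      upper unipotent and is removed again below.\<close>
    then have "(mat2 1 1 0 1 ** g) $ 1 $ 1 \<noteq> 0"
      using True by (simp add: matrix_matrix_mult_def sum_2)
    moreover have "mat2 1 1 0 1 ** g \<in> SL2" using SL g SL2_mult by blast
    ultimately have "tensor_act (mat2 1 1 0 1 ** g) \<Phi> = \<Phi>" using * by blast
    then have "tensor_act (mat2 1 (-1) 0 1 ** (mat2 1 1 0 1 ** g)) \<Phi> = \<Phi>"
      using SL g SL2_mult by (simp only: tensor_act_mult up)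
    also have "mat2 1 (-1) 0 1 ** (mat2 1 1 0 1 ** g) = g"
      by (simp add: vec_eq_iff forall_2 matrix_matrix_mult_def sum_2)
    finally show ?thesis .
  qed (use * g in blast)
qed

section \<open>The group action in coordinates on pairs (w, v)\<close>

lemma rep_act_in_rep_space:
  assumes "w \<in> rep_space r d" "g \<in> SL2" shows "rep_act (matrix_inv g) w \<in> rep_space r d"
  using assms binary_forms_subst
  by (auto simp: rep_space_def rep_act_def form_act_matrix_inv zero_fun_def)

text \<open>Polynomial functions are extended by 0 outside the representation space, so the action
  has to preserve the complement as well.\<close>

lemma rep_act_in_rep_space_iff:
  assumes "g \<in> SL2" shows "rep_act (matrix_inv g) w \<in> rep_space r d \<longleftrightarrow> w \<in> rep_space r d"
proof
  assume "rep_act (matrix_inv g) w \<in> rep_space r d"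
  from rep_act_in_rep_space[OF this SL2_matrix_inv[OF assms]]
  have "rep_act g (rep_act (matrix_inv g) w) \<in> rep_space r d"
    by (simp add: matrix_inv_matrix_inv[OF assms])
  also have "rep_act g (rep_act (matrix_inv g) w) = w"
  proof -
    have "g ** matrix_inv g = mat 1"
      using assms by (simp add: matrix_inv_SL2 SL2_iff vec_eq_iff forall_2 matrix_matrix_mult_def
          sum_2 mat_def algebra_simps)
    then show ?thesis
      by (simp add: rep_act_def form_act_matrix_inv[OF assms] form_act_def fun_eq_iff
          matrix_vector_mul_assoc matrix_inv_matrix_inv[OF assms])
  qed
  finally show "w \<in> rep_space r d" .
qed (rule rep_act_in_rep_space[OF _ assms])

text \<open>The vector \<open>v\<close> is encoded as the linear form \<open>v $ 1 * y - v $ 2 * x\<close>, on which \<open>SL2\<close> acts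
  as on \<open>v\<close> because it preserves the determinant. This gives the block \<open>k = 0\<close>.\<close>

definition crd :: "(nat \<Rightarrow> nat) \<Rightarrow> (nat \<Rightarrow> form) \<times> (complex^2) \<Rightarrow> coords" where
  "crd d = (\<lambda>(w, v) (k, i).
     if k = 0 then (if i = 0 then v $ 1 else - v $ 2) else coef (d k) i (w k))"

definition subst_coords :: "(nat \<Rightarrow> nat) \<Rightarrow> complex^2^2 \<Rightarrow> coords \<Rightarrow> coords" where
  "subst_coords D g c = (\<lambda>(k, j). \<Sum>i\<le>D k. subst_coef g (D k) i j * c (k, i))"

lemma subst_coef_1:
  "subst_coef g 1 0 0 = g $ 2 $ 2" "subst_coef g 1 0 1 = g $ 2 $ 1"
  "subst_coef g 1 1 0 = g $ 1 $ 2" "subst_coef g 1 1 1 = g $ 1 $ 1"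
proof -
  have 0: "bmon 1 0 (g *v v) = (\<Sum>j\<le>1. (if j = 0 then g $ 2 $ 2 else g $ 2 $ 1) * bmon 1 j v)" for v
    by (simp add: bmon_def matrix_vector_mult_2 atMost_Suc)
  have 1: "bmon 1 1 (g *v v) = (\<Sum>j\<le>1. (if j = 0 then g $ 1 $ 2 else g $ 1 $ 1) * bmon 1 j v)" for v
    by (simp add: bmon_def matrix_vector_mult_2 atMost_Suc)
  show "subst_coef g 1 0 0 = g $ 2 $ 2" "subst_coef g 1 0 1 = g $ 2 $ 1"
    using subst_coef_eqI[OF 0, of 0] subst_coef_eqI[OF 0, of 1] by auto
  show "subst_coef g 1 1 0 = g $ 1 $ 2" "subst_coef g 1 1 1 = g $ 1 $ 1"
    using subst_coef_eqI[OF 1, of 0] subst_coef_eqI[OF 1, of 1] by auto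
qed

text \<open>In block 0 this is the identity det (v, g x) = det (g^(-1) v, x), valid for determinant
  1. In the other blocks the inverse in \<open>rep_act\<close> and the one in
  \<open>form_act\<close> cancel and leave the substitution by g.\<close>

lemma crd_act:
  assumes g: "g \<in> SL2" and w: "w \<in> rep_space r d" and p: "p \<in> idx {..r} (d(0 := 1))"
  shows "crd d (rep_act (matrix_inv g) w, matrix_inv g *v v) p = subst_coords (d(0 := 1)) g (crd d (w, v)) p"
proof -
  obtain k j where kj: "p = (k, j)" "k \<le> r" "j \<le> (d(0 := 1)) k" using p by auto
  show ?thesis
  proof (cases "k = 0")
    case True
    with kj have "j = 0 \<or> j = 1" by auto
    then show ?thesis
      unfolding kj True
      by (auto simp: crd_def subst_coords_def atMost_Suc subst_coef_1[simplified]
          matrix_inv_SL2[OF g] matrix_vector_mult_2)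
  next
    case False
    then have "w k \<in> binary_forms (d k)" using w kj by (auto simp: rep_space_def)
    from coef_subst[OF this, of j g] show ?thesis
      using False by (simp add: kj crd_def subst_coords_def rep_act_def form_act_matrix_inv[OF g])
  qed
qed

definition pull :: "nat \<Rightarrow> (nat \<Rightarrow> nat) \<Rightarrow> (coords \<Rightarrow> complex) \<Rightarrow> (nat \<Rightarrow> form) \<times> (complex^2) \<Rightarrow> complex" where
  "pull r d f = (\<lambda>(w, v). if w \<in> rep_space r d then f (crd d (w, v)) else 0)"

text \<open>Coordinates can be prescribed freely, so a polynomial in the coordinates is recovered
  from its pullback to pairs (w, v).\<close>

lemma crd_surj: "\<exists>w v. w \<in> rep_space r d \<and> (\<forall>p\<in>idx {..r} (d(0 := 1)). crd d (w, v) p = c p)"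
proof (intro exI conjI ballI)
  let ?w = "\<lambda>k. if k \<in> {1..r} then (\<lambda>v. \<Sum>i\<le>d k. c (k, i) * bmon (d k) i v) else 0"
  let ?v = "vector [c (0, 0), - c (0, 1)] :: complex^2"
  show "?w \<in> rep_space r d" by (auto simp: rep_space_def sum_bmon_in_binary_forms)
  fix p assume "p \<in> idx {..r} (d(0 := 1))"
  then obtain k i where p: "p = (k, i)" "k \<le> r" "i \<le> (d(0 := 1)) k" by auto
  show "crd d (?w, ?v) p = c p"
  proof (cases "k = 0")
    case True
    with p have "i = 0 \<or> i = 1" by auto
    with True p show ?thesis by (auto simp: crd_def)
  next
    case False
    with p show ?thesis by (auto simp: crd_def coef_sum_bmon)
  qed
qed

lemma linear_pull: "Vector_Spaces.linear fscale fscale (pull r d)"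
  by unfold_locales (auto simp: pull_def fscale_def fun_eq_iff algebra_simps)

subsection \<open>Unipotent and diagonal substitutions\<close>

lemma subst_coef_upper:
  assumes "i \<le> m" "j \<le> m"
  shows "subst_coef (mat2 1 s 0 1) m i j = of_nat (i choose j) * s ^ (i - j)"
proof (rule subst_coef_eqI[OF _ assms(2)])
  fix v :: "complex^2"
  have "bmon m i (mat2 1 s 0 1 *v v)
      = (\<Sum>j\<le>i. of_nat (i choose j) * v $ 1 ^ j * (s * v $ 2) ^ (i - j)) * v $ 2 ^ (m - i)"
    by (simp add: bmon_def matrix_vector_mult_2 binomial_ring)
  also have "\<dots> = (\<Sum>j\<le>i. of_nat (i choose j) * s ^ (i - j) * bmon m j v)"
    unfolding sum_distrib_right
  proof (intro sum.cong refl)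
    fix j assume "j \<in> {..i}"
    then have "m - j = (i - j) + (m - i)" using assms by auto
    then show "of_nat (i choose j) * v $ 1 ^ j * (s * v $ 2) ^ (i - j) * v $ 2 ^ (m - i)
        = of_nat (i choose j) * s ^ (i - j) * bmon m j v"
      by (simp add: bmon_def power_add power_mult_distrib)
  qed
  also have "\<dots> = (\<Sum>j\<le>m. of_nat (i choose j) * s ^ (i - j) * bmon m j v)"
    by (rule sum.mono_neutral_left) (use assms in \<open>auto simp: binomial_eq_0\<close>)
  finally show "bmon m i (mat2 1 s 0 1 *v v)
    = (\<Sum>j\<le>m. of_nat (i choose j) * s ^ (i - j) * bmon m j v)" .
qed

lemma subst_coef_lower:
  assumes "i \<le> m" "j \<le> m"
  shows "subst_coef (mat2 1 0 s 1) m i j = of_nat ((m - i) choose (m - j)) * s ^ (j - i)"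
proof (rule subst_coef_eqI[OF _ assms(2)])
  fix v :: "complex^2"
  have "bmon m i (mat2 1 0 s 1 *v v)
      = v $ 1 ^ i * (\<Sum>l\<le>m - i. of_nat ((m - i) choose l) * v $ 2 ^ l * (s * v $ 1) ^ (m - i - l))"
    using binomial_ring[of "v $ 2" "s * v $ 1" "m - i"]
    by (simp add: bmon_def matrix_vector_mult_2 add.commute)
  also have "\<dots> = (\<Sum>l\<le>m - i. of_nat ((m - i) choose l) * s ^ (m - l - i) * bmon m (m - l) v)"
    unfolding sum_distrib_left
  proof (intro sum.cong refl)
    fix l assume "l \<in> {..m - i}"
    then have l: "m - l = (m - i - l) + i" "m - (m - l) = l" "m - l - i = m - i - l" using assms by auto
    show "v $ 1 ^ i * (of_nat ((m - i) choose l) * v $ 2 ^ l * (s * v $ 1) ^ (m - i - l))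
        = of_nat ((m - i) choose l) * s ^ (m - l - i) * bmon m (m - l) v"
      unfolding bmon_def l(2,3) unfolding l(1) by (simp add: power_add power_mult_distrib)
  qed
  also have "\<dots> = (\<Sum>l\<le>m. of_nat ((m - i) choose l) * s ^ (m - l - i) * bmon m (m - l) v)"
    by (rule sum.mono_neutral_left) (use assms in \<open>auto simp: binomial_eq_0\<close>)
  also have "\<dots> = (\<Sum>j\<le>m. of_nat ((m - i) choose (m - j)) * s ^ (j - i) * bmon m j v)"
    by (rule sum.reindex_bij_witness[of _ "\<lambda>j. m - j" "\<lambda>j. m - j"]) auto
  finally show "bmon m i (mat2 1 0 s 1 *v v)
    = (\<Sum>j\<le>m. of_nat ((m - i) choose (m - j)) * s ^ (j - i) * bmon m j v)" .
qed

lemma subst_coef_diag: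
  assumes "i \<le> m" "j \<le> m" "z \<noteq> 0"
  shows "subst_coef (mat2 z 0 0 (inverse z)) m i j = (if j = i then z powi (2 * int i - int m) else 0)"
proof (rule subst_coef_eqI[OF _ assms(2)])
  fix v :: "complex^2"
  have eq: "2 * int i - int m = int i - int (m - i)" using assms(1) by auto
  have "z powi (2 * int i - int m) = z ^ i * inverse z ^ (m - i)"
    unfolding eq using assms(3) by (subst power_int_diff) (auto simp: field_simps)
  then have "bmon m i (mat2 z 0 0 (inverse z) *v v) = z powi (2 * int i - int m) * bmon m i v"
    by (simp add: bmon_def matrix_vector_mult_2 power_mult_distrib)
  also have "\<dots> = (\<Sum>j\<le>m. (if j = i then z powi (2 * int i - int m) else 0) * bmon m j v)"
    using assms(1) by (simp add: if_distrib[of "\<lambda>x. x * _"] cong: if_cong)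
  finally show "bmon m i (mat2 z 0 0 (inverse z) *v v) = \<dots>" .
qed

lemma choose_times_diff: "(n choose j) * (n - j) = (j + 1) * (n choose (j + 1))"
  using binomial_absorb_comp[of n j] binomial_absorption[of j n]
  by (simp add: mult.commute del: mult_Suc mult_Suc_right)

text \<open>Differentiating the coefficients of (x + s y)^i gives the vector field at the moved
  point for every s, not just at s = 0. The substitutions are thus the flow of
  \<open>raise D\<close>, and a vanishing derivation forces constancy along whole orbits.\<close>

lemma subst_coords_upper_deriv:
  assumes "p \<in> idx K D"
  shows "((\<lambda>s. subst_coords D (mat2 1 s 0 1) c p) has_field_derivative
    raise D (subst_coords D (mat2 1 s 0 1) c) p) (at s)"
proof -
  obtain k j where p: "p = (k, j)" "j \<le> D k" using assms by auto
  have eq: "subst_coords D (mat2 1 s 0 1) c (k, l)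
      = (\<Sum>i\<le>D k. of_nat (i choose l) * s ^ (i - l) * c (k, i))" if "l \<le> D k" for s l
    unfolding subst_coords_def using that by (simp add: subst_coef_upper)
  have "((\<lambda>s. \<Sum>i\<le>D k. of_nat (i choose j) * s ^ (i - j) * c (k, i)) has_field_derivative
      (\<Sum>i\<le>D k. of_nat (i choose j) * (of_nat (i - j) * s ^ (i - j - 1)) * c (k, i))) (at s)"
    by (auto intro!: derivative_eq_intros sum.cong)
  also have "(\<Sum>i\<le>D k. of_nat (i choose j) * (of_nat (i - j) * s ^ (i - j - 1)) * c (k, i))
      = (\<Sum>i\<le>D k. of_nat (j + 1) * (of_nat (i choose (j + 1)) * s ^ (i - (j + 1)) * c (k, i)))"
  proof (intro sum.cong refl)
    fix i
    have "(of_nat (i choose j) * of_nat (i - j) :: complex) = of_nat (j + 1) * of_nat (i choose (j + 1))"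
      unfolding of_nat_mult[symmetric] choose_times_diff ..
    then show "of_nat (i choose j) * (of_nat (i - j) * s ^ (i - j - 1)) * c (k, i)
      = of_nat (j + 1) * (of_nat (i choose (j + 1)) * s ^ (i - (j + 1)) * c (k, i))"
      by (simp add: mult.assoc[symmetric])
  qed
  also have "\<dots> = raise D (subst_coords D (mat2 1 s 0 1) c) p"
  proof (cases "j < D k")
    case True
    then show ?thesis unfolding p raise_def by (simp add: eq sum_distrib_left)
  next
    case False
    then show ?thesis unfolding p raise_def by (auto intro!: sum.neutral simp: binomial_eq_0)
  qed
  finally show ?thesis using eq[OF p(2)] by (simp add: p)
qed

lemma subst_coords_lower_deriv:
  assumes "p \<in> idx K D"
  shows "((\<lambda>s. subst_coords D (mat2 1 0 s 1) c p) has_field_derivative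
    lower D (subst_coords D (mat2 1 0 s 1) c) p) (at s)"
proof -
  obtain k j where p: "p = (k, j)" "j \<le> D k" using assms by auto
  have eq: "subst_coords D (mat2 1 0 s 1) c (k, l)
      = (\<Sum>i\<le>D k. of_nat ((D k - i) choose (D k - l)) * s ^ (l - i) * c (k, i))" if "l \<le> D k" for s l
    unfolding subst_coords_def using that by (simp add: subst_coef_lower)
  have "((\<lambda>s. \<Sum>i\<le>D k. of_nat ((D k - i) choose (D k - j)) * s ^ (j - i) * c (k, i)) has_field_derivative
      (\<Sum>i\<le>D k. of_nat ((D k - i) choose (D k - j)) * (of_nat (j - i) * s ^ (j - i - 1)) * c (k, i))) (at s)"
    by (auto intro!: derivative_eq_intros sum.cong)
  also have "(\<Sum>i\<le>D k. of_nat ((D k - i) choose (D k - j)) * (of_nat (j - i) * s ^ (j - i - 1)) * c (k, i))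
      = lower D (subst_coords D (mat2 1 0 s 1) c) p"
  proof (cases "0 < j")
    case True
    have "(\<Sum>i\<le>D k. of_nat ((D k - i) choose (D k - j)) * (of_nat (j - i) * s ^ (j - i - 1)) * c (k, i))
        = (\<Sum>i\<le>D k. of_nat (D k - j + 1) * (of_nat ((D k - i) choose (D k - (j - 1))) * s ^ (j - 1 - i) * c (k, i)))"
    proof (intro sum.cong refl)
      fix i assume i: "i \<in> {..D k}"
      \<comment> \<open>Subtraction is truncated: for i > j the left side vanishes through j - i,
        the right side because the lower binomial index exceeds the upper one.\<close>
      have "((D k - i) choose (D k - j)) * (j - i) = (D k - j + 1) * ((D k - i) choose (D k - (j - 1)))"
      proof (cases "i \<le> j")
        case le: True
        have "(D k - i) - (D k - j) = j - i" "D k - (j - 1) = Suc (D k - j)" using le True p i by auto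
        then show ?thesis
          using choose_times_diff[of "D k - i" "D k - j"] by simp
      qed (use True p i in \<open>auto simp: binomial_eq_0\<close>)
      then have "(of_nat ((D k - i) choose (D k - j)) * of_nat (j - i) :: complex)
          = of_nat (D k - j + 1) * of_nat ((D k - i) choose (D k - (j - 1)))"
        unfolding of_nat_mult[symmetric] by (rule arg_cong)
      then show "of_nat ((D k - i) choose (D k - j)) * (of_nat (j - i) * s ^ (j - i - 1)) * c (k, i)
          = of_nat (D k - j + 1) * (of_nat ((D k - i) choose (D k - (j - 1))) * s ^ (j - 1 - i) * c (k, i))"
        by (simp add: mult.assoc[symmetric] diff_right_commute)
    qed
    then show ?thesis using True p by (simp add: lower_def eq sum_distrib_left)
  qed (simp add: p lower_def)
  finally show ?thesis using eq[OF p(2)] by (simp add: p)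
qed

lemma subst_coords_id:
  assumes "p \<in> idx K D" shows "subst_coords D (mat2 1 0 0 1) c p = c p"
proof -
  obtain k j where p: "p = (k, j)" "j \<le> D k" using assms by auto
  have "subst_coords D (mat2 1 0 0 1) c p = (\<Sum>i\<le>D k. if i = j then c (k, i) else 0)"
    unfolding p subst_coords_def prod.case
  proof (intro sum.cong refl)
    fix i assume "i \<in> {..D k}"
    then have "subst_coef (mat2 1 0 0 1) (D k) i j = (if i = j then 1 else 0)"
      using p(2) by (cases i j rule: linorder_cases) (auto simp: subst_coef_upper binomial_eq_0)
    then show "subst_coef (mat2 1 0 0 1) (D k) i j * c (k, i) = (if i = j then c (k, i) else 0)"
      by simp
  qed
  then show ?thesis using p by simp
qed

text \<open>A function with zero derivative on the complex line is constant, with the value at s =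
  0; conversely the derivation is the derivative at s = 0. The flow starts at \<open>c\<close> only
  on \<open>idx K D\<close>, which suffices because polynomials read no other coordinates.\<close>

lemma weighted_flow_invariant_iff:
  assumes f: "weighted K D N m f" and af: "weighted K D N' m' (lie a f)"
    and \<gamma>: "\<And>s c p. p \<in> idx K D \<Longrightarrow> ((\<lambda>s. \<gamma> s c p) has_field_derivative a (\<gamma> s c) p) (at s)"
    and \<gamma>0: "\<And>c p. p \<in> idx K D \<Longrightarrow> \<gamma> 0 c p = c p"
  shows "lie a f = (\<lambda>_. 0) \<longleftrightarrow> (\<forall>s c. f (\<gamma> s c) = f c)"
proof -
  have deriv: "((\<lambda>s. f (\<gamma> s c)) has_field_derivative lie a f (\<gamma> s c)) (at s)" for s c
    unfolding lie_def by (rule weighted_chain_rule[OF f \<gamma>])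
  have start: "f (\<gamma> 0 c) = f c" "lie a f (\<gamma> 0 c) = lie a f c" for c
    using weighted_cong_coords[OF f \<gamma>0] weighted_cong_coords[OF af \<gamma>0] by auto
  show ?thesis
  proof
    assume zero: "lie a f = (\<lambda>_. 0)"
    show "\<forall>s c. f (\<gamma> s c) = f c"
    proof (intro allI)
      fix s c
      have "\<exists>b. \<forall>s\<in>UNIV. f (\<gamma> s c) = b"
        by (rule has_field_derivative_zero_constant) (use deriv[of c] zero in auto)
      then show "f (\<gamma> s c) = f c" using start(1)[of c] by auto
    qed
  next
    assume const: "\<forall>s c. f (\<gamma> s c) = f c"
    show "lie a f = (\<lambda>_. 0)"
    proof
      fix c
      have "((\<lambda>s. f (\<gamma> s c)) has_field_derivative 0) (at 0)" using const by simp
      then have "lie a f (\<gamma> 0 c) = 0" using deriv[of c 0] DERIV_unique by blast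
      then show "lie a f c = 0" using start(2) by simp
    qed
  qed
qed

lemma weighted_upper_invariant_iff:
  assumes "weighted K D N m f"
  shows "lie (raise D) f = (\<lambda>_. 0) \<longleftrightarrow> (\<forall>s c. f (subst_coords D (mat2 1 s 0 1) c) = f c)"
  by (rule weighted_flow_invariant_iff[OF assms weighted_raise[OF assms]])
    (rule subst_coords_upper_deriv subst_coords_id, assumption)+

lemma weighted_lower_invariant_iff:
  assumes "weighted K D N m f"
  shows "lie (lower D) f = (\<lambda>_. 0) \<longleftrightarrow> (\<forall>s c. f (subst_coords D (mat2 1 0 s 1) c) = f c)"
  by (rule weighted_flow_invariant_iff[OF assms weighted_lower[OF assms]])
    (rule subst_coords_lower_deriv subst_coords_id, assumption)+

lemma subst_coords_diag:
  assumes "p \<in> idx K D" "z \<noteq> 0"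
  shows "subst_coords D (mat2 z 0 0 (inverse z)) c p = z powi (wt D p) * c p"
proof -
  obtain k j where p: "p = (k, j)" "j \<le> D k" using assms by auto
  have "subst_coords D (mat2 z 0 0 (inverse z)) c p
      = (\<Sum>i\<le>D k. if j = i then z powi (2 * int i - int (D k)) * c (k, i) else 0)"
    unfolding p subst_coords_def prod.case
    using p(2) assms(2) by (intro sum.cong refl) (auto simp: subst_coef_diag)
  then show ?thesis using p by (simp add: wt_def)
qed

lemma mon_subst_diag:
  assumes "finite K" "z \<noteq> 0"
  shows "mon K D e (subst_coords D (mat2 z 0 0 (inverse z)) c) = z powi (mwt K D e) * mon K D e c"
proof -
  have "finite (idx K D)" using assms by auto
  then have "z powi (mwt K D e) = (\<Prod>p\<in>idx K D. (z powi (wt D p)) ^ e p)"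
    unfolding mwt_def using assms(2)
    by (induction rule: finite_induct) (auto simp: power_int_add power_int_mult mult.commute)
  then show ?thesis
    using assms(2) by (simp add: mon_def subst_coords_diag power_mult_distrib prod.distrib)
qed

lemma weighted_subst_diag:
  assumes "weighted K D N m f" "z \<noteq> 0"
  shows "f (subst_coords D (mat2 z 0 0 (inverse z)) c) = z powi m * f c"
  using assms(1)
proof induction
  case (var N m f k i)
  then have p: "(k, i) \<in> idx K D" by auto
  show ?case
    unfolding subst_coords_diag[OF p assms(2)] var.IH
    using assms(2) by (simp add: power_int_add wt_def)
qed (auto simp: algebra_simps)

subsection \<open>Covariants\<close>

text \<open>Fixed multidegree, all weights together: the tensor product containing the covariants is
  identified with this space before any invariance is imposed.\<close>

definition multihom :: "nat set \<Rightarrow> (nat \<Rightarrow> nat) \<Rightarrow> (nat \<Rightarrow> nat) \<Rightarrow> (coords \<Rightarrow> complex) set" where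
  "multihom K D N = fun_space.span (mon K D ` degree_weight_exps K D N)"

lemma weighted_subset_multihom:
  assumes "finite K" "weighted K D N m f" shows "f \<in> multihom K D N"
proof -
  have "weight_weight_exps K D N m \<subseteq> degree_weight_exps K D N" by (auto simp: weight_weight_exps_def degree_weight_exps_def)
  then show ?thesis
    using weighted_eq_span[OF assms(1), of D N m] assms(2) unfolding multihom_def
    by (metis (no_types, lifting) fun_space.span_mono image_mono mem_Collect_eq subsetD)
qed

lemma multihom_expand:
  assumes "finite K" "f \<in> multihom K D N"
  obtains a where "f = (\<lambda>c. \<Sum>e\<in>degree_weight_exps K D N. a e * mon K D e c)"
proof -
  have inj: "inj_on (mon K D) (degree_weight_exps K D N)"
    using inj_mon[OF assms(1)] by (rule inj_on_subset) (auto simp: degree_weight_exps_def)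
  obtain u where "f = (\<Sum>g\<in>mon K D ` degree_weight_exps K D N. fscale (u g) g)"
    using assms(2) finite_degree_weight_exps[OF assms(1), of D N] unfolding multihom_def
    by (subst (asm) fun_space.span_finite) auto
  then have "f = (\<lambda>c. \<Sum>e\<in>degree_weight_exps K D N. u (mon K D e) * mon K D e c)"
    by (simp add: sum.reindex[OF inj] fun_eq_iff sum_fun_apply fscale_def)
  then show ?thesis by (rule that)
qed

lemma multihom_cong_coords:
  assumes "finite K" "f \<in> multihom K D N" "\<And>p. p \<in> idx K D \<Longrightarrow> c p = c' p"
  shows "f c = f c'"
proof -
  obtain a where f: "f = (\<lambda>c. \<Sum>e\<in>degree_weight_exps K D N. a e * mon K D e c)"
    using multihom_expand[OF assms(1,2)] .
  have "mon K D e c = mon K D e c'" for e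
    unfolding mon_def by (rule prod.cong) (use assms(3) in auto)
  then show ?thesis by (simp add: f)
qed

lemma multihom_linear_form:
  assumes "finite K" "f \<in> multihom K D N" "k \<in> K"
  shows "(\<lambda>c. (\<Sum>i\<le>D k. a i * c (k, i)) * f c) \<in> multihom K D (N(k := Suc (N k)))"
proof -
  have "(\<lambda>c. c (k, i) * f c) \<in> multihom K D (N(k := Suc (N k)))" if i: "i \<le> D k" for i
  proof -
    let ?p = "(k, i)"
    have p: "?p \<in> idx K D" using assms(3) i by auto
    have "(\<lambda>f c. c ?p * f c) ` mon K D ` degree_weight_exps K D N \<subseteq> mon K D ` degree_weight_exps K D (N(k := Suc (N k)))"
    proof clarify
      fix e assume e: "e \<in> degree_weight_exps K D N"
      have "e(?p := Suc (e ?p)) \<in> degree_weight_exps K D (N(k := Suc (N k)))"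
        using e assms(3) i unfolding degree_weight_exps_def
        by (auto simp: mdeg_Suc PiE_iff extensional_def)
      moreover have "(\<lambda>c. c ?p * mon K D e c) = mon K D (e(?p := Suc (e ?p)))"
        by (simp add: fun_eq_iff mon_Suc[OF assms(1) p])
      ultimately show "(\<lambda>c. c ?p * mon K D e c) \<in> mon K D ` degree_weight_exps K D (N(k := Suc (N k)))" by blast
    qed
    from fun_space.span_mono[OF this] show ?thesis
      using assms(2) unfolding multihom_def fun_pair.linear_span_image[OF linear_mult_left] by blast
  qed
  then have "(\<Sum>i\<le>D k. fscale (a i) (\<lambda>c. c (k, i) * f c)) \<in> multihom K D (N(k := Suc (N k)))"
    unfolding multihom_def by (intro fun_space.span_sum fun_space.span_scale) auto
  also have "(\<Sum>i\<le>D k. fscale (a i) (\<lambda>c. c (k, i) * f c))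
      = (\<lambda>c. (\<Sum>i\<le>D k. a i * c (k, i)) * f c)"
    by (simp add: fun_eq_iff sum_fun_apply fscale_def sum_distrib_right mult.assoc)
  finally show ?thesis .
qed

lemma multihom_prod_linear_forms:
  assumes "finite K"
  shows "(\<lambda>c. \<Prod>k\<in>K. \<Prod>j<N k. \<Sum>i\<le>D k. a k j i * c (k, i)) \<in> multihom K D N"
proof -
  \<comment> \<open>Partial products over \<open>S\<close> have degree 0 in the blocks outside
    \<open>S\<close>. The outer induction adds a block, the inner one a linear form in it.\<close>
  have "(\<lambda>c. \<Prod>k\<in>S. \<Prod>j<N k. \<Sum>i\<le>D k. a k j i * c (k, i)) \<in> multihom K D (\<lambda>k. if k \<in> S then N k else 0)"
    if "finite S" "S \<subseteq> K" for S
    using that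
  proof (induction S rule: finite_induct)
    case empty
    let ?e = "\<lambda>p\<in>idx K D. 0 :: nat"
    have "?e \<in> degree_weight_exps K D (\<lambda>_. 0)" by (auto simp: degree_weight_exps_def mdeg_def)
    moreover have "mon K D ?e = (\<lambda>_. 1)" by (auto simp: mon_def fun_eq_iff)
    ultimately show ?case
      unfolding multihom_def by simp (metis fun_space.span_base image_eqI)
  next
    case (insert q S)
    let ?N = "\<lambda>k. if k \<in> S then N k else 0"
    let ?f = "\<lambda>c. \<Prod>k\<in>S. \<Prod>j<N k. \<Sum>i\<le>D k. a k j i * c (k, i)"
    have "(\<lambda>c. (\<Prod>j<n. \<Sum>i\<le>D q. a q j i * c (q, i)) * ?f c) \<in> multihom K D (?N(q := n))" for n
    proof (induction n)
      case 0
      have "?N(q := 0) = ?N" using insert by auto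
      then show ?case using insert by simp
    next
      case (Suc n)
      have "(\<lambda>c. (\<Sum>i\<le>D q. a q n i * c (q, i)) * ((\<Prod>j<n. \<Sum>i\<le>D q. a q j i * c (q, i)) * ?f c))
          \<in> multihom K D ((?N(q := n))(q := Suc ((?N(q := n)) q)))"
        by (rule multihom_linear_form[OF assms Suc]) (use insert.prems in auto)
      moreover have "(?N(q := n))(q := Suc ((?N(q := n)) q)) = ?N(q := Suc n)" by (rule ext) simp
      ultimately show ?case by (simp only: prod.lessThan_Suc mult_ac)
    qed
    from this[of "N q"] have "(\<lambda>c. (\<Prod>j<N q. \<Sum>i\<le>D q. a q j i * c (q, i)) * ?f c) \<in> multihom K D (?N(q := N q))" .
    moreover have "?N(q := N q) = (\<lambda>k. if k \<in> insert q S then N k else 0)" by (rule ext) simp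
    ultimately show ?case
      unfolding prod.insert[OF insert.hyps] by (simp only:)
  qed
  from this[OF assms order_refl] show ?thesis
    unfolding multihom_def degree_weight_exps_def by (simp cong: conj_cong ball_cong)
qed

text \<open>Lists the variables of a monomial with repetition, which brings it into the shape of a
  product of linear forms demanded by \<open>poly_functions\<close>.\<close>

lemma prod_power_as_prod_select:
  fixes e :: "nat \<Rightarrow> nat"
  shows "\<exists>\<sigma>. \<forall>c :: nat \<Rightarrow> complex. (\<Prod>j<(\<Sum>i\<le>m. e i). c (\<sigma> j)) = (\<Prod>i\<le>m. c i ^ e i)"
proof (induction m)
  case 0
  show ?case by (rule exI[of _ "\<lambda>_. 0"]) simp
next
  case (Suc m)
  then obtain \<sigma> where \<sigma>: "\<And>c :: nat \<Rightarrow> complex. (\<Prod>j<(\<Sum>i\<le>m. e i). c (\<sigma> j)) = (\<Prod>i\<le>m. c i ^ e i)" by blast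
  define \<tau> where "\<tau> j = (if j < (\<Sum>i\<le>m. e i) then \<sigma> j else Suc m)" for j
  have "(\<Prod>j<(\<Sum>i\<le>m. e i) + n. c (\<tau> j)) = (\<Prod>i\<le>m. c i ^ e i) * c (Suc m) ^ n"
    for c :: "nat \<Rightarrow> complex" and n
  proof (induction n)
    case 0
    show ?case unfolding \<sigma>[symmetric] by (auto intro!: prod.cong simp: \<tau>_def)
  next
    case (Suc n)
    then show ?case by (simp add: \<tau>_def)
  qed
  then show ?case by (intro exI[of _ \<tau>]) simp
qed

lemma degree_weight_exps_0:
  assumes "e \<in> degree_weight_exps {..r} (d(0 := 1)) (n(0 := L))" shows "e (0, 0) + e (0, 1) = L"
proof -
  have "mdeg (d(0 := 1)) e 0 = (n(0 := L)) 0"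
    using assms unfolding degree_weight_exps_def by blast
  then show ?thesis by (simp add: mdeg_def)
qed

text \<open>The sign stems from the coordinate \<open>- v $ 2\<close>. Degree L in block 0 ties the
  exponents of the two coordinates of v together, leaving a single \<open>bmon L\<close>.\<close>

lemma mon_crd:
  assumes "e \<in> degree_weight_exps {..r} (d(0 := 1)) (n(0 := L))"
  shows "mon {..r} (d(0 := 1)) e (crd d (w, v))
    = (-1) ^ e (0, 1) * bmon L (e (0, 0)) v * (\<Prod>k=1..r. \<Prod>i\<le>d k. coef (d k) i (w k) ^ e (k, i))"
proof -
  note L = degree_weight_exps_0[OF assms]
  have "mon {..r} (d(0 := 1)) e (crd d (w, v))
      = (\<Prod>k\<in>insert 0 {1..r}. \<Prod>i\<le>(d(0 := 1)) k. crd d (w, v) (k, i) ^ e (k, i))"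
  proof -
    have "insert 0 {1..r} = {..r}" by auto
    then show ?thesis by (simp add: mon_def prod.Sigma case_prod_unfold del: fun_upd_apply)
  qed
  also have "\<dots> = (v $ 1 ^ e (0, 0) * (- v $ 2) ^ e (0, 1))
      * (\<Prod>k=1..r. \<Prod>i\<le>d k. coef (d k) i (w k) ^ e (k, i))"
    by (simp add: crd_def)
  also have "(- v $ 2) ^ e (0, 1) = (-1) ^ e (0, 1) * v $ 2 ^ e (0, 1)"
    by (rule power_minus)
  finally show ?thesis
    by (simp only: bmon_def L[symmetric] add_diff_cancel_left' mult_ac)
qed

lemma fun_tensor_span:
  "fun_tensor (fun_space.span A) (fun_space.span B)
    = fun_space.span {(\<lambda>(x, y). f x * h y) | f h. f \<in> A \<and> h \<in> B}" (is "_ = ?T")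
proof (rule antisym)
  show "?T \<subseteq> fun_tensor (fun_space.span A) (fun_space.span B)"
    unfolding fun_tensor_def by (rule fun_space.span_mono) (blast intro: fun_space.span_base)
  have lin1: "Vector_Spaces.linear fscale fscale (\<lambda>f (x, y). f x * h y)" for h :: "'b \<Rightarrow> complex"
    by unfold_locales (auto simp: fscale_def fun_eq_iff algebra_simps)
  have lin2: "Vector_Spaces.linear fscale fscale (\<lambda>h (x, y). f x * h y)" for f :: "'a \<Rightarrow> complex"
    by unfold_locales (auto simp: fscale_def fun_eq_iff algebra_simps)
  have 1: "(\<lambda>(x, y). f x * h y) \<in> ?T" if "f \<in> fun_space.span A" "h \<in> B" for f h
  proof -
    have "(\<lambda>f (x, y). f x * h y) ` A \<subseteq> {(\<lambda>(x, y). f x * h y) | f h. f \<in> A \<and> h \<in> B}"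
      using that by blast
    from fun_space.span_mono[OF this] show ?thesis
      using that(1) unfolding fun_pair.linear_span_image[OF lin1] by blast
  qed
  have 2: "(\<lambda>(x, y). f x * h y) \<in> ?T" if "f \<in> fun_space.span A" "h \<in> fun_space.span B" for f h
  proof -
    have "(\<lambda>h (x, y). f x * h y) ` B \<subseteq> ?T"
      using 1 that by blast
    then have "fun_space.span ((\<lambda>h (x, y). f x * h y) ` B) \<subseteq> ?T"
      by (rule fun_space.span_minimal) simp
    then show ?thesis
      using that(2) unfolding fun_pair.linear_span_image[OF lin2] by blast
  qed
  show "fun_tensor (fun_space.span A) (fun_space.span B) \<subseteq> ?T"
    unfolding fun_tensor_def by (rule fun_space.span_minimal) (use 2 in auto)
qed

text \<open>Checked on generators in both directions: a monomial splits into linear forms on the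
  summands of W times a monomial in v, and a product of linear forms expands in the
  coordinates.\<close>

lemma fun_tensor_eq_pull:
  "fun_tensor (poly_functions r d n) (binary_forms L) = pull r d ` multihom {..r} (d(0 := 1)) (n(0 := L))"
    (is "_ = _ ` multihom ?K ?D ?N")
proof -
  define A where "A = {(\<lambda>w. if w \<in> rep_space r d then \<Prod>k=1..r. \<Prod>j<n k. l k j (w k) else 0) |
        l. \<forall>k j. Vector_Spaces.linear fscale (*) (l k j :: form \<Rightarrow> complex)}"
  let ?G = "{(\<lambda>(x, y). f x * h y) | f h. f \<in> A \<and> h \<in> bmon L ` {..L}}"
  have T: "fun_tensor (poly_functions r d n) (binary_forms L) = fun_space.span ?G"
    unfolding poly_functions_def binary_forms_eq fun_tensor_span A_def ..
  have P: "pull r d ` multihom ?K ?D ?N = fun_space.span (pull r d ` mon ?K ?D ` degree_weight_exps ?K ?D ?N)"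
    unfolding multihom_def by (rule fun_pair.linear_span_image[OF linear_pull, symmetric])
  show ?thesis
  proof (rule antisym)
    show "pull r d ` multihom ?K ?D ?N \<subseteq> fun_tensor (poly_functions r d n) (binary_forms L)"
      unfolding T P
    proof (rule fun_space.span_minimal, clarify)
      fix e assume e: "e \<in> degree_weight_exps ?K ?D ?N"
      have "\<forall>k. \<exists>\<sigma>. \<forall>c :: nat \<Rightarrow> complex. (\<Prod>j<(\<Sum>i\<le>d k. e (k, i)). c (\<sigma> j)) = (\<Prod>i\<le>d k. c i ^ e (k, i))"
        using prod_power_as_prod_select by blast
      then obtain \<sigma> where \<sigma>: "\<And>k (c :: nat \<Rightarrow> complex).
          (\<Prod>j<(\<Sum>i\<le>d k. e (k, i)). c (\<sigma> k j)) = (\<Prod>i\<le>d k. c i ^ e (k, i))"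
        by metis
      have nk: "(\<Sum>i\<le>d k. e (k, i)) = n k" if "k \<in> {1..r}" for k
        using e that by (auto simp: degree_weight_exps_def mdeg_def dest!: bspec[of _ _ k])
      have le: "e (0, 0) \<le> L" using degree_weight_exps_0[OF e] by simp
      define f where "f w = (if w \<in> rep_space r d then \<Prod>k=1..r. \<Prod>j<n k. coef (d k) (\<sigma> k j) (w k) else 0)" for w
      have f: "f \<in> A"
        unfolding A_def f_def
        by (rule CollectI, rule exI[of _ "\<lambda>k j. coef (d k) (\<sigma> k j)"]) (simp add: coef)
      have "pull r d (mon ?K ?D e) = fscale ((-1) ^ e (0, 1)) (\<lambda>(w, v). f w * bmon L (e (0, 0)) v)"
      proof (rule ext, clarify)
        fix w v
        have "(\<Prod>k=1..r. \<Prod>i\<le>d k. coef (d k) i (w k) ^ e (k, i)) = (\<Prod>k=1..r. \<Prod>j<n k. coef (d k) (\<sigma> k j) (w k))"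
        proof (rule prod.cong[OF refl])
          fix k assume k: "k \<in> {1..r}"
          show "(\<Prod>i\<le>d k. coef (d k) i (w k) ^ e (k, i)) = (\<Prod>j<n k. coef (d k) (\<sigma> k j) (w k))"
            using \<sigma>[of "\<lambda>i. coef (d k) i (w k)" k] nk[OF k] by simp
        qed
        then show "pull r d (mon ?K ?D e) (w, v)
            = fscale ((-1) ^ e (0, 1)) (\<lambda>(w, v). f w * bmon L (e (0, 0)) v) (w, v)"
          by (simp add: pull_def mon_crd[OF e] fscale_def f_def del: fun_upd_apply One_nat_def)
      qed
      also have "\<dots> \<in> fun_space.span ?G"
        by (intro fun_space.span_scale fun_space.span_base) (use f le in blast)
      finally show "pull r d (mon ?K ?D e) \<in> fun_space.span ?G" .
    qed simp
    show "fun_tensor (poly_functions r d n) (binary_forms L) \<subseteq> pull r d ` multihom ?K ?D ?N"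
      unfolding T
    proof (rule fun_space.span_minimal)
      show "fun_space.subspace (pull r d ` multihom ?K ?D ?N)"
        unfolding P by simp
      show "?G \<subseteq> pull r d ` multihom ?K ?D ?N"
      proof clarify
        fix f i assume "f \<in> A" and i: "i \<le> L"
        then obtain l where l: "\<And>k j. Vector_Spaces.linear fscale (*) (l k j :: form \<Rightarrow> complex)"
          "f = (\<lambda>w. if w \<in> rep_space r d then \<Prod>k=1..r. \<Prod>j<n k. l k j (w k) else 0)"
          unfolding A_def by blast
        \<comment> \<open>In block 0 the first \<open>i\<close> linear forms are c (0, 0), which is
          \<open>v $ 1\<close>, and the other L - i are - c (0, 1), which is \<open>v $ 2\<close>;
          their product is \<open>bmon L i\<close>. In the other blocks these are the values of
          \<open>l\<close> on the monomial basis.\<close>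
        define a where "a k j i' = (if k = 0 then (if j < i then (if i' = 0 then 1 else 0)
            else (if i' = 0 then 0 else -1)) else l k j (bmon (d k) i'))" for k j i'
        let ?g = "\<lambda>c. \<Prod>k\<in>?K. \<Prod>j<?N k. \<Sum>i\<le>?D k. a k j i * c (k, i)"
        have "?g \<in> multihom ?K ?D ?N" by (rule multihom_prod_linear_forms) simp
        moreover have "(\<lambda>(x, y). f x * bmon L i y) = pull r d ?g"
        proof (rule ext, clarify)
          fix w v
          show "f w * bmon L i v = pull r d ?g (w, v)"
          proof (cases "w \<in> rep_space r d")
            case True
            have "?g (crd d (w, v)) = (\<Prod>k\<in>insert 0 {1..r}. \<Prod>j<?N k. \<Sum>i\<le>?D k. a k j i * crd d (w, v) (k, i))"
              by (rule prod.cong) auto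
            also have "\<dots> = (\<Prod>j<L. if j < i then v $ 1 else v $ 2)
                * (\<Prod>k=1..r. \<Prod>j<n k. \<Sum>i\<le>d k. a k j i * coef (d k) i (w k))"
              by (simp add: crd_def) (auto intro!: prod.cong simp: a_def)
            also have "(\<Prod>j<L. if j < i then v $ 1 else v $ 2) = bmon L i v"
            proof -
              have "{..<L} \<inter> {j. j < i} = {..<i}" "{..<L} \<inter> - {j. j < i} = {i..<L}" using i by auto
              then show ?thesis by (simp add: prod.If_cases bmon_def)
            qed
            also have "(\<Prod>k=1..r. \<Prod>j<n k. \<Sum>i\<le>d k. a k j i * coef (d k) i (w k)) = f w"
            proof -
              have "(\<Sum>i\<le>d k. a k j i * coef (d k) i (w k)) = l k j (w k)" if k: "k \<in> {1..r}" for k j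
              proof -
                have wk: "w k \<in> binary_forms (d k)" using True k by (auto simp: rep_space_def)
                have "l k j (w k) = (\<Sum>i\<le>d k. coef (d k) i (w k) * l k j (bmon (d k) i))"
                  by (subst binary_forms_expand[OF wk]) (rule linear_sum_scale[OF l(1)])
                then show ?thesis using k by (simp add: a_def mult.commute)
              qed
              then show ?thesis using True by (simp add: l(2))
            qed
            finally show ?thesis using True by (simp add: pull_def)
          qed (simp add: l(2) pull_def)
        qed
        ultimately show "(\<lambda>(x, y). f x * bmon L i y) \<in> pull r d ` multihom ?K ?D ?N" by blast
      qed
    qed
  qed
qed

lemma tensor_act_pull:
  assumes "f \<in> multihom {..r} (d(0 := 1)) N" "g \<in> SL2"
  shows "tensor_act g (pull r d f) = pull r d (\<lambda>c. f (subst_coords (d(0 := 1)) g c))"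
proof (rule ext, clarify)
  fix w v
  show "tensor_act g (pull r d f) (w, v) = pull r d (\<lambda>c. f (subst_coords (d(0 := 1)) g c)) (w, v)"
  proof (cases "w \<in> rep_space r d")
    case True
    have "f (crd d (rep_act (matrix_inv g) w, matrix_inv g *v v)) = f (subst_coords (d(0 := 1)) g (crd d (w, v)))"
      by (rule multihom_cong_coords[OF _ assms(1)]) (use crd_act[OF assms(2) True] in auto)
    then show ?thesis
      using True by (simp add: tensor_act_def pull_def rep_act_in_rep_space_iff[OF assms(2)])
  qed (simp add: tensor_act_def pull_def rep_act_in_rep_space_iff[OF assms(2)])
qed

lemma pull_eqD:
  assumes "pull r d f = pull r d g"
    and "\<And>c c'. (\<And>p. p \<in> idx {..r} (d(0 := 1)) \<Longrightarrow> c p = c' p) \<Longrightarrow> f c = f c'"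
    and "\<And>c c'. (\<And>p. p \<in> idx {..r} (d(0 := 1)) \<Longrightarrow> c p = c' p) \<Longrightarrow> g c = g c'"
  shows "f c = g c"
proof -
  obtain w v where wv: "w \<in> rep_space r d" "\<And>p. p \<in> idx {..r} (d(0 := 1)) \<Longrightarrow> crd d (w, v) p = c p"
    using crd_surj[of r d c] by blast
  have "f (crd d (w, v)) = g (crd d (w, v))"
    using fun_cong[OF assms(1), of "(w, v)"] wv(1) by (simp add: pull_def)
  then show ?thesis using assms(2)[OF wv(2)] assms(3)[OF wv(2)] by simp
qed

lemma subst_coords_cong:
  assumes "\<And>p. p \<in> idx K D \<Longrightarrow> c p = c' p" "p \<in> idx K D"
  shows "subst_coords D g c p = subst_coords D g c' p"
proof -
  obtain k j where p: "p = (k, j)" "k \<in> K" using assms(2) by auto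
  have "c (k, i) = c' (k, i)" if "i \<le> D k" for i
    using assms(1)[of "(k, i)"] p(2) that by auto
  then show ?thesis by (simp add: subst_coords_def p)
qed

text \<open>As every coordinate vector on \<open>idx\<close> comes from some pair (w, v), invariance
  of the function on pairs is invariance of the polynomial at all coordinates.\<close>

lemma pull_fixed_iff:
  assumes f: "f \<in> multihom {..r} (d(0 := 1)) N" and g: "g \<in> SL2"
  shows "tensor_act g (pull r d f) = pull r d f \<longleftrightarrow> (\<forall>c. f (subst_coords (d(0 := 1)) g c) = f c)"
proof
  assume "tensor_act g (pull r d f) = pull r d f"
  then have eq: "pull r d (\<lambda>c. f (subst_coords (d(0 := 1)) g c)) = pull r d f"
    using tensor_act_pull[OF f g] by simp
  have cong: "f c = f c'" if "\<And>p. p \<in> idx {..r} (d(0 := 1)) \<Longrightarrow> c p = c' p" for c c'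
    by (rule multihom_cong_coords[OF _ f that]) simp_all
  show "\<forall>c. f (subst_coords (d(0 := 1)) g c) = f c"
    using pull_eqD[OF eq _ cong] cong subst_coords_cong by blast
qed (simp add: tensor_act_pull[OF f g])

section \<open>Covariants as invariant polynomials, and their dimension\<close>

lemma two_powi_eq_1:
  assumes "(2 :: real) powi k = 1" shows "k = 0"
proof (cases k rule: int_cases2)
  case (nonneg n)
  then show ?thesis using assms one_less_power[of "2 :: real" n] by (cases "n = 0") auto
next
  case (nonpos n)
  then show ?thesis using assms using one_less_power[of "2 :: real" n] by (cases "n = 0") (auto simp: power_int_minus)
qed

text \<open>An invariant has weight 0 by the diagonal matrices and is killed by \<open>lower\<close>
  through the lower unipotent ones. Conversely \<open>raise\<close> then kills it too by the sl2
  relations, so it is fixed by three subgroups that generate the group.\<close>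

lemma covariants_eq_pull:
  "covariants r d L n = pull r d ` {f. weighted {..r} (d(0 := 1)) (n(0 := L)) 0 f \<and> lie (lower (d(0 := 1))) f = (\<lambda>_. 0)}"
    (is "_ = _ ` {f. weighted ?K ?D ?N 0 f \<and> _ f}")
proof (intro antisym subsetI)
  have SL: "mat2 1 s 0 1 \<in> SL2" "mat2 1 0 s 1 \<in> SL2" for s by (auto simp: SL2_iff)
  have SL3: "mat2 z 0 0 (inverse z) \<in> SL2" if "z \<noteq> 0" for z using that by (auto simp: SL2_iff)
  {
    fix \<Phi> assume \<Phi>: "\<Phi> \<in> covariants r d L n"
    then obtain f where f: "f \<in> multihom ?K ?D ?N" "\<Phi> = pull r d f"
      unfolding covariants_def fun_tensor_eq_pull by blast
    have inv: "f (subst_coords ?D g c) = f c" if "g \<in> SL2" for g c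
      using \<Phi> that pull_fixed_iff[OF f(1) that] unfolding covariants_def f(2) by blast
    obtain a where a: "f = (\<lambda>c. \<Sum>e\<in>degree_weight_exps ?K ?D ?N. a e * mon ?K ?D e c)"
      using multihom_expand[OF _ f(1)] by auto
    have a0: "a e = 0" if e: "e \<in> degree_weight_exps ?K ?D ?N" "mwt ?K ?D e \<noteq> 0" for e
    proof -
      \<comment> \<open>The single diagonal element with z = 2 suffices: 2 is not a root of unity,
        so only weight 0 survives comparison of coefficients.\<close>
      have "a e * (2 powi (mwt ?K ?D e) - 1) = 0"
      proof (rule mon_sum_eq_0[of ?K "degree_weight_exps ?K ?D ?N" ?D "\<lambda>e. a e * (2 powi (mwt ?K ?D e) - 1)"])
        show "(\<Sum>e\<in>degree_weight_exps ?K ?D ?N. a e * (2 powi mwt ?K ?D e - 1) * mon ?K ?D e c) = 0" for c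
          using inv[OF SL3[of 2], of c]
          by (simp add: a mon_subst_diag[where z = 2, simplified] algebra_simps sum_subtractf)
      qed (rule finite_atMost finite_degree_weight_exps degree_weight_exps_subset e)+
      moreover have "(2 :: complex) powi (mwt ?K ?D e) \<noteq> 1"
      proof
        assume "(2 :: complex) powi (mwt ?K ?D e) = 1"
        then have "norm ((2 :: complex) powi (mwt ?K ?D e)) = 1" by simp
        then have "(2 :: real) powi (mwt ?K ?D e) = 1" by (simp add: norm_power_int)
        then show False using e(2) two_powi_eq_1 by blast
      qed
      ultimately show ?thesis by simp
    qed
    have "f = (\<Sum>e\<in>weight_weight_exps ?K ?D ?N 0. fscale (a e) (mon ?K ?D e))"
    proof
      fix c
      have "f c = (\<Sum>e\<in>weight_weight_exps ?K ?D ?N 0. a e * mon ?K ?D e c)"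
        unfolding a by (rule sum.mono_neutral_right)
          (use a0 finite_degree_weight_exps[of ?K ?D ?N] in \<open>auto simp: weight_weight_exps_def simp del: fun_upd_apply\<close>)
      then show "f c = (\<Sum>e\<in>weight_weight_exps ?K ?D ?N 0. fscale (a e) (mon ?K ?D e)) c"
        by (simp add: sum_fun_apply fscale_def)
    qed
    also have "\<dots> \<in> Collect (weighted ?K ?D ?N 0)"
      unfolding weighted_eq_span[OF finite_atMost]
      by (intro fun_space.span_sum fun_space.span_scale fun_space.span_base imageI)
    finally have hpf: "weighted ?K ?D ?N 0 f" by simp
    then have "lie (lower ?D) f = (\<lambda>_. 0)"
      using weighted_lower_invariant_iff[OF hpf] inv[OF SL(2)] by blast
    with hpf f(2) show "\<Phi> \<in> pull r d ` {f. weighted ?K ?D ?N 0 f \<and> lie (lower ?D) f = (\<lambda>_. 0)}" by blast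
  }
  fix \<Phi> assume "\<Phi> \<in> pull r d ` {f. weighted ?K ?D ?N 0 f \<and> lie (lower ?D) f = (\<lambda>_. 0)}"
  then obtain f where f: "\<Phi> = pull r d f" "weighted ?K ?D ?N 0 f" "lie (lower ?D) f = (\<lambda>_. 0)" by blast
  have ft: "f \<in> multihom ?K ?D ?N" by (rule weighted_subset_multihom[OF _ f(2)]) simp
  have up: "lie (raise ?D) f = (\<lambda>_. 0)" by (rule weighted_raise_eq_0[OF _ f(2,3)]) simp
  have "tensor_act g \<Phi> = \<Phi>" if "g \<in> SL2" for g
  proof (rule tensor_act_fixedI[OF _ _ _ that])
    show "tensor_act (mat2 1 s 0 1) \<Phi> = \<Phi>" for s
      unfolding f(1) pull_fixed_iff[OF ft SL(1)] using weighted_upper_invariant_iff[OF f(2)] up by blast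
    show "tensor_act (mat2 1 0 s 1) \<Phi> = \<Phi>" for s
      unfolding f(1) pull_fixed_iff[OF ft SL(2)] using weighted_lower_invariant_iff[OF f(2)] f(3) by blast
    show "tensor_act (mat2 z 0 0 (inverse z)) \<Phi> = \<Phi>" if "z \<noteq> 0" for z
      unfolding f(1) pull_fixed_iff[OF ft SL3[OF that]] using weighted_subst_diag[OF f(2) that]
      by (intro allI) (simp only: power_int_0_right mult_1_left)
  qed
  then show "\<Phi> \<in> covariants r d L n"
    using ft unfolding covariants_def fun_tensor_eq_pull f(1) by blast
qed

text \<open>In block 0 the exponents are L - a and a, of weights -1 and 1. They contribute 2 a - L,
  which leaves m + L - 2 a for the blocks of W.\<close>

lemma card_weight_exps_extend:
  "card (weight_weight_exps {..r} (d(0 := 1)) (n(0 := L)) m)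
    = (\<Sum>a\<le>L. card (weight_weight_exps {1..r} d n (m + int L - 2 * int a)))"
proof -
  let ?K = "{..r}" and ?D = "d(0 := 1)" and ?N = "n(0 := L)"
  let ?I = "idx {1..r} d"
  let ?ext = "\<lambda>(a, e) p. if p = (0, 0) then L - a else if p = (0, 1) then a else e p :: nat"
  have I: "idx ?K ?D = {(0, 0), (0, 1)} \<union> ?I"
  proof -
    have "i = 0 \<or> i = 1" if "i \<le> Suc 0" for i using that by auto
    then show ?thesis by (auto split: if_splits)
  qed
  have wt: "mwt ?K ?D e = int (e (0, 1)) - int (e (0, 0)) + mwt {1..r} d e" for e
  proof -
    have "mwt ?K ?D e = (\<Sum>p\<in>{(0, 0), (0, 1)}. int (e p) * wt ?D p) + (\<Sum>p\<in>?I. int (e p) * wt ?D p)"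
      unfolding mwt_def I by (rule sum.union_disjoint) auto
    also have "(\<Sum>p\<in>?I. int (e p) * wt ?D p) = mwt {1..r} d e"
      unfolding mwt_def by (rule sum.cong) (auto simp: wt_def)
    finally show ?thesis by (simp add: wt_def fun_upd_same del: fun_upd_apply One_nat_def)
  qed
  have deg: "(\<forall>k\<in>?K. mdeg ?D e k = ?N k) \<longleftrightarrow> e (0, 0) + e (0, 1) = L \<and> (\<forall>k\<in>{1..r}. mdeg d e k = n k)" for e
  proof -
    have "?K = insert 0 {1..r}" by auto
    then show ?thesis by (simp add: mdeg_def)
  qed
  have restr: "mwt {1..r} d (restrict e ?I) = mwt {1..r} d e" for e
    unfolding mwt_def by (rule sum.cong) auto
  have restr': "mdeg d (restrict e ?I) k = mdeg d e k" if "k \<in> {1..r}" for e k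
    unfolding mdeg_def by (rule sum.cong) (use that in auto)
  have ext: "mwt {1..r} d (?ext (a, e)) = mwt {1..r} d e" for a e
    unfolding mwt_def by (rule sum.cong) auto
  have ext': "mdeg d (?ext (a, e)) k = mdeg d e k" if "k \<in> {1..r}" for a e k
    unfolding mdeg_def by (rule sum.cong) (use that in auto)
  have "bij_betw (\<lambda>e. (e (0, 1), restrict e ?I)) (weight_weight_exps ?K ?D ?N m)
      (SIGMA a:{..L}. weight_weight_exps {1..r} d n (m + int L - 2 * int a))"
  proof (rule bij_betwI[where g = ?ext])
    show "(\<lambda>e. (e (0, 1), restrict e ?I)) \<in> weight_weight_exps ?K ?D ?N m \<rightarrow> (SIGMA a:{..L}. weight_weight_exps {1..r} d n (m + int L - 2 * int a))"
    proof (rule funcsetI)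
      fix e assume "e \<in> weight_weight_exps ?K ?D ?N m"
      then have "e (0, 0) + e (0, 1) = L" "\<forall>k\<in>{1..r}. mdeg d e k = n k"
        "int (e (0, 1)) - int (e (0, 0)) + mwt {1..r} d e = m"
        unfolding weight_weight_exps_def degree_weight_exps_def deg wt by blast+
      then have "e (0, 1) \<le> L" "restrict e ?I \<in> weight_weight_exps {1..r} d n (m + int L - 2 * int (e (0, 1)))"
        using restr[of e] unfolding weight_weight_exps_def degree_weight_exps_def by (auto simp: restr' simp del: restrict_apply One_nat_def)
      then show "(e (0, 1), restrict e ?I) \<in> (SIGMA a:{..L}. weight_weight_exps {1..r} d n (m + int L - 2 * int a))"
        by simp
    qed
    show "?ext \<in> (SIGMA a:{..L}. weight_weight_exps {1..r} d n (m + int L - 2 * int a)) \<rightarrow> weight_weight_exps ?K ?D ?N m"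
    proof (rule funcsetI)
      fix x assume "x \<in> (SIGMA a:{..L}. weight_weight_exps {1..r} d n (m + int L - 2 * int a))"
      then obtain a e where x: "x = (a, e)" "a \<le> L" "e \<in> weight_weight_exps {1..r} d n (m + int L - 2 * int a)" by auto
      have "?ext (a, e) \<in> idx ?K ?D \<rightarrow>\<^sub>E UNIV"
        using x(3) unfolding I by (auto simp: weight_weight_exps_def degree_weight_exps_def PiE_iff extensional_def)
      moreover have "\<forall>k\<in>?K. mdeg ?D (?ext (a, e)) k = ?N k"
        unfolding deg using x by (auto simp: ext'[simplified] weight_weight_exps_def degree_weight_exps_def)
      moreover have "mwt ?K ?D (?ext (a, e)) = m"
        unfolding wt ext using x by (auto simp: weight_weight_exps_def degree_weight_exps_def of_nat_diff)
      ultimately show "?ext x \<in> weight_weight_exps ?K ?D ?N m" unfolding x(1) weight_weight_exps_def degree_weight_exps_def by blast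
    qed
    show "?ext (e (0, 1), restrict e ?I) = e" if "e \<in> weight_weight_exps ?K ?D ?N m" for e
    proof
      fix p
      have e: "e \<in> idx ?K ?D \<rightarrow>\<^sub>E UNIV" "e (0, 0) + e (0, 1) = L"
        using that unfolding weight_weight_exps_def degree_weight_exps_def deg by auto
      consider "p = (0, 0)" | "p = (0, 1)" | "p \<in> ?I" | "p \<notin> idx ?K ?D" unfolding I by blast
      then show "?ext (e (0, 1), restrict e ?I) p = e p"
      proof cases
        case 4
        then have "p \<notin> ?I" "p \<noteq> (0, 0)" "p \<noteq> (0, 1)" unfolding I by auto
        then show ?thesis using PiE_arb[OF e(1) 4] by (auto simp: restrict_def)
      qed (use e(2) in auto)
    qed
    show "(?ext x (0, 1), restrict (?ext x) ?I) = x"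
      if "x \<in> (SIGMA a:{..L}. weight_weight_exps {1..r} d n (m + int L - 2 * int a))" for x
    proof -
      obtain a e where x: "x = (a, e)" "e \<in> ?I \<rightarrow>\<^sub>E UNIV"
        using \<open>x \<in> _\<close> by (auto simp: weight_weight_exps_def degree_weight_exps_def)
      have "restrict (?ext (a, e)) ?I = e"
      proof
        fix p show "restrict (?ext (a, e)) ?I p = e p"
          using PiE_arb[OF x(2), of p] by (cases "p \<in> ?I") auto
      qed
      then show ?thesis by (simp add: x(1))
    qed
  qed
  then have "card (weight_weight_exps ?K ?D ?N m) = card (SIGMA a:{..L}. weight_weight_exps {1..r} d n (m + int L - 2 * int a))"
    by (rule bij_betw_same_card)
  then show ?thesis by (simp add: finite_weight_exps)
qed

text \<open>With \<open>h a\<close> counting the exponents on W of weight L - 2 a, weight 0 on the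
  enlarged space gives the sum of \<open>h a\<close> and weight -2 the sum of
  \<open>h (Suc a)\<close>, both over a \<le> L. The difference telescopes to \<open>h 0\<close>
  minus \<open>h (Suc L)\<close>, that is, to the weights L and -L-2.\<close>

lemma dim_covariants:
  "fun_space.dim (covariants r d L n) + card (weight_weight_exps {1..r} d n (- int L - 2))
    = card (weight_weight_exps {1..r} d n (int L))"
proof -
  let ?K = "{..r}" and ?D = "d(0 := 1)" and ?N = "n(0 := L)"
  let ?V = "{f. weighted ?K ?D ?N 0 f \<and> lie (lower ?D) f = (\<lambda>_. 0)}"
  define h where "h a = card (weight_weight_exps {1..r} d n (int L - 2 * int a))" for a
  have sub: "?V \<subseteq> multihom ?K ?D ?N" using weighted_subset_multihom[of ?K] by auto
  have inj: "inj_on (pull r d) (multihom ?K ?D ?N)"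
  proof (rule inj_onI, rule ext)
    fix f g c assume "f \<in> multihom ?K ?D ?N" "g \<in> multihom ?K ?D ?N" "pull r d f = pull r d g"
    then show "f c = g c" by (rule_tac pull_eqD) (auto intro: multihom_cong_coords[of ?K])
  qed
  have span: "fun_space.span ?V \<subseteq> multihom ?K ?D ?N"
    by (rule fun_space.span_minimal[OF sub]) (simp add: multihom_def)
  \<comment> \<open>\<open>pull\<close> is injective on polynomials only, not on all functions of
    the coordinates, so the dimension is carried over through a basis.\<close>
  have "fun_space.dim (covariants r d L n) = fun_space.dim ?V"
  proof -
    obtain B where B: "B \<subseteq> ?V" "fun_space.independent B" "?V \<subseteq> fun_space.span B" "card B = fun_space.dim ?V"
      using fun_space.basis_exists by blast
    have injB: "inj_on (pull r d) (fun_space.span B)"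
      using inj span fun_space.span_mono[OF B(1)] by (meson inj_on_subset)
    have "fun_space.span (pull r d ` ?V) = fun_space.span (pull r d ` B)"
      unfolding fun_pair.linear_span_image[OF linear_pull]
      using fun_space.span_mono[OF B(1)] fun_space.span_mono[OF B(3)]
      unfolding fun_space.span_span by (intro arg_cong[where f = "(`) (pull r d)"] antisym)
    then have "fun_space.dim (pull r d ` ?V) = card (pull r d ` B)"
      using fun_pair.linear_independent_injective_image[OF linear_pull B(2) injB]
      by (intro fun_space.dim_eq_card) simp_all
    also have "\<dots> = card B"
      by (rule card_image) (rule inj_on_subset[OF injB fun_space.span_superset])
    finally show ?thesis unfolding covariants_eq_pull B(4) .
  qed
  then have "fun_space.dim (covariants r d L n) + (\<Sum>a\<le>L. h (Suc a)) = (\<Sum>a\<le>L. h a)"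
    using dim_weighted_invariants[of ?K ?D ?N] unfolding card_weight_exps_extend h_def
    by (simp add: algebra_simps)
  moreover have "h 0 + (\<Sum>a\<le>L. h (Suc a)) = (\<Sum>a\<le>L. h a) + h (Suc L)"
    using sum.atMost_Suc_shift[of h L] by simp
  ultimately have "fun_space.dim (covariants r d L n) + h (Suc L) = h 0" by linarith
  then show ?thesis by (simp add: h_def algebra_simps)
qed

subsection \<open>Laurent coefficients as contour integrals\<close>

lemma has_contour_integral_powi:
  assumes "R > 0"
  shows "((\<lambda>z. z powi n) has_contour_integral (if n = -1 then 2 * of_real pi * \<i> else 0)) (circlepath 0 R)"
proof -
  have "((\<lambda>z::complex. 1 * z powi (- ((- n - 1) + 1))) has_contour_integral
      complex_of_real (2 * pi) * \<i> * fls_nth 1 (- n - 1)) (circlepath 0 R)"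
    by (rule fls_nth_as_contour_integral[where r = "R + 1"])
      (use assms in \<open>auto intro: laurent_expansion_intros\<close>)
  then show ?thesis by (auto split: if_splits)
qed

text \<open>Termwise integration of an absolutely convergent Laurent series. The index set is
  arbitrary, so many terms may share a power of z; integration picks out the fibre of
  \<open>w\<close> over m.\<close>

lemma contour_integral_laurent_sum:
  fixes b :: "'x \<Rightarrow> complex" and w :: "'x \<Rightarrow> int"
  assumes R: "R > 0" and summ: "(\<lambda>x. norm (b x) * R powi w x) summable_on X"
  shows "((\<lambda>z. z powi (- m - 1) * (\<Sum>\<^sub>\<infinity>x\<in>X. b x * z powi w x)) has_contour_integral
      2 * of_real pi * \<i> * (\<Sum>\<^sub>\<infinity>x\<in>{x \<in> X. w x = m}. b x)) (circlepath 0 R)"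
    and "b summable_on {x \<in> X. w x = m}"
proof -
  define f where "f x z = z powi (- m - 1) * (b x * z powi w x)" for x z
  define F where "F z = (\<Sum>\<^sub>\<infinity>x\<in>X. f x z)" for z
  have sphere: "path_image (circlepath 0 R) = sphere (0 :: complex) R" using R by simp
  have f_norm: "norm (f x z) = R powi (- m - 1) * (norm (b x) * R powi w x)" if "z \<in> sphere 0 R" for x z
    using that by (simp add: f_def norm_mult norm_power_int)
  have summ': "(\<lambda>x. R powi (- m - 1) * (norm (b x) * R powi w x)) summable_on X"
    using summ by (rule summable_on_cmult_right)
  \<comment> \<open>On the circle the norm of each term is constant, so the absolute series is
    itself the majorant for the Weierstrass test.\<close>
  have ul: "uniform_limit (sphere 0 R) (\<lambda>A z. \<Sum>x\<in>A. f x z) F (finite_subsets_at_top X)"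
    unfolding F_def using summ' by (rule Weierstrass_m_test_general[rotated]) (simp add: f_norm)
  have f_int: "(f x has_contour_integral (if w x = m then 2 * of_real pi * \<i> * b x else 0)) (circlepath 0 R)" for x
  proof -
    have "((\<lambda>z. b x * z powi (w x - m - 1)) has_contour_integral
        b x * (if w x - m - 1 = -1 then 2 * of_real pi * \<i> else 0)) (circlepath 0 R)"
      by (intro has_contour_integral_lmul has_contour_integral_powi R)
    then have "(f x has_contour_integral b x * (if w x - m - 1 = -1 then 2 * of_real pi * \<i> else 0)) (circlepath 0 R)"
    proof (rule has_contour_integral_eq)
      fix z :: complex assume "z \<in> path_image (circlepath 0 R)"
      then have "z \<noteq> 0" using R sphere by auto
      then have "z powi (- m - 1) * z powi w x = z powi (- m - 1 + w x)"
        by (simp add: power_int_add)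
      then show "b x * z powi (w x - m - 1) = f x z"
        by (simp add: f_def algebra_simps)
    qed
    then show ?thesis by (auto split: if_splits simp: mult.commute)
  qed
  have sum_int: "((\<lambda>z. \<Sum>x\<in>A. f x z) has_contour_integral
      (\<Sum>x\<in>A. if w x = m then 2 * of_real pi * \<i> * b x else 0)) (circlepath 0 R)" if "finite A" for A
    by (rule has_contour_integral_sum[OF that]) (rule f_int)
  have ev: "\<forall>\<^sub>F A in finite_subsets_at_top X. (\<lambda>z. \<Sum>x\<in>A. f x z) contour_integrable_on circlepath 0 R"
    using eventually_finite_subsets_at_top_weakI sum_int has_contour_integral_integrable
    by (metis (no_types, lifting))
  have F_int: "F contour_integrable_on circlepath 0 R"
    and lim: "((\<lambda>A. contour_integral (circlepath 0 R) (\<lambda>z. \<Sum>x\<in>A. f x z)) \<longlongrightarrow>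
      contour_integral (circlepath 0 R) F) (finite_subsets_at_top X)"
    using contour_integral_uniform_limit_circlepath[OF ev ul _ R] by simp_all
  have hs: "((\<lambda>x. if w x = m then 2 * of_real pi * \<i> * b x else 0) has_sum
      contour_integral (circlepath 0 R) F) X"
    unfolding has_sum_def
  proof (rule Lim_transform_eventually[OF lim])
    show "\<forall>\<^sub>F A in finite_subsets_at_top X. contour_integral (circlepath 0 R) (\<lambda>z. \<Sum>x\<in>A. f x z)
        = (\<Sum>x\<in>A. if w x = m then 2 * of_real pi * \<i> * b x else 0)"
      by (rule eventually_finite_subsets_at_top_weakI) (rule contour_integral_unique[OF sum_int])
  qed
  define \<kappa> :: complex where "\<kappa> = 2 * of_real pi * \<i>"
  have \<kappa>: "\<kappa> \<noteq> 0" by (simp add: \<kappa>_def)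
  \<comment> \<open>Terms of other powers integrate to 0 and drop out. Keeping the statement as
    \<open>has_sum\<close> yields summability of the coefficients along with the value.\<close>
  have "((\<lambda>x. \<kappa> * b x) has_sum contour_integral (circlepath 0 R) F) {x \<in> X. w x = m}"
    using hs unfolding \<kappa>_def[symmetric] by (rule has_sum_cong_neutral[THEN iffD1, rotated -1]) auto
  from has_sum_cmult_right[OF this, of "inverse \<kappa>"]
  have hs': "(b has_sum (inverse \<kappa> * contour_integral (circlepath 0 R) F)) {x \<in> X. w x = m}"
    using \<kappa> by (simp add: mult.assoc[symmetric])
  then show "b summable_on {x \<in> X. w x = m}" by (rule has_sum_imp_summable)
  have "contour_integral (circlepath 0 R) F = 2 * of_real pi * \<i> * (\<Sum>\<^sub>\<infinity>x\<in>{x \<in> X. w x = m}. b x)"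
    unfolding infsumI[OF hs'] \<kappa>_def[symmetric] using \<kappa> by simp
  then have "(F has_contour_integral 2 * of_real pi * \<i> * (\<Sum>\<^sub>\<infinity>x\<in>{x \<in> X. w x = m}. b x)) (circlepath 0 R)"
    using has_contour_integral_integral[OF F_int] by simp
  moreover have "F z = z powi (- m - 1) * (\<Sum>\<^sub>\<infinity>x\<in>X. b x * z powi w x)" if "z \<in> path_image (circlepath 0 R)" for z
  proof -
    have "(\<lambda>x. norm (b x * z powi w x)) summable_on X"
      using summ that R by (simp add: norm_mult norm_power_int)
    then have "(\<lambda>x. b x * z powi w x) summable_on X" by (rule abs_summable_summable)
    then show ?thesis unfolding F_def f_def by (intro infsum_cmult_right) simp
  qed
  ultimately show "((\<lambda>z. z powi (- m - 1) * (\<Sum>\<^sub>\<infinity>x\<in>X. b x * z powi w x)) has_contour_integral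
      2 * of_real pi * \<i> * (\<Sum>\<^sub>\<infinity>x\<in>{x \<in> X. w x = m}. b x)) (circlepath 0 R)"
    by (rule has_contour_integral_eq) 
qed

lemma abs_summable_on_geometric:
  fixes x :: complex
  assumes "norm x < 1"
  shows "(\<lambda>n. norm (x ^ n)) summable_on UNIV"
  using assms by (intro norm_summable_imp_summable_on) (simp add: norm_power summable_geometric)

lemma infsum_geometric:
  fixes x :: complex
  assumes "norm x < 1"
  shows "(\<Sum>\<^sub>\<infinity>n. x ^ n) = 1 / (1 - x)"
proof (rule infsumI)
  show "((\<lambda>n. x ^ n) has_sum 1 / (1 - x)) UNIV"
    using assms by (intro norm_summable_imp_has_sum geometric_sums) (simp_all add: norm_power summable_geometric)
qed

lemma abs_summable_on_prod_geometric:
  fixes x :: "'i \<Rightarrow> complex"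
  assumes "finite A" "\<And>p. p \<in> A \<Longrightarrow> norm (x p) < 1"
  shows "(\<lambda>e. norm (\<Prod>p\<in>A. x p ^ e p)) summable_on (A \<rightarrow>\<^sub>E UNIV)"
proof -
  have "Infinite_Set_Sum.abs_summable_on (\<lambda>e. \<Prod>p\<in>A. x p ^ e p) (A \<rightarrow>\<^sub>E UNIV)"
    by (rule abs_summable_on_prod_PiE)
      (use assms abs_summable_on_geometric in \<open>auto simp: abs_summable_equivalent[symmetric]\<close>)
  then show ?thesis by (simp add: abs_summable_equivalent)
qed

lemma infsum_prod_geometric:
  fixes x :: "'i \<Rightarrow> complex"
  assumes "finite A" "\<And>p. p \<in> A \<Longrightarrow> norm (x p) < 1"
  shows "(\<Sum>\<^sub>\<infinity>e\<in>A \<rightarrow>\<^sub>E UNIV. \<Prod>p\<in>A. x p ^ e p) = (\<Prod>p\<in>A. 1 / (1 - x p))"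
  using infsum_prod_PiE_abs[of A "\<lambda>p n. x p ^ n" "\<lambda>_. UNIV"] assms abs_summable_on_geometric
  by (simp add: infsum_geometric)

lemma prod_powi_eq_powi_sum:
  fixes z :: complex
  assumes "finite A" "z \<noteq> 0"
  shows "(\<Prod>p\<in>A. (c p * z powi w p) ^ e p) = (\<Prod>p\<in>A. c p ^ e p) * z powi (\<Sum>p\<in>A. int (e p) * w p)"
  using assms by (induction rule: finite_induct)
    (auto simp: power_mult_distrib power_int_add power_int_power' mult.commute mult.left_commute)

text \<open>Geometric expansion of every factor, possible once all ratios are below 1 on the circle.
  It serves both circles: the unit circle with all weights of W, and a small circle with positive
  weights only.\<close>

lemma contour_integral_prod_geometric:
  fixes c :: "'i \<Rightarrow> complex" and w :: "'i \<Rightarrow> int"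
  assumes A: "finite A" and R: "R > 0" and small: "\<And>p. p \<in> A \<Longrightarrow> norm (c p) * R powi w p < 1"
  defines "E m \<equiv> {e \<in> A \<rightarrow>\<^sub>E UNIV. (\<Sum>p\<in>A. int (e p) * w p) = m}"
  shows "((\<lambda>z. z powi (- m - 1) * (\<Prod>p\<in>A. 1 / (1 - c p * z powi w p))) has_contour_integral
      2 * of_real pi * \<i> * (\<Sum>\<^sub>\<infinity>e\<in>E m. \<Prod>p\<in>A. c p ^ e p)) (circlepath 0 R)"
    and "(\<lambda>e. \<Prod>p\<in>A. c p ^ e p) summable_on E m"
proof -
  have norm: "norm (c p * z powi w p) < 1" if "p \<in> A" "norm z = R" for p z
    using small[OF that(1)] that(2) by (simp add: norm_mult norm_power_int)
  have "(\<lambda>e. norm (\<Prod>p\<in>A. (c p * of_real R powi w p) ^ e p)) summable_on (A \<rightarrow>\<^sub>E UNIV)"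
    by (rule abs_summable_on_prod_geometric[OF A]) (use norm R in auto)
  moreover have "norm (\<Prod>p\<in>A. (c p * of_real R powi w p) ^ e p)
      = norm (\<Prod>p\<in>A. c p ^ e p) * R powi (\<Sum>p\<in>A. int (e p) * w p)" for e
    using prod_powi_eq_powi_sum[OF A, of "of_real R" c w e] R by (simp add: norm_mult norm_power_int)
  ultimately have summ: "(\<lambda>e. norm (\<Prod>p\<in>A. c p ^ e p) * R powi (\<Sum>p\<in>A. int (e p) * w p)) summable_on (A \<rightarrow>\<^sub>E UNIV)"
    by simp
  show "(\<lambda>e. \<Prod>p\<in>A. c p ^ e p) summable_on E m"
    using contour_integral_laurent_sum(2)[OF R summ] unfolding E_def .
  show "((\<lambda>z. z powi (- m - 1) * (\<Prod>p\<in>A. 1 / (1 - c p * z powi w p))) has_contour_integral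
      2 * of_real pi * \<i> * (\<Sum>\<^sub>\<infinity>e\<in>E m. \<Prod>p\<in>A. c p ^ e p)) (circlepath 0 R)"
  proof (rule has_contour_integral_eq[OF contour_integral_laurent_sum(1)[OF R summ, of m, folded E_def]])
    fix z :: complex assume "z \<in> path_image (circlepath 0 R)"
    then have z: "norm z = R" "z \<noteq> 0" using R by auto
    show "z powi (- m - 1) * (\<Sum>\<^sub>\<infinity>e\<in>A \<rightarrow>\<^sub>E UNIV. (\<Prod>p\<in>A. c p ^ e p) * z powi (\<Sum>p\<in>A. int (e p) * w p))
        = z powi (- m - 1) * (\<Prod>p\<in>A. 1 / (1 - c p * z powi w p))"
      unfolding prod_powi_eq_powi_sum[OF A z(2), symmetric]
      using infsum_prod_geometric[OF A norm[OF _ z(1)]] by simp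
  qed
qed

section \<open>The integrand, its Laurent coefficients and its expansion near 0\<close>

lemma Lam_subset: "Lam r d \<subseteq> idx {1..r} d"
  by (auto simp: Lam_def)

lemma finite_Lam: "finite (Lam r d)"
  by (rule finite_subset[OF Lam_subset]) auto

lemma wt_pos: "p \<in> Lam r d \<Longrightarrow> wt d p > 0"
  by (auto simp: Lam_def wt_def)

lemma wt_eq_int:
  assumes "p \<in> Lam r d" obtains a where "wt d p = int a" "a > 0"
  using wt_pos[OF assms] by (metis zero_less_imp_eq_int)

lemma mult_wt_nonneg: "p \<in> Lam r d \<Longrightarrow> 0 \<le> int n * wt d p"
  using wt_pos[of p r d] by simp

lemma fst_Lam: "p \<in> Lam r d \<Longrightarrow> fst p \<in> {1..r}"
  by (auto simp: Lam_def)

text \<open>The reflection of i into d k - i matches negative with positive weights, and weight 0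
  occurs once for each even \<open>d k\<close>, in the middle of the block.\<close>

lemma prod_weights_split:
  fixes f :: "nat \<Rightarrow> int \<Rightarrow> 'a::comm_monoid_mult"
  shows "(\<Prod>p\<in>idx {1..r} d. f (fst p) (wt d p))
    = (\<Prod>k\<in>{k\<in>{1..r}. even (d k)}. f k 0) * (\<Prod>p\<in>Lam r d. f (fst p) (wt d p) * f (fst p) (- wt d p))"
proof -
  define N where "N = {p \<in> idx {1..r} d. wt d p < 0}"
  define Z where "Z = {p \<in> idx {1..r} d. wt d p = 0}"
  have Lam: "Lam r d = {p \<in> idx {1..r} d. wt d p > 0}"
    by (auto simp: Lam_def wt_def)
  have ev: "even (d k)" if "2 * int i = int (d k)" for k i using that by presburger
  have fin: "finite (idx {1..r} d)" by auto
  have split: "idx {1..r} d = Lam r d \<union> N \<union> Z" unfolding Lam N_def Z_def by auto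
  have "(\<Prod>p\<in>idx {1..r} d. f (fst p) (wt d p)) = (\<Prod>p\<in>Lam r d \<union> N. f (fst p) (wt d p)) * (\<Prod>p\<in>Z. f (fst p) (wt d p))"
    unfolding split using fin by (intro prod.union_disjoint) (auto simp: Lam N_def Z_def)
  also have "(\<Prod>p\<in>Lam r d \<union> N. f (fst p) (wt d p)) = (\<Prod>p\<in>Lam r d. f (fst p) (wt d p)) * (\<Prod>p\<in>N. f (fst p) (wt d p))"
    using fin by (intro prod.union_disjoint) (auto simp: Lam N_def Z_def)
  also have "(\<Prod>p\<in>N. f (fst p) (wt d p)) = (\<Prod>p\<in>Lam r d. f (fst p) (- wt d p))"
    by (rule prod.reindex_bij_witness[of _ "\<lambda>(k, i). (k, d k - i)" "\<lambda>(k, i). (k, d k - i)"])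
      (auto simp: N_def Lam wt_def of_nat_diff)
  also have "(\<Prod>p\<in>Z. f (fst p) (wt d p)) = (\<Prod>k\<in>{k\<in>{1..r}. even (d k)}. f k 0)"
    by (rule prod.reindex_bij_witness[of _ "\<lambda>k. (k, d k div 2)" fst])
      (auto simp: Z_def wt_def ev)
  finally show ?thesis by (simp add: prod.distrib mult_ac)
qed

text \<open>Written over the positive weights, so that the factors with zeros inside the unit disc
  stand apart from those with zeros outside. The two powers of z extract the coefficients of weight
  L and -L-2.\<close>

definition integrand :: "nat \<Rightarrow> (nat \<Rightarrow> nat) \<Rightarrow> nat \<Rightarrow> (nat \<Rightarrow> complex) \<Rightarrow> complex \<Rightarrow> complex" where
  "integrand r d L t z = (z powi (- int L - 1) - z powi (int L + 1)) * (1 / even_prod r d t) *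
     (\<Prod>p\<in>Lam r d. 1 / ((1 - t (fst p) * z powi wt d p) * (1 - t (fst p) * z powi (- wt d p))))"

definition weight_coeff :: "nat \<Rightarrow> (nat \<Rightarrow> nat) \<Rightarrow> (nat \<Rightarrow> complex) \<Rightarrow> int \<Rightarrow> complex" where
  "weight_coeff r d t m = (\<Sum>\<^sub>\<infinity>e\<in>{e \<in> idx {1..r} d \<rightarrow>\<^sub>E UNIV. mwt {1..r} d e = m}. \<Prod>p\<in>idx {1..r} d. t (fst p) ^ e p)"

lemma integrand_eq:
  "integrand r d L t z = (z powi (- int L - 1) - z powi (int L + 1)) *
     (\<Prod>p\<in>idx {1..r} d. 1 / (1 - t (fst p) * z powi wt d p))"
  unfolding prod_weights_split[of "\<lambda>k w. 1 / (1 - t k * z powi w)"]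
  by (simp add: integrand_def even_prod_def prod_dividef)

lemma weight_coeff_summable:
  fixes t :: "nat \<Rightarrow> complex"
  assumes "\<And>k. k \<in> {1..r} \<Longrightarrow> norm (t k) < 1"
  shows "(\<lambda>e. \<Prod>p\<in>idx {1..r} d. t (fst p) ^ e p) summable_on {e \<in> idx {1..r} d \<rightarrow>\<^sub>E UNIV. mwt {1..r} d e = m}"
  unfolding mwt_def
  by (rule contour_integral_prod_geometric(2)[where R = 1 and c = "\<lambda>p. t (fst p)" and w = "wt d"])
    (use assms in auto)

lemma integrand_unit_circle:
  assumes "\<And>k. k \<in> {1..r} \<Longrightarrow> norm (t k) < 1"
  shows "(integrand r d L t has_contour_integral
    2 * of_real pi * \<i> * (weight_coeff r d t (int L) - weight_coeff r d t (- int L - 2))) (circlepath 0 1)"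
proof -
  have *: "((\<lambda>z. z powi (- m - 1) * (\<Prod>p\<in>idx {1..r} d. 1 / (1 - t (fst p) * z powi wt d p))) has_contour_integral
      2 * of_real pi * \<i> * weight_coeff r d t m) (circlepath 0 1)" for m
    unfolding weight_coeff_def mwt_def
    by (rule contour_integral_prod_geometric(1)) (use assms in auto)
  from has_contour_integral_diff[OF *[of "int L"] *[of "- int L - 2"]]
  show ?thesis
    by (simp add: integrand_eq[abs_def] left_diff_distrib right_diff_distrib add.commute)
qed

text \<open>All weights are at least 1, so no entry of I or J can exceed nu - 1. Finiteness turns
  the series for the residue at 0 into an ordinary sum.\<close>

lemma finite_S_set: "finite (S_set r d L)"
proof (rule finite_subset)
  let ?B = "Lam r d \<rightarrow>\<^sub>E {..nat (nu r d L - 1)}"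
  show "finite (?B \<times> ?B)" by (intro finite_cartesian_product finite_PiE finite_Lam) auto
  have bound: "I q + J q \<le> nat (nu r d L - 1)" if "(I, J) \<in> S_set r d L" "q \<in> Lam r d" for I J q
  proof -
    have "int (I q + J q) \<le> int (I q + J q) * wt d q"
      using wt_pos[OF that(2)] mult_left_mono[of 1 "wt d q" "int (I q + J q)"] by simp
    also have "\<dots> \<le> (\<Sum>p\<in>Lam r d. int (I p + J p) * wt d p)"
      by (rule member_le_sum[OF that(2) _ finite_Lam]) (rule mult_wt_nonneg, blast)
    also have "\<dots> = nu r d L - 1" using that(1) by (auto simp: S_set_def)
    finally show ?thesis by simp
  qed
  show "S_set r d L \<subseteq> ?B \<times> ?B"
  proof clarify
    fix I J assume IJ: "(I, J) \<in> S_set r d L"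
    have "I \<in> Lam r d \<rightarrow>\<^sub>E UNIV" "J \<in> Lam r d \<rightarrow>\<^sub>E UNIV" using IJ by (auto simp: S_set_def)
    then show "I \<in> ?B \<and> J \<in> ?B"
      using bound[OF IJ] by (auto simp: PiE_iff dest: add_leD1 add_leD2)
  qed
qed

definition correction :: "nat \<Rightarrow> (nat \<Rightarrow> nat) \<Rightarrow> nat \<Rightarrow> (nat \<Rightarrow> complex) \<Rightarrow> complex" where
  "correction r d L t = (-1) ^ card (Lam r d) / even_prod r d t *
     (\<Sum>(I, J)\<in>S_set r d L. \<Prod>p\<in>Lam r d. t (fst p) powi (int (I p) - int (J p) - 1))"

text \<open>Inside the circles of radius |t_K| the factors 1 - t z^(-a) no longer expand in negative
  powers. Rewritten as - t z^(-a) (1 - t^(-1) z^a) they expand in positive ones, and the Laurent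
  coefficient needed becomes a finite sum.\<close>

lemma integrand_small_circle:
  assumes t: "\<And>k. k \<in> {1..r} \<Longrightarrow> 0 < norm (t k)" "\<And>k. k \<in> {1..r} \<Longrightarrow> norm (t k) < 1"
    and R: "0 < R" "R < 1" "\<And>p. p \<in> Lam r d \<Longrightarrow> R < norm (t (fst p))"
  shows "(integrand r d L t has_contour_integral 2 * of_real pi * \<i> * correction r d L t) (circlepath 0 R)"
proof -
  \<comment> \<open>\<open>False\<close> marks the factor 1 - t z^a, whose exponent becomes I, and
    \<open>True\<close> the factor 1 - t^(-1) z^a, whose exponent becomes J. The constants split off
    go into \<open>\<kappa>\<close>, the powers of z split off into \<open>s\<close>.\<close>
  define A where "A = Lam r d \<times> (UNIV :: bool set)"
  define c where "c = (\<lambda>(p :: nat \<times> nat, b). if b then inverse (t (fst p)) else t (fst p))"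
  define w where "w = (\<lambda>(p, b :: bool). wt d p)"
  define E where "E m = {e \<in> A \<rightarrow>\<^sub>E UNIV. (\<Sum>p\<in>A. int (e p) * w p) = m}" for m
  define s where "s = (\<Sum>p\<in>Lam r d. wt d p)"
  define \<kappa> where "\<kappa> = (1 / even_prod r d t) * (\<Prod>p\<in>Lam r d. - inverse (t (fst p)))"
  have A: "finite A" by (simp add: A_def finite_Lam)
  have t0: "t (fst p) \<noteq> 0" if "p \<in> Lam r d" for p
    using t(1)[OF fst_Lam[OF that]] by auto
  have sum_A: "(\<Sum>x\<in>A. f x) = (\<Sum>p\<in>Lam r d. f (p, False) + f (p, True))" for f :: "_ \<Rightarrow> 'b::comm_monoid_add"
    using sum.cartesian_product[of "\<lambda>p b. f (p, b)" "UNIV :: bool set" "Lam r d"]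
    by (simp add: A_def UNIV_bool add.commute)
  have prod_A: "(\<Prod>x\<in>A. f x) = (\<Prod>p\<in>Lam r d. f (p, False) * f (p, True))" for f :: "_ \<Rightarrow> complex"
    using prod.cartesian_product[of "\<lambda>p b. f (p, b)" "UNIV :: bool set" "Lam r d"]
    by (simp add: A_def UNIV_bool mult.commute)
  have small: "norm (c p) * R powi w p < 1" if p: "p \<in> A" for p
  proof -
    obtain q b where q: "p = (q, b)" "q \<in> Lam r d" using p by (auto simp: A_def)
    obtain a where a: "wt d q = int a" "a > 0" using wt_eq_int[OF q(2)] .
    \<comment> \<open>Since R < 1 and a \<ge> 1, a radius below every |t_K| also makes R^a / |t_K|
      less than 1.\<close>
    have "R ^ a \<le> R" using R a by (intro power_le_one_iff[THEN iffD2] power_decreasing[of 1 a R, simplified]) auto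
    then have "R ^ a < norm (t (fst q))" "R ^ a < 1" using R(2) R(3)[OF q(2)] by auto
    moreover have "norm (t (fst q)) * R ^ a \<le> 1 * R ^ a"
      using t(2)[OF fst_Lam[OF q(2)]] R(1) by (intro mult_right_mono) auto
    ultimately show ?thesis
      using t(1)[OF fst_Lam[OF q(2)]] by (auto simp: q c_def w_def a norm_inverse norm_divide field_simps)
  qed
  have int: "((\<lambda>z. z powi (- m - 1) * (\<Prod>p\<in>A. 1 / (1 - c p * z powi w p))) has_contour_integral
      2 * of_real pi * \<i> * (\<Sum>\<^sub>\<infinity>e\<in>E m. \<Prod>p\<in>A. c p ^ e p)) (circlepath 0 R)" for m
    unfolding E_def by (rule contour_integral_prod_geometric(1)[OF A R(1) small])
  \<comment> \<open>Only positive weights are left, so no exponent reaches this negative total: the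
    term with z^(L+1) contributes nothing at 0.\<close>
  have neg: "E (- int L - 2 - s) = {}"
  proof -
    have "s \<ge> 0" unfolding s_def by (rule sum_nonneg) (use wt_pos[of _ r d] in force)
    moreover have "(\<Sum>p\<in>A. int (e p) * w p) \<ge> 0" for e
      unfolding w_def A_def by (rule sum_nonneg) (auto intro: mult_wt_nonneg)
    ultimately show ?thesis unfolding E_def by (smt (verit, best) Collect_empty_eq of_nat_0_le_iff)
  qed
  have "((\<lambda>z. \<kappa> * (z powi (- (int L - s) - 1) * (\<Prod>p\<in>A. 1 / (1 - c p * z powi w p))
          - z powi (- (- int L - 2 - s) - 1) * (\<Prod>p\<in>A. 1 / (1 - c p * z powi w p)))) has_contour_integral
      \<kappa> * (2 * of_real pi * \<i> * (\<Sum>\<^sub>\<infinity>e\<in>E (int L - s). \<Prod>p\<in>A. c p ^ e p)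
          - 2 * of_real pi * \<i> * (\<Sum>\<^sub>\<infinity>e\<in>E (- int L - 2 - s). \<Prod>p\<in>A. c p ^ e p))) (circlepath 0 R)"
    by (intro has_contour_integral_lmul has_contour_integral_diff int)
  moreover have "\<kappa> * (z powi (- (int L - s) - 1) * (\<Prod>p\<in>A. 1 / (1 - c p * z powi w p))
          - z powi (- (- int L - 2 - s) - 1) * (\<Prod>p\<in>A. 1 / (1 - c p * z powi w p))) = integrand r d L t z"
    if "z \<in> path_image (circlepath 0 R)" for z
  proof -
    have z: "z \<noteq> 0" using that R by auto
    have "(\<Prod>p\<in>Lam r d. 1 / ((1 - t (fst p) * z powi wt d p) * (1 - t (fst p) * z powi (- wt d p))))
        = (\<Prod>p\<in>Lam r d. - inverse (t (fst p)) * z powi wt d p *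
            (1 / (1 - t (fst p) * z powi wt d p) * (1 / (1 - inverse (t (fst p)) * z powi wt d p))))"
    proof (rule prod.cong[OF refl])
      fix p assume p: "p \<in> Lam r d"
      let ?x = "z powi wt d p" and ?t = "t (fst p)"
      have "1 - ?t * z powi (- wt d p) = - ?t * inverse ?x * (1 - inverse ?t * ?x)"
        using t0[OF p] z by (simp add: power_int_minus field_simps)
      then show "1 / ((1 - ?t * ?x) * (1 - ?t * z powi (- wt d p)))
          = - inverse ?t * ?x * (1 / (1 - ?t * ?x) * (1 / (1 - inverse ?t * ?x)))"
        by (simp add: divide_inverse)
    qed
    also have "\<dots> = (\<Prod>p\<in>Lam r d. - inverse (t (fst p))) * z powi s * (\<Prod>p\<in>A. 1 / (1 - c p * z powi w p))"
    proof -
      have "(\<Prod>p\<in>Lam r d. z powi wt d p) = z powi s"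
        unfolding s_def using finite_Lam z by (induction rule: finite_induct) (auto simp: power_int_add)
      then show ?thesis
        by (simp only: prod.distrib prod_A c_def w_def prod.case if_True if_False)
    qed
    finally have "integrand r d L t z = \<kappa> * ((z powi (- int L - 1) - z powi (int L + 1)) * z powi s * (\<Prod>p\<in>A. 1 / (1 - c p * z powi w p)))"
      by (simp add: integrand_def \<kappa>_def)
    also have "(z powi (- int L - 1) - z powi (int L + 1)) * z powi s = z powi (- (int L - s) - 1) - z powi (- (- int L - 2 - s) - 1)"
      using z by (simp add: left_diff_distrib power_int_add[symmetric] algebra_simps)
    finally show ?thesis by (simp add: left_diff_distrib)
  qed
  ultimately have "(integrand r d L t has_contour_integral
      \<kappa> * (2 * of_real pi * \<i> * (\<Sum>\<^sub>\<infinity>e\<in>E (int L - s). \<Prod>p\<in>A. c p ^ e p)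
          - 2 * of_real pi * \<i> * (\<Sum>\<^sub>\<infinity>e\<in>E (- int L - 2 - s). \<Prod>p\<in>A. c p ^ e p))) (circlepath 0 R)"
    by (rule has_contour_integral_eq)
  then have "(integrand r d L t has_contour_integral
      2 * of_real pi * \<i> * (\<kappa> * (\<Sum>\<^sub>\<infinity>e\<in>E (int L - s). \<Prod>p\<in>A. c p ^ e p))) (circlepath 0 R)"
    unfolding neg by (simp add: mult_ac)
  also have "\<kappa> * (\<Sum>\<^sub>\<infinity>e\<in>E (int L - s). \<Prod>p\<in>A. c p ^ e p) = correction r d L t"
  proof -
    define h where "h = (\<lambda>(I, J). \<lambda>x\<in>A. if snd x then J (fst x) else I (fst x :: nat \<times> nat) :: nat)"
    define g where "g e = (\<lambda>p\<in>Lam r d. e (p, False) :: nat, \<lambda>p\<in>Lam r d. e (p, True) :: nat)" for e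
    \<comment> \<open>The shift by \<open>s\<close> turns the target weight L into
      \<open>nu r d L - 1\<close>, the defining condition of \<open>S_set\<close>.\<close>
    have nu: "nu r d L - 1 = int L - s" by (simp add: nu_def s_def)
    have h_wt: "(\<Sum>x\<in>A. int (h (I, J) x) * w x) = (\<Sum>p\<in>Lam r d. int (I p + J p) * wt d p)" for I J
      unfolding sum_A by (rule sum.cong) (auto simp: h_def w_def A_def algebra_simps)
    have "bij_betw h (S_set r d L) (E (int L - s))"
    proof (rule bij_betwI[where g = g])
      show "h \<in> S_set r d L \<rightarrow> E (int L - s)"
      proof clarify
        fix I J assume "(I, J) \<in> S_set r d L"
        moreover have "h (I, J) \<in> A \<rightarrow>\<^sub>E UNIV" by (simp add: h_def)
        ultimately show "h (I, J) \<in> E (int L - s)" by (simp add: E_def h_wt S_set_def nu)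
      qed
      show "h (g e) = e" if "e \<in> E (int L - s)" for e
      proof
        fix x
        have "e \<in> A \<rightarrow>\<^sub>E UNIV" using that by (simp add: E_def)
        then show "h (g e) x = e x"
          using PiE_arb[of e A "\<lambda>_. UNIV" x]
          by (cases x; cases "x \<in> A"; cases "snd x") (auto simp: h_def g_def A_def)
      qed
      note hg = this
      show "g \<in> E (int L - s) \<rightarrow> S_set r d L"
      proof (rule funcsetI)
        fix e assume e: "e \<in> E (int L - s)"
        obtain I J where IJ: "g e = (I, J)" "I \<in> Lam r d \<rightarrow>\<^sub>E UNIV" "J \<in> Lam r d \<rightarrow>\<^sub>E UNIV"
          by (simp add: g_def)
        have "(\<Sum>p\<in>A. int (e p) * w p) = int L - s" using e by (simp add: E_def)
        then have "(\<Sum>p\<in>Lam r d. int (I p + J p) * wt d p) = nu r d L - 1"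
          using h_wt[of I J] hg[OF e] unfolding IJ(1) nu by simp
        then show "g e \<in> S_set r d L" using IJ by (simp add: S_set_def)
      qed
      show "g (h x) = x" if xS: "x \<in> S_set r d L" for x
      proof -
        obtain I J where x: "x = (I, J)" "I \<in> Lam r d \<rightarrow>\<^sub>E UNIV" "J \<in> Lam r d \<rightarrow>\<^sub>E UNIV"
          using xS unfolding S_set_def by blast
        have "restrict I (Lam r d) = I" "restrict J (Lam r d) = J"
          using x by (auto intro!: extensional_restrict simp: PiE_def)
        moreover have "g (h (I, J)) = (restrict I (Lam r d), restrict J (Lam r d))"
          by (auto simp: g_def h_def A_def fun_eq_iff)
        ultimately show ?thesis by (simp add: x(1))
      qed
    qed
    then have "(\<Sum>\<^sub>\<infinity>e\<in>E (int L - s). \<Prod>p\<in>A. c p ^ e p) = (\<Sum>\<^sub>\<infinity>x\<in>S_set r d L. \<Prod>p\<in>A. c p ^ h x p)"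
      by (rule infsum_reindex_bij_betw[symmetric])
    also have "\<dots> = (\<Sum>x\<in>S_set r d L. \<Prod>p\<in>A. c p ^ h x p)"
      by (rule infsum_finite[OF finite_S_set])
    finally have "\<kappa> * (\<Sum>\<^sub>\<infinity>e\<in>E (int L - s). \<Prod>p\<in>A. c p ^ e p)
        = (\<Sum>x\<in>S_set r d L. \<kappa> * (\<Prod>p\<in>A. c p ^ h x p))"
      by (simp add: sum_distrib_left)
    also have "\<dots> = (\<Sum>(I, J)\<in>S_set r d L. (-1) ^ card (Lam r d) / even_prod r d t *
        (\<Prod>p\<in>Lam r d. t (fst p) powi (int (I p) - int (J p) - 1)))"
    proof (intro sum.cong refl, clarify)
      fix I J
      have "(\<Prod>p\<in>Lam r d. - inverse (t (fst p))) * (\<Prod>p\<in>A. c p ^ h (I, J) p)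
          = (\<Prod>p\<in>Lam r d. (-1) * t (fst p) powi (int (I p) - int (J p) - 1))"
        unfolding prod_A prod.distrib[symmetric]
      proof (rule prod.cong[OF refl])
        fix p assume p: "p \<in> Lam r d"
        have "t (fst p) powi (int (I p) - int (J p) - 1) = t (fst p) ^ I p * inverse (t (fst p)) ^ J p * inverse (t (fst p))"
          using t0[OF p] by (simp add: power_int_diff power_int_add field_simps)
        then show "- inverse (t (fst p)) * (c (p, False) ^ h (I, J) (p, False) * c (p, True) ^ h (I, J) (p, True))
            = (-1) * t (fst p) powi (int (I p) - int (J p) - 1)"
          using p by (simp add: c_def h_def A_def)
      qed
      then show "\<kappa> * (\<Prod>p\<in>A. c p ^ h (I, J) p) = (-1) ^ card (Lam r d) / even_prod r d t *
          (\<Prod>p\<in>Lam r d. t (fst p) powi (int (I p) - int (J p) - 1))"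
        unfolding prod.distrib[of "\<lambda>_. - 1"] prod_constant by (simp add: \<kappa>_def)
    qed
    also have "\<dots> = correction r d L t"
      by (simp add: correction_def sum_distrib_left case_prod_unfold)
    finally show ?thesis .
  qed
  finally show ?thesis .
qed

subsection \<open>Residues\<close>

definition poles :: "(nat \<Rightarrow> nat) \<Rightarrow> (nat \<Rightarrow> complex) \<Rightarrow> nat \<times> nat \<Rightarrow> complex set" where
  "poles d t q = {z. z powi wt d q = t (fst q)}"

lemma poles_iff:
  assumes "z \<noteq> 0" shows "z \<in> poles d t q \<longleftrightarrow> 1 - t (fst q) * z powi (- wt d q) = 0"
  using assms by (auto simp: poles_def power_int_minus field_simps)

lemma finite_roots_of_unity_powi:
  assumes "q \<in> Lam r d" shows "finite {\<zeta> :: complex. \<zeta> powi wt d q = 1}"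
proof -
  obtain a where a: "wt d q = int a" "a > 0" using wt_eq_int[OF assms] .
  then show ?thesis using finite_roots_unity[of a] by simp
qed

text \<open>The chosen logarithm singles out one root of z^a = t_K; all others differ from it by a
  root of unity.\<close>

lemma poles_eq_image:
  assumes "q \<in> Lam r d" "exp (u (fst q)) = t (fst q)"
  shows "poles d t q = (\<lambda>\<zeta>. \<zeta> * lpow (u (fst q)) (1 / of_int (wt d q))) ` {\<zeta>. \<zeta> powi wt d q = 1}"
proof -
  let ?\<tau> = "lpow (u (fst q)) (1 / of_int (wt d q))"
  have a: "wt d q \<noteq> 0" using wt_pos[OF assms(1)] by simp
  have \<tau>: "?\<tau> powi wt d q = t (fst q)" "?\<tau> \<noteq> 0"
    using a assms(2) by (simp_all add: lpow_def exp_power_int)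
  show ?thesis
  proof (intro antisym subsetI)
    fix z assume "z \<in> poles d t q"
    then have "(z / ?\<tau>) powi wt d q = 1"
      using \<tau> by (auto simp: poles_def power_int_divide_distrib)
    moreover have "z = z / ?\<tau> * ?\<tau>" using \<tau> by simp
    ultimately show "z \<in> (\<lambda>\<zeta>. \<zeta> * ?\<tau>) ` {\<zeta>. \<zeta> powi wt d q = 1}" by blast
  qed (auto simp: poles_def power_int_mult_distrib \<tau>)
qed

lemma lpow_of_int_divide:
  "lpow u (of_int n / of_int a) = lpow u (1 / of_int a) powi n"
  by (simp add: lpow_def exp_power_int)

lemma even_prod_nonzero:
  assumes "\<And>k. k \<in> {1..r} \<Longrightarrow> norm (t k) < 1" shows "even_prod r d t \<noteq> 0"
  using assms by (force simp: even_prod_def)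

lemma norm_mult_powi_less_1:
  assumes "p \<in> Lam r d" "norm (t (fst p)) < 1" "norm z \<le> (1 :: real)"
  shows "norm (t (fst p) * z powi wt d p :: complex) < 1"
proof -
  have "norm z powi wt d p \<le> 1"
  proof -
    obtain a where a: "wt d p = int a" using wt_eq_int[OF assms(1)] by blast
    show ?thesis using assms(3) by (simp add: a power_le_one)
  qed
  then have "norm (t (fst p)) * norm z powi wt d p \<le> norm (t (fst p))"
    by (intro mult_left_le) auto
  then show ?thesis using assms(2) by (simp add: norm_mult norm_power_int)
qed

lemma norm_pole_less_1:
  assumes "q \<in> Lam r d" "norm (t (fst q)) < 1" "z \<in> poles d t q"
  shows "norm z < 1"
proof (rule ccontr)
  assume "\<not> norm z < 1"
  obtain a where a: "wt d q = int a" using wt_eq_int[OF assms(1)] by blast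
  have "norm z ^ a \<ge> 1" using \<open>\<not> norm z < 1\<close> by (simp add: one_le_power)
  moreover have "norm z ^ a = norm (t (fst q))"
    using assms(3) by (simp add: poles_def a norm_power[symmetric])
  ultimately show False using assms(2) by simp
qed

text \<open>Inside the unit disc |z| \<ge> |z|^a = |t_K| because a \<ge> 1. This keeps the poles
  away from a small circle around 0.\<close>

lemma norm_pole_gt:
  assumes "q \<in> Lam r d" "z \<in> poles d t q" "norm z < 1"
  shows "norm (t (fst q)) \<le> norm z"
proof -
  obtain a where a: "wt d q = int a" "a > 0" using wt_eq_int[OF assms(1)] .
  have "norm z ^ a \<le> norm z ^ 1" using assms(3) a by (intro power_decreasing) auto
  moreover have "norm z ^ a = norm (t (fst q))"
    using assms(2) by (simp add: poles_def a norm_power[symmetric])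
  ultimately show ?thesis by simp
qed

lemma integrand_holomorphic:
  assumes "\<And>p z. p \<in> Lam r d \<Longrightarrow> z \<in> S \<Longrightarrow> norm (t (fst p) * z powi wt d p) < 1"
    and "0 \<notin> S" "\<And>p z. p \<in> Lam r d \<Longrightarrow> z \<in> S \<Longrightarrow> z \<notin> poles d t p"
  shows "integrand r d L t holomorphic_on S"
proof -
  have "1 - t (fst p) * z powi wt d p \<noteq> 0" if "p \<in> Lam r d" "z \<in> S" for p z
    using assms(1)[OF that] by auto
  moreover have "1 - t (fst p) * z powi (- wt d p) \<noteq> 0" if "p \<in> Lam r d" "z \<in> S" for p z
    using assms(3)[OF that] assms(2) that(2) poles_iff[of z d t p] by auto
  ultimately show ?thesis
    unfolding integrand_def using assms(2) by (intro holomorphic_intros) auto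
qed

text \<open>The factor 1 - t_K z^(-a) has derivative a / z at its zero, so the residue is z / a
  times the remaining factors. The extra z turns the exponents -L-1 and L+1 into -L and L+2, and z^a
  = t_K turns the partner factor into 1 - t_K^2.\<close>

lemma residue_integrand:
  assumes t: "\<And>k. k \<in> {1..r} \<Longrightarrow> norm (t k) < 1" and t0: "t (fst q) \<noteq> 0"
    and q: "q \<in> Lam r d" and u: "exp (u (fst q)) = t (fst q)"
    and \<zeta>: "\<zeta> powi wt d q = 1" and den: "summand_den r d u t q \<zeta> \<noteq> 0"
  shows "residue (integrand r d L t) (\<zeta> * lpow (u (fst q)) (1 / of_int (wt d q)))
    = summand_num d L u q \<zeta> / summand_den r d u t q \<zeta>"
proof -
  define \<tau> where "\<tau> = lpow (u (fst q)) (1 / of_int (wt d q))"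
  define z where "z = \<zeta> * \<tau>"
  define a where "a = wt d q"
  have a: "a > 0" using wt_pos[OF q] by (simp add: a_def)
  have \<tau>: "\<tau> \<noteq> 0" by (simp add: \<tau>_def lpow_def)
  have \<zeta>0: "\<zeta> \<noteq> 0" using \<zeta> wt_pos[OF q] by auto
  have z0: "z \<noteq> 0" using \<tau> \<zeta>0 by (simp add: z_def)
  have "z \<in> poles d t q" unfolding poles_eq_image[of q r d u t, OF q u] z_def \<tau>_def using \<zeta> by blast
  then have za: "z powi a = t (fst q)" by (simp add: poles_def a_def)
  have z1: "norm z < 1" by (rule norm_pole_less_1[OF q _ \<open>z \<in> poles d t q\<close>]) (rule t[OF fst_Lam[OF q]])
  have pow: "\<zeta> powi n * t' * lpow (u (fst q)) (of_int n / of_int a) = t' * z powi n" for n t'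
    unfolding lpow_of_int_divide z_def \<tau>_def a_def by (simp add: power_int_mult_distrib mult_ac)
  define f1 where "f1 p w = 1 - t (fst p) * w powi wt d p" for p w
  define f2 where "f2 p w = 1 - t (fst p) * w powi (- wt d p)" for p w
  have den_eq: "summand_den r d u t q \<zeta> = of_int a * (1 - t (fst q) ^ 2) * even_prod r d t *
      (\<Prod>p\<in>Lam r d - {q}. f2 p z * f1 p z)"
  proof -
    have "1 - \<zeta> powi (- wt d p) * t (fst p) * lpow (u (fst q)) (- of_int (wt d p) / of_int a) = f2 p z" for p
      using pow[of "- wt d p" "t (fst p)"] by (simp add: f2_def)
    moreover have "1 - \<zeta> powi wt d p * t (fst p) * lpow (u (fst q)) (of_int (wt d p) / of_int a) = f1 p z" for p
      using pow[of "wt d p" "t (fst p)"] by (simp add: f1_def)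
    ultimately show ?thesis by (simp add: summand_den_def a_def[symmetric])
  qed
  have num_eq: "summand_num d L u q \<zeta> = z powi (- int L) - z powi (int L + 2)"
  proof -
    have "\<zeta> ^ (L + 2) = \<zeta> powi (int L + 2)" by (metis of_nat_add of_nat_numeral power_int_of_nat)
    then show ?thesis
      using pow[of "- int L" 1] pow[of "int L + 2" 1] unfolding summand_num_def a_def
      by (simp add: add.commute)
  qed
  define f where "f w = (w powi (- int L - 1) - w powi (int L + 1)) * (1 / even_prod r d t) *
      (1 / f1 q w) * (\<Prod>p\<in>Lam r d - {q}. 1 / (f1 p w * f2 p w))" for w
  \<comment> \<open>The punctured unit disc without the poles of the other pairs. It is open and
    contains z, as the non-vanishing denominator excludes a pole shared with another pair.\<close>
  define S where "S = {w. norm w < 1 \<and> w \<noteq> 0} - (\<Union>p\<in>Lam r d - {q}. poles d t p)"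
  have split: "integrand r d L t w = f w / f2 q w" for w
  proof -
    have "(\<Prod>p\<in>Lam r d. 1 / (f1 p w * f2 p w)) = 1 / (f1 q w * f2 q w) * (\<Prod>p\<in>Lam r d - {q}. 1 / (f1 p w * f2 p w))"
      by (rule prod.remove[OF finite_Lam q])
    then show ?thesis by (simp add: integrand_def f_def f1_def f2_def)
  qed
  have prod_nz: "f1 p z \<noteq> 0 \<and> f2 p z \<noteq> 0" if "p \<in> Lam r d - {q}" for p
    using den that finite_Lam[of r d] unfolding den_eq by auto
  have zS: "z \<in> S"
    unfolding S_def using z0 z1 prod_nz by (simp add: poles_iff[OF z0] f2_def)
  have finp: "finite (poles d t p)" if p: "p \<in> Lam r d" for p
  proof -
    obtain b where b: "wt d p = int b" "b > 0" using wt_eq_int[OF p] .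
    then show ?thesis unfolding poles_def using finite_nth_roots[of b "t (fst p)"] by simp
  qed
  have "open S"
  proof -
    have "{w. norm w < 1 \<and> w \<noteq> 0} = ball 0 1 - {0 :: complex}" by auto
    moreover have "closed (\<Union>p\<in>Lam r d - {q}. poles d t p)"
      using finite_Lam[of r d] finp by (intro finite_imp_closed) auto
    ultimately show ?thesis unfolding S_def by (auto intro: open_Diff)
  qed
  then obtain e where e: "e > 0" "ball z e \<subseteq> S" using zS open_contains_ball by blast
  have f1_nz: "f1 p w \<noteq> 0" if "p \<in> Lam r d" "norm w < 1" for p w
    using norm_mult_powi_less_1[of p r d t w] that t[OF fst_Lam[OF that(1)]] by (auto simp: f1_def)
  have f2_nz: "f2 p w \<noteq> 0" if "p \<in> Lam r d - {q}" "w \<in> S" for p w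
    using that poles_iff[of w d t p] by (auto simp: S_def f2_def)
  have "residue (\<lambda>w. f w / f2 q w) z = f z / (of_int a / z)"
  proof (rule residue_simple_pole_deriv)
    have "w \<noteq> 0" "f1 q w \<noteq> 0" "p \<in> Lam r d - {q} \<Longrightarrow> f1 p w \<noteq> 0 \<and> f2 p w \<noteq> 0"
      if "w \<in> ball z e" for w p
    proof -
      have w: "w \<in> S" using that e(2) by blast
      then have "norm w < 1" "w \<noteq> 0" by (auto simp: S_def)
      then show "w \<noteq> 0" "f1 q w \<noteq> 0" "p \<in> Lam r d - {q} \<Longrightarrow> f1 p w \<noteq> 0 \<and> f2 p w \<noteq> 0"
        using w f1_nz[OF q, of w] f1_nz[of p w] f2_nz[of p w] by auto
    qed
    moreover have "f1 p holomorphic_on ball z e" "f2 p holomorphic_on ball z e" for p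
      unfolding f1_def f2_def using e by (auto intro!: holomorphic_intros simp: S_def)
    ultimately show "f holomorphic_on ball z e"
      unfolding f_def using even_prod_nonzero[OF t, where d = d]
      by (intro holomorphic_intros) auto
    show "f2 q holomorphic_on ball z e"
      unfolding f2_def using e by (auto intro!: holomorphic_intros simp: S_def)
    have "((\<lambda>w. w powi (- a)) has_field_derivative of_int (- a) * z powi (- a - 1)) (at z)"
      by (rule derivative_eq_intros refl | use z0 in simp)+
    from DERIV_diff[OF DERIV_const[of 1] DERIV_cmult[OF this, of "t (fst q)"]]
    have "(f2 q has_field_derivative - (t (fst q) * (of_int (- a) * z powi (- a - 1)))) (at z)"
      unfolding f2_def a_def[symmetric] diff_0 .
    \<comment> \<open>Here t_K z^(-a) = 1 is used, leaving a / z.\<close>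
    also have "- (t (fst q) * (of_int (- a) * z powi (- a - 1))) = of_int a / z"
      using z0 t0 unfolding za[symmetric] by (simp add: power_int_diff power_int_minus field_simps)
    finally show "(f2 q has_field_derivative of_int a / z) (at z)" .
    show "f2 q z = 0"
      using z0 t0 za unfolding f2_def a_def[symmetric] by (simp add: power_int_minus)
    \<comment> \<open>Equality would force |z| = 1, but the poles lie strictly inside the disc. The
      residue formula for simple poles asks for a nonzero numerator.\<close>
    have "z powi (- int L - 1) \<noteq> z powi (int L + 1)"
    proof
      assume eq: "z powi (- int L - 1) = z powi (int L + 1)"
      have "z powi (- int L - 1) * z powi (int L + 1) = 1"
        using z0 by (simp add: power_int_add[symmetric])
      then have "norm (z powi (int L + 1) * z powi (int L + 1)) = 1"
        unfolding eq by simp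
      moreover have "z powi (int L + 1) = z ^ Suc L"
        by (metis of_nat_Suc power_int_of_nat add.commute)
      ultimately have "norm z ^ Suc L * norm z ^ Suc L = 1"
        by (simp add: norm_mult norm_power)
      moreover have "norm z ^ Suc L < 1" using z0 z1 by (intro power_Suc_less_one) auto
      ultimately show False
        using mult_strict_mono[of "norm z ^ Suc L" 1 "norm z ^ Suc L" 1] by auto
    qed
    then show "f z \<noteq> 0"
      using even_prod_nonzero[OF t, where d = d] f1_nz[OF q z1] prod_nz finite_Lam[of r d]
      unfolding f_def by auto
  qed (use e a z0 in auto)
  also have "f z / (of_int a / z) = (z * z powi (- int L - 1) - z * z powi (int L + 1)) / (of_int a * f1 q z * even_prod r d t *
      (\<Prod>p\<in>Lam r d - {q}. f2 p z * f1 p z))"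
    by (simp add: f_def prod_dividef algebra_simps diff_divide_distrib)
  also have "z * z powi (- int L - 1) = z powi (- int L)"
    using z0 by (simp add: power_int_diff)
  also have "z * z powi (int L + 1) = z powi (int L + 2)"
    using z0 by (simp add: power_int_add power2_eq_square)
  also have "f1 q z = 1 - t (fst q) ^ 2"
    using za by (simp add: f1_def a_def power2_eq_square)
  finally show ?thesis
    unfolding split[abs_def] num_eq den_eq z_def[symmetric] \<tau>_def[symmetric] .
qed

text \<open>Residue theorem on the unit circle, which winds once around 0 and around every pole. The
  residue at 0 is found by comparison with the integral over a small circle.\<close>

lemma unit_circle_residues:
  assumes t: "\<And>k. k \<in> {1..r} \<Longrightarrow> 0 < norm (t k) \<and> norm (t k) < 1"
    and u: "\<And>k. k \<in> {1..r} \<Longrightarrow> exp (u k) = t k"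
    and den: "\<And>q \<zeta>. q \<in> Lam r d \<Longrightarrow> \<zeta> powi (wt d q) = 1 \<Longrightarrow> summand_den r d u t q \<zeta> \<noteq> 0"
  shows "contour_integral (circlepath 0 1) (integrand r d L t)
    = 2 * of_real pi * \<i> * (correction r d L t + residue_sum r d L u t)"
proof -
  define Z where "Z = (\<Union>q\<in>Lam r d. poles d t q)"
  have t1: "norm (t (fst p)) < 1" "0 < norm (t (fst p))" if "p \<in> Lam r d" for p
    using t[OF fst_Lam[OF that]] by auto
  have img: "poles d t q = (\<lambda>\<zeta>. \<zeta> * lpow (u (fst q)) (1 / of_int (wt d q))) ` {\<zeta>. \<zeta> powi wt d q = 1}"
    if "q \<in> Lam r d" for q
    by (rule poles_eq_image[OF that]) (rule u[OF fst_Lam[OF that]])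
  have finZq: "finite (poles d t q)" if "q \<in> Lam r d" for q
    unfolding img[OF that] using finite_roots_of_unity_powi[OF that] by simp
  have finZ: "finite Z" unfolding Z_def using finite_Lam finZq by auto
  have Z1: "norm z < 1" if "z \<in> Z" for z
    using that norm_pole_less_1 t1 unfolding Z_def by blast
  have Z0: "0 \<notin> Z"
    using t1(2) wt_pos[of _ r d] by (force simp: Z_def poles_def)
  \<comment> \<open>The residue theorem needs an open domain containing the unit circle. By
    continuity, |t_K| \<rho>^a stays below 1 for some \<rho> > 1, so the factors 1 - t_K z^a have no
    zeros in the larger disc.\<close>
  obtain \<rho> where \<rho>: "\<rho> > 1" "\<And>p. p \<in> Lam r d \<Longrightarrow> norm (t (fst p)) * \<rho> powi wt d p < 1"
  proof -
    have "\<forall>\<^sub>F \<rho> in at_right (1::real). \<forall>p\<in>Lam r d. norm (t (fst p)) * \<rho> powi wt d p < 1"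
    proof (rule eventually_ball_finite[OF finite_Lam], rule ballI)
      fix p assume p: "p \<in> Lam r d"
      have "((\<lambda>\<rho>. norm (t (fst p)) * \<rho> powi wt d p) \<longlongrightarrow> norm (t (fst p)) * 1 powi wt d p) (at_right (1::real))"
        by (intro tendsto_intros) auto
      then show "\<forall>\<^sub>F \<rho> in at_right (1::real). norm (t (fst p)) * \<rho> powi wt d p < 1"
        by (rule order_tendstoD) (use t1[OF p] in auto)
    qed
    then have "\<forall>\<^sub>F \<rho> in at_right (1::real). \<rho> > 1 \<and> (\<forall>p\<in>Lam r d. norm (t (fst p)) * \<rho> powi wt d p < 1)"
      using eventually_at_right_less by (rule eventually_conj[rotated])
    from eventually_happens'[OF _ this] show ?thesis using that by auto
  qed
  have small: "norm (t (fst p) * z powi wt d p) < 1" if pz: "p \<in> Lam r d" "norm z < \<rho>" for p z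
  proof -
    obtain a where a: "wt d p = int a" using wt_eq_int[OF pz(1)] by blast
    have "norm (t (fst p)) * norm z ^ a \<le> norm (t (fst p)) * \<rho> ^ a"
      using that(2) by (intro mult_left_mono power_mono) auto
    also have "\<dots> < 1" using \<rho>(2)[OF that(1)] by (simp add: a)
    finally show ?thesis by (simp add: norm_mult norm_power a)
  qed
  have holo: "integrand r d L t holomorphic_on S" if "S \<subseteq> ball 0 \<rho> - insert 0 Z" for S
    using that small by (intro integrand_holomorphic) (auto simp: Z_def)
  have "contour_integral (circlepath 0 1) (integrand r d L t)
      = 2 * pi * \<i> * (\<Sum>z\<in>insert 0 Z. winding_number (circlepath 0 1) z * residue (integrand r d L t) z)"
  proof (rule Residue_theorem[where S = "ball 0 \<rho>"])
    show "path_image (circlepath 0 1) \<subseteq> ball 0 \<rho> - insert 0 Z"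
      using \<rho>(1) Z1 by fastforce
    show "\<forall>z. z \<notin> ball 0 \<rho> \<longrightarrow> winding_number (circlepath 0 1) z = 0"
      using \<rho>(1) by (intro allI impI winding_number_zero_outside[of _ "cball 0 1"]) auto
  qed (use finZ holo in auto)
  also have "(\<Sum>z\<in>insert 0 Z. winding_number (circlepath 0 1) z * residue (integrand r d L t) z)
      = (\<Sum>z\<in>insert 0 Z. residue (integrand r d L t) z)"
    by (intro sum.cong refl) (use Z1 in \<open>auto simp: winding_number_circlepath\<close>)
  also have "\<dots> = residue (integrand r d L t) 0 + (\<Sum>z\<in>Z. residue (integrand r d L t) z)"
    using finZ Z0 by simp
  also have "residue (integrand r d L t) 0 = correction r d L t"
  proof -
    \<comment> \<open>Every pole has norm at least some |t_K|, so the punctured disc of radius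
      \<open>\<delta>\<close> is free of poles. The 1 covers an empty
      \<open>Lam r d\<close>.\<close>
    define \<delta> where "\<delta> = Min (insert 1 ((\<lambda>p. norm (t (fst p))) ` Lam r d))"
    have \<delta>0: "\<delta> > 0"
      unfolding \<delta>_def using finite_Lam[of r d] t1 by (subst Min_gr_iff) auto
    have \<delta>t: "\<delta> \<le> norm (t (fst p))" if "p \<in> Lam r d" for p
      unfolding \<delta>_def using finite_Lam[of r d] that by (auto intro!: Min_le)
    have \<delta>1: "\<delta> \<le> 1"
      unfolding \<delta>_def using finite_Lam[of r d] by (intro Min_le) auto
    have avoid: "z \<notin> Z" if "norm z < \<delta>" for z
      using that norm_pole_gt[of _ r d z t] Z1[of z] \<delta>t unfolding Z_def by fastforce
    have "(integrand r d L t has_contour_integral 2 * pi * \<i> * residue (integrand r d L t) 0) (circlepath 0 (\<delta> / 2))"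
    proof (rule base_residue)
      show "integrand r d L t holomorphic_on ball 0 \<delta> - {0}"
        using avoid \<delta>1 \<rho>(1) by (intro holo) auto
    qed (use \<delta>0 in auto)
    moreover have "(integrand r d L t has_contour_integral 2 * of_real pi * \<i> * correction r d L t) (circlepath 0 (\<delta> / 2))"
    proof (rule integrand_small_circle)
      show "\<delta> / 2 < norm (t (fst p))" if "p \<in> Lam r d" for p
        using \<delta>t[OF that] \<delta>0 by linarith
    qed (use t \<delta>0 \<delta>1 in auto)
    ultimately show ?thesis
      using has_contour_integral_unique by fastforce
  qed
  also have "(\<Sum>z\<in>Z. residue (integrand r d L t) z) = (\<Sum>q\<in>Lam r d. \<Sum>z\<in>poles d t q. residue (integrand r d L t) z)"
    unfolding Z_def
  proof (rule sum.UNION_disjoint)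
    show "\<forall>p\<in>Lam r d. \<forall>q\<in>Lam r d. p \<noteq> q \<longrightarrow> poles d t p \<inter> poles d t q = {}"
    \<comment> \<open>A pole common to p and q makes the factor of p with negative exponent vanish
      in the summand of q, against the assumption on the denominators.\<close>
    proof (intro ballI impI, rule ccontr)
      fix p q assume pq: "p \<in> Lam r d" "q \<in> Lam r d" "p \<noteq> q" "poles d t p \<inter> poles d t q \<noteq> {}"
      then obtain z where z: "z \<in> poles d t p" "z \<in> poles d t q" by blast
      obtain \<zeta> where \<zeta>: "\<zeta> powi wt d q = 1" "z = \<zeta> * lpow (u (fst q)) (1 / of_int (wt d q))"
        using z(2) unfolding img[OF pq(2)] by blast
      have "\<zeta> powi (- wt d p) * lpow (u (fst q)) (- of_int (wt d p) / of_int (wt d q)) = z powi (- wt d p)"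
        using lpow_of_int_divide[of "u (fst q)" "- wt d p" "wt d q"]
        by (simp add: \<zeta>(2) power_int_mult_distrib)
      then have "1 - \<zeta> powi (- wt d p) * t (fst p) * lpow (u (fst q)) (- of_int (wt d p) / of_int (wt d q)) = 0"
        using z(1) t1(2)[OF pq(1)] by (simp add: mult.assoc[symmetric] mult.commute poles_def power_int_minus)
          (metis mult.assoc mult.commute right_inverse norm_zero less_irrefl)
      then have "summand_den r d u t q \<zeta> = 0"
        unfolding summand_den_def using pq finite_Lam[of r d] by (auto intro!: bexI[of _ p])
      then show False using den[OF pq(2) \<zeta>(1)] by simp
    qed
  qed (use finite_Lam finZq in auto)
  also have "\<dots> = residue_sum r d L u t"
    unfolding residue_sum_def
  proof (rule sum.cong[OF refl])
    fix q assume q: "q \<in> Lam r d"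
    have inj: "inj_on (\<lambda>\<zeta>. \<zeta> * lpow (u (fst q)) (1 / of_int (wt d q))) {\<zeta>. \<zeta> powi wt d q = 1}"
      by (auto simp: inj_on_def lpow_def)
    have "residue (integrand r d L t) (\<zeta> * lpow (u (fst q)) (1 / of_int (wt d q)))
        = summand_num d L u q \<zeta> / summand_den r d u t q \<zeta>" if \<zeta>: "\<zeta> powi wt d q = 1" for \<zeta>
      using t1[OF q] t
      by (intro residue_integrand[OF _ _ q u[OF fst_Lam[OF q]] \<zeta> den[OF q \<zeta>]]) auto
    then show "(\<Sum>z\<in>poles d t q. residue (integrand r d L t) z)
        = (\<Sum>\<zeta>\<in>{\<zeta>. \<zeta> powi wt d q = 1}. summand_num d L u q \<zeta> / summand_den r d u t q \<zeta>)"
      unfolding img[OF q] sum.reindex[OF inj] by (intro sum.cong) auto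
  qed
  finally show ?thesis by simp
qed

lemma weight_coeff_has_sum:
  assumes "\<And>k. k \<in> {1..r} \<Longrightarrow> norm (t k) < 1"
  shows "((\<lambda>n. of_nat (card (weight_weight_exps {1..r} d n m)) * (\<Prod>k=1..r. t k ^ n k)) has_sum weight_coeff r d t m)
    (multidegrees r)"
proof -
  define S where "S = {e \<in> idx {1..r} d \<rightarrow>\<^sub>E UNIV. mwt {1..r} d e = m}"
  define T where "T = (SIGMA n:multidegrees r. weight_weight_exps {1..r} d n m)"
  define f where "f e = (\<Prod>p\<in>idx {1..r} d. t (fst p) ^ e p)" for e :: "nat \<times> nat \<Rightarrow> nat"
  have "(f has_sum weight_coeff r d t m) S"
    using has_sum_infsum[OF weight_coeff_summable[OF assms]]
    unfolding f_def[abs_def] S_def weight_coeff_def .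
  note f_sum = this
  \<comment> \<open>Each exponent is filed under its multidegree, so that summing over the finite
    fibres first regroups the series of all monomials into one indexed by multidegrees.\<close>
  have bij: "bij_betw (\<lambda>e. (\<lambda>k\<in>{1..r}. mdeg d e k, e)) S T"
  proof (rule bij_betwI[where g = snd])
    show "(\<lambda>e. (\<lambda>k\<in>{1..r}. mdeg d e k, e)) \<in> S \<rightarrow> T"
      by (auto simp: S_def T_def weight_weight_exps_def degree_weight_exps_def multidegrees_def)
    show "snd \<in> T \<rightarrow> S" by (auto simp: S_def T_def weight_weight_exps_def degree_weight_exps_def)
    show "((\<lambda>k\<in>{1..r}. mdeg d (snd x) k), snd x) = x" if "x \<in> T" for x
    proof -
      obtain n e where x: "x = (n, e)" "n \<in> {1..r} \<rightarrow>\<^sub>E UNIV" "\<forall>k\<in>{1..r}. mdeg d e k = n k"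
        using \<open>x \<in> T\<close> by (auto simp: T_def multidegrees_def weight_weight_exps_def degree_weight_exps_def)
      have "(\<lambda>k\<in>{1..r}. mdeg d e k) = n"
        using x(3) PiE_arb[OF x(2)] by (auto simp: fun_eq_iff restrict_def)
      then show ?thesis by (simp add: x(1))
    qed
  qed auto
  have "((\<lambda>x. f (snd x)) has_sum weight_coeff r d t m) T"
    using has_sum_reindex_bij_betw[OF bij, of "\<lambda>x. f (snd x)"] f_sum by simp
  then show ?thesis unfolding T_def
  proof (rule has_sum_SigmaD)
    fix n
    have "f e = (\<Prod>k=1..r. t k ^ n k)" if "e \<in> weight_weight_exps {1..r} d n m" for e
    proof -
      have "f e = (\<Prod>k=1..r. \<Prod>i\<le>d k. t k ^ e (k, i))"
        by (simp add: f_def prod.Sigma case_prod_unfold)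
      also have "\<dots> = (\<Prod>k=1..r. t k ^ n k)"
        by (rule prod.cong[OF refl])
          (use that in \<open>auto simp: power_sum[symmetric] mdeg_def weight_weight_exps_def degree_weight_exps_def\<close>)
      finally show ?thesis .
    qed
    then have "(\<Sum>e\<in>weight_weight_exps {1..r} d n m. f e) = of_nat (card (weight_weight_exps {1..r} d n m)) * (\<Prod>k=1..r. t k ^ n k)"
      by simp
    then show "((\<lambda>e. f (snd (n, e))) has_sum of_nat (card (weight_weight_exps {1..r} d n m)) * (\<Prod>k=1..r. t k ^ n k))
        (weight_weight_exps {1..r} d n m)"
      by (intro has_sum_finiteI) (auto simp: finite_weight_exps)
  qed
qed

text \<open>\<open>dim_covariants\<close> expresses each dimension as a difference of two counts;
  both series of counts converge separately, so they can be subtracted.\<close>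

lemma hilb_term_has_sum:
  assumes "\<And>k. k \<in> {1..r} \<Longrightarrow> norm (t k) < 1"
  shows "(hilb_term r d L t has_sum (weight_coeff r d t (int L) - weight_coeff r d t (- int L - 2))) (multidegrees r)"
proof -
  let ?h = "\<lambda>m n. of_nat (card (weight_weight_exps {1..r} d n m)) * (\<Prod>k=1..r. t k ^ n k)"
  have "hilb_term r d L t = (\<lambda>n. ?h (int L) n + (-1) * ?h (- int L - 2) n)"
    unfolding hilb_term_def[abs_def] dim_covariants[of r d L, symmetric] by (simp add: algebra_simps)
  then show ?thesis
    using has_sum_add[OF weight_coeff_has_sum[OF assms, where d = d and m = "int L"]
        has_sum_cmult_right[OF weight_coeff_has_sum[OF assms, where d = d and m = "- int L - 2"], where c = "-1"]]
    by simp
qed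

theorem proposition3p1:
  fixes r L :: nat and d :: "nat \<Rightarrow> nat" and t u :: "nat \<Rightarrow> complex"
  assumes "r \<ge> 1"
    and "rep_invariants r d = {0}"
    and "\<And>k. k \<in> {1..r} \<Longrightarrow> 0 < norm (t k) \<and> norm (t k) < 1"
    and "\<And>k. k \<in> {1..r} \<Longrightarrow> exp (u k) = t k"
    and "\<And>q \<zeta>. q \<in> Lam r d \<Longrightarrow> \<zeta> powi (wt d q) = 1 \<Longrightarrow> summand_den r d u t q \<zeta> \<noteq> 0"
  shows "hilb_term r d L t summable_on multidegrees r \<and>
    (nu r d L \<le> 0 \<longrightarrow> Hilb r d L t = residue_sum r d L u t) \<and>
    (nu r d L > 0 \<longrightarrow> Hilb r d L t = residue_sum r d L u t +
       (-1) ^ card (Lam r d) / even_prod r d t *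
       (\<Sum>(I, J)\<in>S_set r d L. \<Prod>p\<in>Lam r d. t (fst p) powi (int (I p) - int (J p) - 1)))"
proof -
  have norm: "norm (t k) < 1" if "k \<in> {1..r}" for k using assms(3)[OF that] by simp
  note sum = hilb_term_has_sum[OF norm, where d = d and L = L]
  \<comment> \<open>Two evaluations of the integral over the unit circle: by series expansion and by
    residues.\<close>
  have "2 * of_real pi * \<i> * (weight_coeff r d t (int L) - weight_coeff r d t (- int L - 2))
      = 2 * of_real pi * \<i> * (correction r d L t + residue_sum r d L u t)"
    by (rule trans[OF contour_integral_unique[OF integrand_unit_circle[OF norm], symmetric]
          unit_circle_residues[OF assms(3-5)]])
  then have Hilb: "Hilb r d L t = residue_sum r d L u t + correction r d L t"
    using infsumI[OF sum] by (simp add: Hilb_def)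
  \<comment> \<open>For nu \<le> 0 a sum of nonnegative terms would have to equal the negative
    number nu - 1, so \<open>S_set r d L\<close> is empty. Both cases of the theorem are thus one
    formula.\<close>
  have "correction r d L t = 0" if "nu r d L \<le> 0"
  proof -
    have "(\<Sum>p\<in>Lam r d. int (I p + J p) * wt d p) \<noteq> nu r d L - 1" for I J :: "nat \<times> nat \<Rightarrow> nat"
    proof -
      have "0 \<le> (\<Sum>p\<in>Lam r d. int (I p + J p) * wt d p)"
        by (rule sum_nonneg) (rule mult_wt_nonneg)
      then show ?thesis using that by linarith
    qed
    then have "S_set r d L = {}" by (auto simp: S_set_def)
    then show ?thesis by (simp add: correction_def)
  qed
  then show ?thesis
    using has_sum_imp_summable[OF sum] Hilb by (simp add: correction_def)
qed

end
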